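(* Let $\mathcal{G}=(G^0,\mathcal{G}^1,r,s)$ be an ultragraph and let $\{R_e,D_A,f_e\}_{e\in\mathcal{G}^1,A\in\mathcal{G}^0}$ be a $\mathcal{G}$-branching system on a measure space $(X,\mu)$. Then there exists a unique representation $\pi:C^*(\mathcal{G})\to B(\mathcal{L}^2(X,\mu))$ such that $\pi(s_e)(\phi)=\Phi_{f_e^{-1}}^{1/2}\cdot(\phi\circ f_e^{-1})$ and $\pi(p_A)(\phi)=\chi_{D_A}\phi$ for all $e\in\mathcal{G}^1$, $A\in\mathcal{G}^0$ and $\phi\in\mathcal{L}^2(X,\mu)$, where $\Phi_{f_e^{-1}}^{1/2}\cdot(\phi\circ f_e^{-1})$ is extended by zero outside $R_e$.
   Context: Standing conventions: measure spaces are $\sigma$-finite; C*-algebras are separable; Hilbert spaces carrying representations (here $\mathcal{L}^2(X,\mu)$) are separable and infinite-dimensional; a representation is a $*$-homomorphism into $B(H)$. Ultragraph: $\mathcal{G}=(G^0,\mathcal{G}^1,r,s)$ consists of countable sets $G^0$ (vertices) and $\mathcal{G}^1$ (edges), a map $s:\mathcal{G}^1\to G^0$ and a map $r:\mathcal{G}^1\to P(G^0)\setminus\{\emptyset\}$, $P(G^0)$ being the power set. $\mathcal{G}^0$ denotes the smallest subset of $P(G^0)$ containing $\{v\}$ for all $v\in G^0$ and $r(e)$ for all $e\in\mathcal{G}^1$, and closed under finite unions and nonempty finite intersections (intersections of nonempty finite families); $\emptyset$ is regarded as an element of $\mathcal{G}^0$. A vertex $v$ is identified with $\{v\}$ in subscripts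 ($p_v=p_{\{v\}}$, $D_v=D_{\{v\}}$). $C^*(\mathcal{G})$ is the universal C*-algebra generated by partial isometries $\{s_e:e\in\mathcal{G}^1\}$ with mutually orthogonal ranges and projections $\{p_A:A\in\mathcal{G}^0\}$ such that: (1) $p_\emptyset=0$, $p_Ap_B=p_{A\cap B}$, $p_{A\cup B}=p_A+p_B-p_{A\cap B}$; (2) $s_e^*s_e=p_{r(e)}$; (3) $s_es_e^*\le p_{s(e)}$; (4) $p_v=\sum_{s(e)=v}s_es_e^*$ whenever $0<|s^{-1}(v)|<\infty$. $\mathcal{G}$-branching system on $(X,\mu)$: measurable subsets $\{R_e,D_A\}_{e\in\mathcal{G}^1,A\in\mathcal{G}^0}$ of $X$ with, up to $\mu$-null sets: (1) $R_e\cap R_f=\emptyset$ if $e\ne f$; (2) $D_\emptyset=\emptyset$ (exactly), $D_A\cap D_B=D_{A\cap B}$, $D_A\cup D_B=D_{A\cup B}$; (3) $R_e\subseteq D_{s(e)}$; (4) $D_v=\bigcup_{e\in s^{-1}(v)}R_e$ if $0<|s^{-1}(v)|<\infty$; and (5) for each $e$, measurable maps $f_e:D_{r(e)}\to R_e$ and $f_e^{-1}:R_e\to D_{r(e)}$ with $f_e\circ f_e^{-1}=\mathrm{id}_{R_e}$ and $f_e^{-1}\circ f_e=\mathrm{id}_{D_{r(e)}}$ $\mu$-a.e., such that the pushforward measure $\mu\circ f_e$ on $D_{r(e)}$ (pushforward of $\mu|_{R_e}$ under $f_e^{-1}$) is absolutely continuous with respect to $\mu$ on $D_{r(e)}$,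 and the pushforward measure $\mu\circ f_e^{-1}$ on $R_e$ (pushforward of $\mu|_{D_{r(e)}}$ under $f_e$) is absolutely continuous with respect to $\mu$ on $R_e$. Write $\Phi_{f_e}=d(\mu\circ f_e)/d\mu$ and $\Phi_{f_e^{-1}}=d(\mu\circ f_e^{-1})/d\mu$ for the Radon-Nikodym derivatives. *)

theory Defs
  imports "HOL-Analysis.Analysis" "HOL-Library.Function_Algebras"
begin

section \<open>Ultragraphs\<close>

record ('v, 'e) ultragraph =
  verts :: "'v set"
  edges :: "'e set"
  src :: "'e \<Rightarrow> 'v"
  rng :: "'e \<Rightarrow> 'v set"

definition is_ultragraph :: "('v, 'e) ultragraph \<Rightarrow> bool" where
  "is_ultragraph G \<longleftrightarrow>
     countable (verts G) \<and> countable (edges G) \<and>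
     src G \<in> edges G \<rightarrow> verts G \<and>
     rng G \<in> edges G \<rightarrow> Pow (verts G) - {{}}"

text \<open>The generalized vertices, with the empty set counted as one of them.\<close>

inductive_set gverts :: "('v, 'e) ultragraph \<Rightarrow> 'v set set" for G :: "('v, 'e) ultragraph" where
  empty: "{} \<in> gverts G"
| vertex: "v \<in> verts G \<Longrightarrow> {v} \<in> gverts G"
| range: "e \<in> edges G \<Longrightarrow> rng G e \<in> gverts G"
| union: "A \<in> gverts G \<Longrightarrow> B \<in> gverts G \<Longrightarrow> A \<union> B \<in> gverts G"
| inter: "A \<in> gverts G \<Longrightarrow> B \<in> gverts G \<Longrightarrow> A \<inter> B \<in> gverts G"

definition out_edges :: "('v, 'e) ultragraph \<Rightarrow> 'v \<Rightarrow> 'e set" where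
  "out_edges G v = {e \<in> edges G. src G e = v}"

section \<open>Complex *-algebras and *-homomorphisms\<close>

record 'a star_algebra =
  carr :: "'a set"
  add :: "'a \<Rightarrow> 'a \<Rightarrow> 'a"
  scale :: "complex \<Rightarrow> 'a \<Rightarrow> 'a"
  mult :: "'a \<Rightarrow> 'a \<Rightarrow> 'a"
  star :: "'a \<Rightarrow> 'a"

record 'a normed_star_algebra = "'a star_algebra" +
  nrm :: "'a \<Rightarrow> real"

text \<open>Homomorphisms are extensional, so that two of them are equal iff they agree on the carrier.
  Boundedness is not required, and neither is any unit or nondegeneracy condition.\<close>

definition star_homs ::
  "('a, 'm) star_algebra_scheme \<Rightarrow> ('b, 'n) star_algebra_scheme \<Rightarrow> ('a \<Rightarrow> 'b) set" where
  "star_homs A B = {h \<in> carr A \<rightarrow>\<^sub>E carr B.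
     (\<forall>x\<in>carr A. \<forall>y\<in>carr A. h (add A x y) = add B (h x) (h y)) \<and>
     (\<forall>c. \<forall>x\<in>carr A. h (scale A c x) = scale B c (h x)) \<and>
     (\<forall>x\<in>carr A. \<forall>y\<in>carr A. h (mult A x y) = mult B (h x) (h y)) \<and>
     (\<forall>x\<in>carr A. h (star A x) = star B (h x))}"

definition cstar_seminorm :: "('a, 'm) star_algebra_scheme \<Rightarrow> ('a \<Rightarrow> real) \<Rightarrow> bool" where
  "cstar_seminorm A q \<longleftrightarrow>
     (\<forall>x\<in>carr A. 0 \<le> q x) \<and>
     (\<forall>x\<in>carr A. \<forall>y\<in>carr A. q (add A x y) \<le> q x + q y) \<and>
     (\<forall>c. \<forall>x\<in>carr A. q (scale A c x) = cmod c * q x) \<and>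
     (\<forall>x\<in>carr A. \<forall>y\<in>carr A. q (mult A x y) \<le> q x * q y) \<and>
     (\<forall>x\<in>carr A. q (mult A (star A x) x) = (q x)\<^sup>2)"

section \<open>Hausdorff completion of a *-algebra in a seminorm\<close>

definition sn_dist :: "('a, 'm) star_algebra_scheme \<Rightarrow> ('a \<Rightarrow> real) \<Rightarrow> 'a \<Rightarrow> 'a \<Rightarrow> real" where
  "sn_dist A q x y = q (add A x (scale A (-1) y))"

definition cauchy_seqs :: "('a, 'm) star_algebra_scheme \<Rightarrow> ('a \<Rightarrow> real) \<Rightarrow> (nat \<Rightarrow> 'a) set" where
  "cauchy_seqs A q = {x. (\<forall>n. x n \<in> carr A) \<and>
     (\<forall>\<epsilon>>0. \<exists>N. \<forall>m\<ge>N. \<forall>n\<ge>N. sn_dist A q (x m) (x n) < \<epsilon>)}"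

definition null_rel ::
  "('a, 'm) star_algebra_scheme \<Rightarrow> ('a \<Rightarrow> real) \<Rightarrow> ((nat \<Rightarrow> 'a) \<times> (nat \<Rightarrow> 'a)) set" where
  "null_rel A q = {(x, y). x \<in> cauchy_seqs A q \<and> y \<in> cauchy_seqs A q \<and>
     (\<lambda>n. sn_dist A q (x n) (y n)) \<longlonglongrightarrow> 0}"

definition rep :: "'a set \<Rightarrow> 'a" where
  "rep X = (SOME x. x \<in> X)"

definition completion ::
  "('a, 'm) star_algebra_scheme \<Rightarrow> ('a \<Rightarrow> real) \<Rightarrow> (nat \<Rightarrow> 'a) set normed_star_algebra" where
  "completion A q =
     \<lparr>carr = cauchy_seqs A q // null_rel A q,
      add = (\<lambda>X Y. null_rel A q `` {\<lambda>n. add A (rep X n) (rep Y n)}),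
      scale = (\<lambda>c X. null_rel A q `` {\<lambda>n. scale A c (rep X n)}),
      mult = (\<lambda>X Y. null_rel A q `` {\<lambda>n. mult A (rep X n) (rep Y n)}),
      star = (\<lambda>X. null_rel A q `` {\<lambda>n. star A (rep X n)}),
      nrm = (\<lambda>X. lim (\<lambda>n. q (rep X n)))\<rparr>"

definition to_completion ::
  "('a, 'm) star_algebra_scheme \<Rightarrow> ('a \<Rightarrow> real) \<Rightarrow> 'a \<Rightarrow> (nat \<Rightarrow> 'a) set" where
  "to_completion A q x = null_rel A q `` {\<lambda>n. x}"

section \<open>Free *-algebras\<close>

text \<open>Noncommutative *-polynomials without constant term. A letter \<open>(g, False)\<close> stands for the
  generator \<open>g\<close> and \<open>(g, True)\<close> for its adjoint; a polynomial is the finitely supported function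
  giving the coefficient of each nonempty word. Addition, subtraction and sums of polynomials
  are the pointwise ones.\<close>

type_synonym 'g star_poly = "('g \<times> bool) list \<Rightarrow> complex"

definition sp_mult :: "'g star_poly \<Rightarrow> 'g star_poly \<Rightarrow> 'g star_poly" (infixl \<open>\<odot>\<close> 70) where
  "x \<odot> y = (\<lambda>w. \<Sum>i\<le>length w. x (take i w) * y (drop i w))"

definition sp_star :: "'g star_poly \<Rightarrow> 'g star_poly" where
  "sp_star x = (\<lambda>w. cnj (x (rev (map (\<lambda>(g, b). (g, \<not> b)) w))))"

definition sp_var :: "'g \<Rightarrow> 'g star_poly" where
  "sp_var g = (\<lambda>w. if w = [(g, False)] then 1 else 0)"

definition free_star_algebra :: "'g set \<Rightarrow> 'g star_poly star_algebra" where
  "free_star_algebra X =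
     \<lparr>carr = {x. finite {w. x w \<noteq> 0} \<and> (\<forall>w. x w \<noteq> 0 \<longrightarrow> w \<noteq> [] \<and> fst ` set w \<subseteq> X)},
      add = (\<lambda>x y. x + y),
      scale = (\<lambda>c x w. c * x w),
      mult = sp_mult,
      star = sp_star\<rparr>"

section \<open>The C*-algebra of an ultragraph\<close>

datatype ('v, 'e) gen = Edge 'e | GVert "'v set"

abbreviation sE :: "'e \<Rightarrow> ('v, 'e) gen star_poly" where
  "sE e \<equiv> sp_var (Edge e)"

abbreviation pV :: "'v set \<Rightarrow> ('v, 'e) gen star_poly" where
  "pV A \<equiv> sp_var (GVert A)"

definition ug_free :: "('v, 'e) ultragraph \<Rightarrow> ('v, 'e) gen star_poly star_algebra" where
  "ug_free G = free_star_algebra (Edge ` edges G \<union> GVert ` gverts G)"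

text \<open>The *-polynomials that have to vanish. The order on projections is expressed by
  \<open>q \<le> p\<close> iff \<open>p q = q\<close>.\<close>

inductive_set relators :: "('v, 'e) ultragraph \<Rightarrow> ('v, 'e) gen star_poly set"
  for G :: "('v, 'e) ultragraph" where
  partial_isometry: "e \<in> edges G \<Longrightarrow> sE e \<odot> sp_star (sE e) \<odot> sE e - sE e \<in> relators G"
| orthogonal_ranges: "e \<in> edges G \<Longrightarrow> f \<in> edges G \<Longrightarrow> e \<noteq> f \<Longrightarrow>
    (sE e \<odot> sp_star (sE e)) \<odot> (sE f \<odot> sp_star (sE f)) \<in> relators G"
| proj_selfadjoint: "A \<in> gverts G \<Longrightarrow> sp_star (pV A) - pV A \<in> relators G"
| proj_idempotent: "A \<in> gverts G \<Longrightarrow> pV A \<odot> pV A - pV A \<in> relators G"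
| proj_empty: "pV {} \<in> relators G"
| proj_inter: "A \<in> gverts G \<Longrightarrow> B \<in> gverts G \<Longrightarrow> pV A \<odot> pV B - pV (A \<inter> B) \<in> relators G"
| proj_union: "A \<in> gverts G \<Longrightarrow> B \<in> gverts G \<Longrightarrow>
    pV (A \<union> B) - (pV A + pV B - pV (A \<inter> B)) \<in> relators G"
| source_projection: "e \<in> edges G \<Longrightarrow> sp_star (sE e) \<odot> sE e - pV (rng G e) \<in> relators G"
| range_projection: "e \<in> edges G \<Longrightarrow>
    pV {src G e} \<odot> (sE e \<odot> sp_star (sE e)) - sE e \<odot> sp_star (sE e) \<in> relators G"
| vertex_sum: "v \<in> verts G \<Longrightarrow> finite (out_edges G v) \<Longrightarrow> out_edges G v \<noteq> {} \<Longrightarrow>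
    pV {v} - (\<Sum>e\<in>out_edges G v. sE e \<odot> sp_star (sE e)) \<in> relators G"

text \<open>The universal C*-algebra on these generators and relations is the Hausdorff completion of
  the free *-algebra in the largest C*-seminorm vanishing on the relators. The C*-seminorms
  vanishing on the relators are exactly the functions \<open>x \<mapsto> \<parallel>\<rho>(x)\<parallel>\<close> for \<open>\<rho>\<close> the evaluation at a
  family satisfying the relations in some C*-algebra, so no quantification over C*-algebras
  (hence over types) is needed. The supremum is that of a nonempty set (the zero seminorm
  qualifies) and finite, because every such seminorm is at most 1 on each generator.\<close>

definition ug_norm :: "('v, 'e) ultragraph \<Rightarrow> ('v, 'e) gen star_poly \<Rightarrow> real" where
  "ug_norm G x = Sup {q x | q. cstar_seminorm (ug_free G) q \<and> (\<forall>t\<in>relators G. q t = 0)}"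

definition ug_cstar ::
  "('v, 'e) ultragraph \<Rightarrow> (nat \<Rightarrow> ('v, 'e) gen star_poly) set normed_star_algebra" where
  "ug_cstar G = completion (ug_free G) (ug_norm G)"

definition s_gen :: "('v, 'e) ultragraph \<Rightarrow> 'e \<Rightarrow> (nat \<Rightarrow> ('v, 'e) gen star_poly) set" where
  "s_gen G e = to_completion (ug_free G) (ug_norm G) (sE e)"

definition p_gen :: "('v, 'e) ultragraph \<Rightarrow> 'v set \<Rightarrow> (nat \<Rightarrow> ('v, 'e) gen star_poly) set" where
  "p_gen G A = to_completion (ug_free G) (ug_norm G) (pV A)"

section \<open>Bounded operators on a complex Hilbert space\<close>

text \<open>The inner product is linear in the first argument.\<close>

record 'h hilbert =
  hcarr :: "'h set"
  hadd :: "'h \<Rightarrow> 'h \<Rightarrow> 'h"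
  hscale :: "complex \<Rightarrow> 'h \<Rightarrow> 'h"
  hinner :: "'h \<Rightarrow> 'h \<Rightarrow> complex"

definition hnorm :: "'h hilbert \<Rightarrow> 'h \<Rightarrow> real" where
  "hnorm H x = sqrt (Re (hinner H x x))"

definition bounded_ops_carr :: "'h hilbert \<Rightarrow> ('h \<Rightarrow> 'h) set" where
  "bounded_ops_carr H = {T \<in> hcarr H \<rightarrow>\<^sub>E hcarr H.
     (\<forall>x\<in>hcarr H. \<forall>y\<in>hcarr H. T (hadd H x y) = hadd H (T x) (T y)) \<and>
     (\<forall>c. \<forall>x\<in>hcarr H. T (hscale H c x) = hscale H c (T x)) \<and>
     (\<exists>C. \<forall>x\<in>hcarr H. hnorm H (T x) \<le> C * hnorm H x)}"

definition adjoint_op :: "'h hilbert \<Rightarrow> ('h \<Rightarrow> 'h) \<Rightarrow> 'h \<Rightarrow> 'h" where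
  "adjoint_op H T = (THE S. S \<in> bounded_ops_carr H \<and>
     (\<forall>x\<in>hcarr H. \<forall>y\<in>hcarr H. hinner H (T x) y = hinner H x (S y)))"

definition bounded_ops :: "'h hilbert \<Rightarrow> ('h \<Rightarrow> 'h) normed_star_algebra" where
  "bounded_ops H =
     \<lparr>carr = bounded_ops_carr H,
      add = (\<lambda>S T. \<lambda>x\<in>hcarr H. hadd H (S x) (T x)),
      scale = (\<lambda>c T. \<lambda>x\<in>hcarr H. hscale H c (T x)),
      mult = (\<lambda>S T. compose (hcarr H) S T),
      star = adjoint_op H,
      nrm = (\<lambda>T. Sup {hnorm H (T x) | x. x \<in> hcarr H \<and> hnorm H x \<le> 1})\<rparr>"

definition h_separable :: "'h hilbert \<Rightarrow> bool" where
  "h_separable H \<longleftrightarrow> (\<exists>C\<subseteq>hcarr H. countable C \<and>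
     (\<forall>x\<in>hcarr H. \<forall>\<epsilon>>0. \<exists>y\<in>C. hnorm H (hadd H x (hscale H (-1) y)) < \<epsilon>))"

inductive_set hspan :: "'h hilbert \<Rightarrow> 'h set \<Rightarrow> 'h set" for H :: "'h hilbert" and B :: "'h set" where
  "x \<in> B \<Longrightarrow> x \<in> hspan H B"
| "x \<in> hspan H B \<Longrightarrow> y \<in> hspan H B \<Longrightarrow> hadd H x y \<in> hspan H B"
| "x \<in> hspan H B \<Longrightarrow> hscale H c x \<in> hspan H B"

definition h_infinite_dimensional :: "'h hilbert \<Rightarrow> bool" where
  "h_infinite_dimensional H \<longleftrightarrow> \<not> (\<exists>B\<subseteq>hcarr H. finite B \<and> hcarr H \<subseteq> hspan H B)"

section \<open>The Hilbert space of square integrable functions\<close>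

definition l2_funs :: "'x measure \<Rightarrow> ('x \<Rightarrow> complex) set" where
  "l2_funs M = {\<phi> \<in> borel_measurable M. integrable M (\<lambda>x. (cmod (\<phi> x))\<^sup>2)}"

definition l2_rel :: "'x measure \<Rightarrow> (('x \<Rightarrow> complex) \<times> ('x \<Rightarrow> complex)) set" where
  "l2_rel M = {(\<phi>, \<psi>). \<phi> \<in> l2_funs M \<and> \<psi> \<in> l2_funs M \<and> (AE x in M. \<phi> x = \<psi> x)}"

definition l2_class :: "'x measure \<Rightarrow> ('x \<Rightarrow> complex) \<Rightarrow> ('x \<Rightarrow> complex) set" where
  "l2_class M \<phi> = l2_rel M `` {\<phi>}"

definition l2 :: "'x measure \<Rightarrow> ('x \<Rightarrow> complex) set hilbert" where
  "l2 M =
     \<lparr>hcarr = l2_funs M // l2_rel M,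
      hadd = (\<lambda>F G. l2_class M (\<lambda>x. rep F x + rep G x)),
      hscale = (\<lambda>c F. l2_class M (\<lambda>x. c * rep F x)),
      hinner = (\<lambda>F G. integral\<^sup>L M (\<lambda>x. rep F x * cnj (rep G x)))\<rparr>"

section \<open>Branching systems\<close>

text \<open>\<open>f e\<close> is the map from \<open>D (rng G e)\<close> to \<open>R e\<close> and \<open>g e\<close> its almost everywhere inverse.\<close>

definition branching_system ::
  "('v, 'e) ultragraph \<Rightarrow> 'x measure \<Rightarrow> ('e \<Rightarrow> 'x set) \<Rightarrow> ('v set \<Rightarrow> 'x set) \<Rightarrow>
    ('e \<Rightarrow> 'x \<Rightarrow> 'x) \<Rightarrow> ('e \<Rightarrow> 'x \<Rightarrow> 'x) \<Rightarrow> bool" where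
  "branching_system G M R D f g \<longleftrightarrow>
     (\<forall>e\<in>edges G. R e \<in> sets M) \<and>
     (\<forall>A\<in>gverts G. D A \<in> sets M) \<and>
     (\<forall>e\<in>edges G. \<forall>e'\<in>edges G. e \<noteq> e' \<longrightarrow> (AE x in M. x \<notin> R e \<inter> R e')) \<and>
     D {} = {} \<and>
     (\<forall>A\<in>gverts G. \<forall>B\<in>gverts G. AE x in M. x \<in> D A \<inter> D B \<longleftrightarrow> x \<in> D (A \<inter> B)) \<and>
     (\<forall>A\<in>gverts G. \<forall>B\<in>gverts G. AE x in M. x \<in> D A \<union> D B \<longleftrightarrow> x \<in> D (A \<union> B)) \<and>
     (\<forall>e\<in>edges G. AE x in M. x \<in> R e \<longrightarrow> x \<in> D {src G e}) \<and>
     (\<forall>v\<in>verts G. finite (out_edges G v) \<and> out_edges G v \<noteq> {} \<longrightarrow>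
        (AE x in M. x \<in> D {v} \<longleftrightarrow> x \<in> (\<Union>e\<in>out_edges G v. R e))) \<and>
     (\<forall>e\<in>edges G.
        let MD = restrict_space M (D (rng G e)); MR = restrict_space M (R e) in
        f e \<in> measurable MD MR \<and>
        g e \<in> measurable MR MD \<and>
        (AE x in MR. f e (g e x) = x) \<and>
        (AE x in MD. g e (f e x) = x) \<and>
        absolutely_continuous MD (distr MR MD (g e)) \<and>
        absolutely_continuous MR (distr MD MR (f e)))"

text \<open>The Radon-Nikodym derivative on \<open>R e\<close> of the push-forward along \<open>f e\<close> of the measure on
  \<open>D (rng G e)\<close>.\<close>

definition RN_inv ::
  "('v, 'e) ultragraph \<Rightarrow> 'x measure \<Rightarrow> ('e \<Rightarrow> 'x set) \<Rightarrow> ('v set \<Rightarrow> 'x set) \<Rightarrow>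
    ('e \<Rightarrow> 'x \<Rightarrow> 'x) \<Rightarrow> 'e \<Rightarrow> 'x \<Rightarrow> real" where
  "RN_inv G M R D f e x =
     enn2real (RN_deriv (restrict_space M (R e))
       (distr (restrict_space M (D (rng G e))) (restrict_space M (R e)) (f e)) x)"

end

theory Submission
  imports Defs
begin

text \<open>The operators \<open>\<phi> \<mapsto> \<surd>\<Phi> (\<phi> \<circ> f\<^sub>e\<inverse>)\<close> and \<open>\<phi> \<mapsto> \<chi>\<^sub>A \<phi>\<close> satisfy the defining relations: the
  adjoint of the former is \<open>\<psi> \<mapsto> (\<psi> \<circ> f\<^sub>e)/\<surd>(\<Phi> \<circ> f\<^sub>e)\<close> on \<open>D (r e)\<close>, and the products of the two
  are multiplication by the indicators of \<open>D (r e)\<close> and of \<open>R e\<close>. Evaluation of *-polynomials at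
  these operators is dominated by the universal norm, hence extends to the completion. Uniqueness
  holds because a *-homomorphism into bounded operators is automatically continuous.\<close>

section \<open>Hilbert spaces and their bounded operators\<close>

text \<open>Two features of the definitions shape the argument. The universal norm is a supremum of
  C*-seminorms on a free *-algebra, so no universal property is at hand: it is won by observing that
  the operator norm of an evaluation is, by the C*-identity, itself one of these seminorms, and that
  the supremum is finite. And a representation is not assumed bounded, nor does the algebra come
  with a unit, a spectrum or a functional calculus; continuity is therefore extracted from a
  contracting iteration of *-polynomials, and the missing unit is the identity acting on vectors.
  Hilbert spaces are records with a carrier set, without a named zero vector or type class
  structure. Hence operators that have no formula are produced from bounded sesquilinear forms,
  where sums and limits are those of complex numbers, and equality of vectors is tested by inner
  products. On the analytic side both absolute continuity conditions enter: that of \<open>f\<close>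
  yields the density, that of \<open>g\<close> its positivity almost everywhere, without which the
  adjoint could not be written as a division.\<close>

locale hilbert_space =
  fixes H :: "'h hilbert"
  assumes hcarr_nonempty: "hcarr H \<noteq> {}"
    and hadd_closed [simp, intro]: "x \<in> hcarr H \<Longrightarrow> y \<in> hcarr H \<Longrightarrow> hadd H x y \<in> hcarr H"
    and hscale_closed [simp, intro]: "x \<in> hcarr H \<Longrightarrow> hscale H c x \<in> hcarr H"
    and inner_add_left [simp]: "x \<in> hcarr H \<Longrightarrow> y \<in> hcarr H \<Longrightarrow> z \<in> hcarr H \<Longrightarrow>
      hinner H (hadd H x y) z = hinner H x z + hinner H y z"
    and inner_scale_left [simp]: "x \<in> hcarr H \<Longrightarrow> y \<in> hcarr H \<Longrightarrow>
      hinner H (hscale H c x) y = c * hinner H x y"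
    and inner_commute: "x \<in> hcarr H \<Longrightarrow> y \<in> hcarr H \<Longrightarrow> hinner H y x = cnj (hinner H x y)"
    and inner_nonneg: "x \<in> hcarr H \<Longrightarrow> 0 \<le> Re (hinner H x x)"
    and inner_definite: "x \<in> hcarr H \<Longrightarrow> y \<in> hcarr H \<Longrightarrow>
      hnorm H (hadd H x (hscale H (-1) y)) = 0 \<Longrightarrow> x = y"
    and complete: "(\<And>n. X n \<in> hcarr H) \<Longrightarrow>
      (\<And>\<epsilon>. 0 < \<epsilon> \<Longrightarrow> \<exists>N. \<forall>m\<ge>N. \<forall>n\<ge>N. hnorm H (hadd H (X m) (hscale H (-1) (X n))) < \<epsilon>) \<Longrightarrow>
      \<exists>u\<in>hcarr H. (\<lambda>n. hnorm H (hadd H (X n) (hscale H (-1) u))) \<longlonglongrightarrow> 0"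
begin

lemma inner_add_right [simp]:
  assumes "x \<in> hcarr H" "y \<in> hcarr H" "z \<in> hcarr H"
  shows "hinner H z (hadd H x y) = hinner H z x + hinner H z y"
  using assms inner_commute[of "hadd H x y" z] inner_commute[of x z] inner_commute[of y z] by simp

lemma inner_scale_right [simp]:
  assumes "x \<in> hcarr H" "y \<in> hcarr H"
  shows "hinner H x (hscale H c y) = cnj c * hinner H x y"
  using assms inner_commute[of "hscale H c y" x] inner_commute[of y x] by simp

lemma inner_self: "x \<in> hcarr H \<Longrightarrow> hinner H x x = complex_of_real ((hnorm H x)\<^sup>2)"
  using inner_commute[of x x] inner_nonneg[of x] by (simp add: hnorm_def complex_eq_iff)

lemma Re_inner_self: "x \<in> hcarr H \<Longrightarrow> Re (hinner H x x) = (hnorm H x)\<^sup>2"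
  by (simp add: inner_self)

lemma hnorm_nonneg: "x \<in> hcarr H \<Longrightarrow> 0 \<le> hnorm H x"
  by (simp add: hnorm_def inner_nonneg)

text \<open>This takes the place of the vector space laws, which the locale does not list: paired
  with an arbitrary \<open>z\<close>, a linear identity of vectors becomes an identity of complex
  numbers.\<close>

lemma hilbert_eqI:
  assumes "x \<in> hcarr H" "y \<in> hcarr H" "\<And>z. z \<in> hcarr H \<Longrightarrow> hinner H x z = hinner H y z"
  shows "x = y"
proof (rule inner_definite)
  let ?d = "hadd H x (hscale H (-1) y)"
  have "hinner H ?d ?d = hinner H x ?d - hinner H y ?d"
    using assms(1,2) by (subst inner_add_left) auto
  then show "hnorm H ?d = 0" using assms by (simp add: hnorm_def)
qed (use assms in auto)

lemma hnorm_scale: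
  assumes "x \<in> hcarr H"
  shows "hnorm H (hscale H c x) = cmod c * hnorm H x"
proof (rule power2_eq_imp_eq)
  have "hinner H (hscale H c x) (hscale H c x) = (c * cnj c) * hinner H x x"
    using assms by simp
  also have "\<dots> = complex_of_real ((cmod c)\<^sup>2 * (hnorm H x)\<^sup>2)"
    using assms by (simp add: inner_self complex_norm_square[symmetric] flip: of_real_mult of_real_power)
  finally show "(hnorm H (hscale H c x))\<^sup>2 = (cmod c * hnorm H x)\<^sup>2"
    using assms by (subst Re_inner_self[symmetric]) (auto simp: power_mult_distrib)
qed (use assms hnorm_nonneg in auto)

lemma hnorm_add_power2:
  "x \<in> hcarr H \<Longrightarrow> y \<in> hcarr H \<Longrightarrow>
    (hnorm H (hadd H x y))\<^sup>2 = (hnorm H x)\<^sup>2 + 2 * Re (hinner H x y) + (hnorm H y)\<^sup>2"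
  by (simp add: Re_inner_self[symmetric] inner_commute[of x y])

lemma Cauchy_Schwarz:
  assumes x: "x \<in> hcarr H" and y: "y \<in> hcarr H"
  shows "cmod (hinner H x y) \<le> hnorm H x * hnorm H y"
proof (cases "hnorm H y = 0")
  case True
  \<comment> \<open>With no zero vector in the record, \<open>hscale H 0 y\<close> plays its part;
    once \<open>y\<close> equals it, all inner products with \<open>y\<close> vanish.\<close>
  have "hnorm H (hadd H y (hscale H (-1) (hscale H 0 y))) = hnorm H y"
    by (simp add: hnorm_def y)
  then have "y = hscale H 0 y" using True y by (intro inner_definite) auto
  then have "hinner H x y = 0" using x y inner_scale_right[of x y 0] by simp
  then show ?thesis using True by simp
next
  case False
  define a where "a = hinner H x y"
  define N where "N = (hnorm H y)\<^sup>2"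
  have N: "0 < N" using False by (simp add: N_def)
  have yx: "hinner H y x = cnj a" using inner_commute[OF x y] by (simp add: a_def)
  \<comment> \<open>\<open>N x - a y\<close> is \<open>N\<close> times the component of
    \<open>x\<close> orthogonal to \<open>y\<close>; the factor \<open>N\<close> keeps divisions out
    of the expansion.\<close>
  have "0 \<le> (hnorm H (hadd H (hscale H (complex_of_real N) x) (hscale H (- a) y)))\<^sup>2" by simp
  also have "\<dots> = N\<^sup>2 * (hnorm H x)\<^sup>2 - N * (cmod a)\<^sup>2"
    using x y by (simp add: hnorm_add_power2 hnorm_scale power_mult_distrib yx cmod_power2
        flip: a_def N_def) (simp add: power2_eq_square algebra_simps)
  finally have "N * (cmod a)\<^sup>2 \<le> N * (N * (hnorm H x)\<^sup>2)"
    by (simp add: power2_eq_square algebra_simps)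
  then have "(cmod a)\<^sup>2 \<le> (hnorm H x * hnorm H y)\<^sup>2"
    using N by (simp add: N_def power_mult_distrib mult.commute)
  then show ?thesis unfolding a_def
    by (rule power2_le_imp_le) (simp add: x y hnorm_nonneg)
qed

lemma hnorm_triangle:
  assumes "x \<in> hcarr H" "y \<in> hcarr H"
  shows "hnorm H (hadd H x y) \<le> hnorm H x + hnorm H y"
proof (rule power2_le_imp_le)
  have "Re (hinner H x y) \<le> hnorm H x * hnorm H y"
    using Cauchy_Schwarz[OF assms] complex_Re_le_cmod order_trans by blast
  then show "(hnorm H (hadd H x y))\<^sup>2 \<le> (hnorm H x + hnorm H y)\<^sup>2"
    using assms by (simp add: hnorm_add_power2 power2_sum)
qed (use assms hnorm_nonneg in auto)

text \<open>The representing vector is the limit of a minimizing sequence of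
  \<open>x \<mapsto> \<parallel>x\<parallel>\<^sup>2 - 2 Re (\<Lambda> x)\<close>, which is Cauchy by the parallelogram law.\<close>

lemma Riesz_representation:
  assumes add: "\<And>x y. x \<in> hcarr H \<Longrightarrow> y \<in> hcarr H \<Longrightarrow> L (hadd H x y) = L x + L y"
    and scale: "\<And>c x. x \<in> hcarr H \<Longrightarrow> L (hscale H c x) = c * L x"
    and bound: "\<And>x. x \<in> hcarr H \<Longrightarrow> cmod (L x) \<le> C * hnorm H x"
  shows "\<exists>u\<in>hcarr H. \<forall>x\<in>hcarr H. L x = hinner H x u"
proof -
  define F where "F x = (hnorm H x)\<^sup>2 - 2 * Re (L x)" for x
  have F_lower: "- C\<^sup>2 \<le> F x" if "x \<in> hcarr H" for x
  proof -
    have "Re (L x) \<le> C * hnorm H x"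
      using bound[OF that] complex_Re_le_cmod order_trans by blast
    moreover have "0 \<le> (hnorm H x - C)\<^sup>2" by simp
    ultimately show ?thesis unfolding F_def by (simp add: power2_eq_square algebra_simps)
  qed
  define m where "m = (INF x\<in>hcarr H. F x)"
  have bdd: "bdd_below (F ` hcarr H)" using F_lower by (auto simp: bdd_below_def)
  have m_le: "m \<le> F x" if "x \<in> hcarr H" for x
    unfolding m_def using bdd that by (rule cINF_lower)
  have "\<exists>x\<in>hcarr H. F x < m + 1 / real (Suc n)" for n
    using cINF_less_iff[OF hcarr_nonempty bdd, of "m + 1 / real (Suc n)"] by (simp add: m_def)
  then obtain X where X: "\<And>n. X n \<in> hcarr H" "\<And>n. F (X n) < m + 1 / real (Suc n)" by metis
  have close: "(hnorm H (hadd H x (hscale H (-1) y)))\<^sup>2 \<le> 2 * (F x - m) + 2 * (F y - m)"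
    if "x \<in> hcarr H" "y \<in> hcarr H" for x y
  proof -
    \<comment> \<open>At the midpoint, \<open>2 F x + 2 F y - 4 F ?z\<close> is exactly the squared
      distance of \<open>x\<close> and \<open>y\<close>, while \<open>F ?z\<close> is at least
      \<open>m\<close>.\<close>
    let ?z = "hscale H (1/2) (hadd H x y)"
    have "m \<le> F ?z" using that by (intro m_le) auto
    moreover have "F ?z = ((hnorm H x)\<^sup>2 + 2 * Re (hinner H x y) + (hnorm H y)\<^sup>2) / 4
        - Re (L x) - Re (L y)"
      using that by (simp add: F_def hnorm_scale hnorm_add_power2 power_mult_distrib add scale
          power_divide add_divide_distrib)
    moreover have "(hnorm H (hadd H x (hscale H (-1) y)))\<^sup>2 =
        (hnorm H x)\<^sup>2 - 2 * Re (hinner H x y) + (hnorm H y)\<^sup>2"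
      using that by (simp add: hnorm_scale hnorm_add_power2)
    ultimately show ?thesis unfolding F_def by argo
  qed
  have "\<exists>u\<in>hcarr H. (\<lambda>n. hnorm H (hadd H (X n) (hscale H (-1) u))) \<longlonglongrightarrow> 0"
  proof (rule complete[OF X(1)])
    fix \<epsilon> :: real assume "0 < \<epsilon>"
    then obtain N where N: "1 / real (Suc N) < \<epsilon>\<^sup>2 / 4"
      using reals_Archimedean[of "\<epsilon>\<^sup>2 / 4"] by (auto simp: inverse_eq_divide)
    have "hnorm H (hadd H (X k) (hscale H (-1) (X n))) < \<epsilon>" if "N \<le> k" "N \<le> n" for k n
    proof (rule power2_less_imp_less)
      have "1 / real (Suc k) \<le> 1 / real (Suc N)" "1 / real (Suc n) \<le> 1 / real (Suc N)"
        using that by (auto simp: field_simps)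
      then show "(hnorm H (hadd H (X k) (hscale H (-1) (X n))))\<^sup>2 < \<epsilon>\<^sup>2"
        using close[OF X(1)[of k] X(1)[of n]] X(2)[of k] X(2)[of n] N by argo
    qed (use \<open>0 < \<epsilon>\<close> in auto)
    then show "\<exists>N. \<forall>m\<ge>N. \<forall>n\<ge>N. hnorm H (hadd H (X m) (hscale H (-1) (X n))) < \<epsilon>" by blast
  qed
  then obtain u where u: "u \<in> hcarr H"
    and lim: "(\<lambda>n. hnorm H (hadd H (X n) (hscale H (-1) u))) \<longlonglongrightarrow> 0" by blast
  have inner_lim: "(\<lambda>n. hinner H x (X n)) \<longlonglongrightarrow> hinner H x u" if x: "x \<in> hcarr H" for x
  proof (rule Lim_null_comparison[THEN LIM_zero_cancel])
    show "\<forall>\<^sub>F n in sequentially. cmod (hinner H x (X n) - hinner H x u)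
        \<le> hnorm H x * hnorm H (hadd H (X n) (hscale H (-1) u))"
    proof (rule always_eventually, rule allI)
      fix n
      show "cmod (hinner H x (X n) - hinner H x u)
          \<le> hnorm H x * hnorm H (hadd H (X n) (hscale H (-1) u))"
        using Cauchy_Schwarz[OF x, of "hadd H (X n) (hscale H (-1) u)"] x u X(1)[of n] by simp
    qed
    show "(\<lambda>n. hnorm H x * hnorm H (hadd H (X n) (hscale H (-1) u))) \<longlonglongrightarrow> 0"
      using tendsto_mult_left[OF lim, of "hnorm H x"] by simp
  qed
  have "L x = hinner H x u" if x: "x \<in> hcarr H" for x
  proof (rule ccontr)
    define w where "w = hinner H x u - L x"
    assume "L x \<noteq> hinner H x u"
    then have w: "0 < (cmod w)\<^sup>2" by (simp add: w_def)
    \<comment> \<open>First variation at the limit: moving by \<open>t x\<close> changes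
      \<open>F\<close> by \<open>|t|^2 |x|^2 + 2 Re (t w)\<close>. The choice
      \<open>t = - s cnj w\<close> makes the linear term \<open>-2 s |w|^2\<close>, and
      \<open>s |x|^2 < 2\<close> keeps the quadratic term from compensating it.\<close>
    define s where "s = 1 / ((hnorm H x)\<^sup>2 + 1)"
    have pos: "0 < (hnorm H x)\<^sup>2 + 1" by (simp add: add_nonneg_pos)
    then have s: "0 < s" "s * (hnorm H x)\<^sup>2 < 2"
      by (auto simp: s_def field_simps)
    define t where "t = - complex_of_real s * cnj w"
    have lower: "- 1 / real (Suc n) \<le> (cmod t)\<^sup>2 * (hnorm H x)\<^sup>2
        + 2 * Re (t * (hinner H x (X n) - L x))" for n
    proof -
      have "m \<le> F (hadd H (X n) (hscale H t x))" using x X(1) by (intro m_le) auto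
      also have "\<dots> = F (X n) + (cmod t)\<^sup>2 * (hnorm H x)\<^sup>2
        + 2 * Re (t * (hinner H x (X n) - L x))"
      proof -
        have "Re (hinner H (X n) (hscale H t x)) = Re (cnj (hinner H (hscale H t x) (X n)))"
          using x X(1)[of n] by (subst inner_commute) auto
        then have "Re (hinner H (X n) (hscale H t x)) = Re (t * hinner H x (X n))"
          using x X(1)[of n] by simp
        then have "(hnorm H (hadd H (X n) (hscale H t x)))\<^sup>2 = (hnorm H (X n))\<^sup>2
            + 2 * Re (t * hinner H x (X n)) + (cmod t)\<^sup>2 * (hnorm H x)\<^sup>2"
          using x X(1)[of n] by (simp only: hnorm_add_power2 hscale_closed hnorm_scale power_mult_distrib)
        moreover have "Re (L (hadd H (X n) (hscale H t x))) = Re (L (X n)) + Re (t * L x)"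
          using x X(1)[of n] by (simp only: add scale hscale_closed plus_complex.sel)
        ultimately show ?thesis
          unfolding F_def right_diff_distrib minus_complex.sel by argo
      qed
      finally show ?thesis using X(2)[of n] by simp
    qed
    have "(\<lambda>n. (cmod t)\<^sup>2 * (hnorm H x)\<^sup>2 + 2 * Re (t * (hinner H x (X n) - L x)))
        \<longlonglongrightarrow> (cmod t)\<^sup>2 * (hnorm H x)\<^sup>2 + 2 * Re (t * w)"
      unfolding w_def by (intro tendsto_intros inner_lim x)
    moreover have "(\<lambda>n. - 1 / real (Suc n)) \<longlonglongrightarrow> 0"
      using tendsto_minus[OF LIMSEQ_inverse_real_of_nat] by (simp add: inverse_eq_divide)
    ultimately have "0 \<le> (cmod t)\<^sup>2 * (hnorm H x)\<^sup>2 + 2 * Re (t * w)"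
      using lower by (intro LIMSEQ_le) auto
    also have "\<dots> = (cmod w)\<^sup>2 * s * (s * (hnorm H x)\<^sup>2 - 2)"
      by (simp add: t_def norm_mult power_mult_distrib cmod_power2)
        (simp add: power2_eq_square algebra_simps)
    also have "\<dots> < 0" using w s by (simp add: mult_less_0_iff)
    finally show False by simp
  qed
  then show ?thesis using u by blast
qed

section \<open>Bounded operators and their adjoints\<close>

abbreviation "\<B> \<equiv> bounded_ops_carr H"

lemma op_apply [simp, intro]: "T \<in> \<B> \<Longrightarrow> x \<in> hcarr H \<Longrightarrow> T x \<in> hcarr H"
  unfolding bounded_ops_carr_def by blast

lemma bounded_opsI:
  assumes "T \<in> extensional (hcarr H)" "\<And>x. x \<in> hcarr H \<Longrightarrow> T x \<in> hcarr H"
    and "\<And>x y. x \<in> hcarr H \<Longrightarrow> y \<in> hcarr H \<Longrightarrow> T (hadd H x y) = hadd H (T x) (T y)"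
    and "\<And>c x. x \<in> hcarr H \<Longrightarrow> T (hscale H c x) = hscale H c (T x)"
    and "\<And>x. x \<in> hcarr H \<Longrightarrow> hnorm H (T x) \<le> C * hnorm H x"
  shows "T \<in> \<B>"
proof -
  have "T \<in> hcarr H \<rightarrow>\<^sub>E hcarr H" using assms(1,2) by (simp add: PiE_def)
  then show ?thesis
    unfolding bounded_ops_carr_def mem_Collect_eq by (intro conjI exI[of _ C]) (use assms(3-) in auto)
qed

lemma op_extensional: "T \<in> \<B> \<Longrightarrow> T \<in> extensional (hcarr H)"
  unfolding bounded_ops_carr_def PiE_def by blast

lemma op_eqI:
  assumes "S \<in> \<B>" "T \<in> \<B>"
    and "\<And>x y. x \<in> hcarr H \<Longrightarrow> y \<in> hcarr H \<Longrightarrow> hinner H (S x) y = hinner H (T x) y"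
  shows "S = T"
  by (rule extensionalityI[OF op_extensional op_extensional])
    (use assms in \<open>auto intro!: hilbert_eqI\<close>)

lemma op_add: "T \<in> \<B> \<Longrightarrow> x \<in> hcarr H \<Longrightarrow> y \<in> hcarr H \<Longrightarrow> T (hadd H x y) = hadd H (T x) (T y)"
  and op_scale: "T \<in> \<B> \<Longrightarrow> x \<in> hcarr H \<Longrightarrow> T (hscale H c x) = hscale H c (T x)"
  unfolding bounded_ops_carr_def by blast+

text \<open>The common source of adjoints, of values of *-polynomials and of norm limits of
  operators. For fixed \<open>x\<close> the map sending \<open>y\<close> to
  \<open>cnj (b x y)\<close> is linear, so Riesz represents it by the value at \<open>x\<close>;
  linearity in \<open>x\<close> is inherited from \<open>b\<close> by testing with inner
  products.\<close>

lemma sesquilinear_operator: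
  assumes add1: "\<And>x y z. x \<in> hcarr H \<Longrightarrow> y \<in> hcarr H \<Longrightarrow> z \<in> hcarr H \<Longrightarrow>
      b (hadd H x y) z = b x z + b y z"
    and scale1: "\<And>c x y. x \<in> hcarr H \<Longrightarrow> y \<in> hcarr H \<Longrightarrow> b (hscale H c x) y = c * b x y"
    and add2: "\<And>x y z. x \<in> hcarr H \<Longrightarrow> y \<in> hcarr H \<Longrightarrow> z \<in> hcarr H \<Longrightarrow>
      b z (hadd H x y) = b z x + b z y"
    and scale2: "\<And>c x y. x \<in> hcarr H \<Longrightarrow> y \<in> hcarr H \<Longrightarrow> b x (hscale H c y) = cnj c * b x y"
    and bound: "\<And>x y. x \<in> hcarr H \<Longrightarrow> y \<in> hcarr H \<Longrightarrow> cmod (b x y) \<le> C * hnorm H x * hnorm H y"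
  shows "\<exists>T\<in>\<B>. \<forall>x\<in>hcarr H. \<forall>y\<in>hcarr H. hinner H (T x) y = b x y"
proof -
  have "\<exists>u\<in>hcarr H. \<forall>y\<in>hcarr H. hinner H u y = b x y" if x: "x \<in> hcarr H" for x
  proof -
    have "\<exists>u\<in>hcarr H. \<forall>y\<in>hcarr H. cnj (b x y) = hinner H y u"
      by (rule Riesz_representation[where C = "C * hnorm H x"])
        (use x bound in \<open>auto simp: add2 scale2\<close>)
    then obtain u where "u \<in> hcarr H" "\<And>y. y \<in> hcarr H \<Longrightarrow> cnj (b x y) = hinner H y u" by blast
    then show ?thesis
      by (metis complex_cnj_cnj inner_commute)
  qed
  then obtain T0 where T0: "\<And>x. x \<in> hcarr H \<Longrightarrow> T0 x \<in> hcarr H"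
    "\<And>x y. x \<in> hcarr H \<Longrightarrow> y \<in> hcarr H \<Longrightarrow> hinner H (T0 x) y = b x y" by metis
  define T where "T = restrict T0 (hcarr H)"
  have T: "\<And>x. x \<in> hcarr H \<Longrightarrow> T x \<in> hcarr H"
    "\<And>x y. x \<in> hcarr H \<Longrightarrow> y \<in> hcarr H \<Longrightarrow> hinner H (T x) y = b x y"
    using T0 by (auto simp: T_def)
  have "hnorm H (T x) \<le> \<bar>C\<bar> * hnorm H x" if x: "x \<in> hcarr H" for x
  proof (cases "hnorm H (T x) = 0")
    case True
    then show ?thesis using hnorm_nonneg[OF x] by simp
  next
    case False
    then have pos: "0 < hnorm H (T x)" using hnorm_nonneg[OF T(1)[OF x]] by simp
    have "(hnorm H (T x))\<^sup>2 \<le> cmod (hinner H (T x) (T x))"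
      using x T(1) by (simp add: inner_self norm_power)
    also have "\<dots> \<le> C * hnorm H x * hnorm H (T x)" using x T bound by simp
    also have "\<dots> \<le> \<bar>C\<bar> * hnorm H x * hnorm H (T x)"
      using hnorm_nonneg[OF x] pos by (intro mult_right_mono) auto
    finally show ?thesis using pos by (simp add: power2_eq_square)
  qed
  moreover have "T (hadd H x y) = hadd H (T x) (T y)" if "x \<in> hcarr H" "y \<in> hcarr H" for x y
    using that T add1 by (intro hilbert_eqI) auto
  moreover have "T (hscale H c x) = hscale H c (T x)" if "x \<in> hcarr H" for x c
    using that T scale1 by (intro hilbert_eqI) auto
  ultimately have "T \<in> \<B>" by (intro bounded_opsI) (auto simp: T(1), auto simp: T_def)
  then show ?thesis using T by blast
qed

lemma op_bounded:
  assumes "T \<in> \<B>"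
  shows "\<exists>C\<ge>0. \<forall>x\<in>hcarr H. hnorm H (T x) \<le> C * hnorm H x"
proof -
  obtain C where C: "\<forall>x\<in>hcarr H. hnorm H (T x) \<le> C * hnorm H x"
    using assms unfolding bounded_ops_carr_def by blast
  have "hnorm H (T x) \<le> \<bar>C\<bar> * hnorm H x" if x: "x \<in> hcarr H" for x
    using C[rule_format, OF x] mult_right_mono[OF abs_ge_self[of C] hnorm_nonneg[OF x]] by linarith
  then show ?thesis by (intro exI[of _ "\<bar>C\<bar>"]) simp
qed

text \<open>\<open>adjoint_op\<close> is a definite description, so it means something only after
  existence and uniqueness. Existence comes from the form sending \<open>(x, y)\<close> to the inner
  product of \<open>x\<close> with \<open>T y\<close>.\<close>

lemma ex1_adjoint:
  assumes T: "T \<in> \<B>"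
  shows "\<exists>!S. S \<in> \<B> \<and> (\<forall>x\<in>hcarr H. \<forall>y\<in>hcarr H. hinner H (T x) y = hinner H x (S y))"
proof -
  obtain C where C: "0 \<le> C" "\<And>x. x \<in> hcarr H \<Longrightarrow> hnorm H (T x) \<le> C * hnorm H x"
    using op_bounded[OF T] by blast
  have "\<exists>S\<in>\<B>. \<forall>y\<in>hcarr H. \<forall>x\<in>hcarr H. hinner H (S y) x = hinner H y (T x)"
  proof (rule sesquilinear_operator[where C = C])
    fix x y assume xy: "x \<in> hcarr H" "y \<in> hcarr H"
    have "cmod (hinner H x (T y)) \<le> hnorm H x * hnorm H (T y)"
      using xy T by (intro Cauchy_Schwarz) auto
    also have "\<dots> \<le> hnorm H x * (C * hnorm H y)"
      using xy C by (intro mult_left_mono hnorm_nonneg) auto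
    finally show "cmod (hinner H x (T y)) \<le> C * hnorm H x * hnorm H y" by (simp add: ac_simps)
  qed (use T in \<open>auto simp: op_add op_scale\<close>)
  then obtain S where S: "S \<in> \<B>" "\<And>x y. x \<in> hcarr H \<Longrightarrow> y \<in> hcarr H \<Longrightarrow>
    hinner H (S y) x = hinner H y (T x)" by blast
  have adj: "hinner H (T x) y = hinner H x (S y)" if "x \<in> hcarr H" "y \<in> hcarr H" for x y
    using S(2)[OF that] inner_commute[of y "T x"] inner_commute[of "S y" x] S(1) T that by simp
  show ?thesis
  proof (rule ex1I[of _ S])
    fix S' assume S': "S' \<in> \<B> \<and> (\<forall>x\<in>hcarr H. \<forall>y\<in>hcarr H. hinner H (T x) y = hinner H x (S' y))"
    show "S' = S"
    proof (rule op_eqI)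
      fix x y assume "x \<in> hcarr H" "y \<in> hcarr H"
      then show "hinner H (S' x) y = hinner H (S x) y"
        using S' S(1) adj inner_commute by (metis op_apply)
    qed (use S S' in auto)
  qed (use S adj in auto)
qed

lemma adjoint_op:
  "T \<in> \<B> \<Longrightarrow> adjoint_op H T \<in> \<B> \<and>
    (\<forall>x\<in>hcarr H. \<forall>y\<in>hcarr H. hinner H (T x) y = hinner H x (adjoint_op H T y))"
  unfolding adjoint_op_def by (rule theI'[OF ex1_adjoint])

lemma adjoint_closed [simp, intro]: "T \<in> \<B> \<Longrightarrow> adjoint_op H T \<in> \<B>"
  using adjoint_op by blast

lemma inner_adjoint:
  "T \<in> \<B> \<Longrightarrow> x \<in> hcarr H \<Longrightarrow> y \<in> hcarr H \<Longrightarrow>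
    hinner H x (adjoint_op H T y) = hinner H (T x) y"
  using adjoint_op[of T] by (simp only:)

lemma adjointI:
  assumes "S \<in> \<B>" "T \<in> \<B>"
    and "\<And>x y. x \<in> hcarr H \<Longrightarrow> y \<in> hcarr H \<Longrightarrow> hinner H (T x) y = hinner H x (S y)"
  shows "adjoint_op H T = S"
  unfolding adjoint_op_def by (rule the1_equality[OF ex1_adjoint[OF assms(2)]]) (use assms in blast)

lemma inner_adjoint_left:
  assumes T: "T \<in> \<B>" and x: "x \<in> hcarr H" and y: "y \<in> hcarr H"
  shows "hinner H (adjoint_op H T x) y = hinner H x (T y)"
  using inner_adjoint[OF T y x] inner_commute[of y "adjoint_op H T x"] inner_commute[of "T y" x] assms
  by (simp only: adjoint_closed op_apply)

lemma adjoint_adjoint: "T \<in> \<B> \<Longrightarrow> adjoint_op H (adjoint_op H T) = T"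
  by (rule adjointI) (auto simp: inner_adjoint_left)

lemma bounded_ops_simps [simp]:
  "carr (bounded_ops H) = \<B>"
  "mult (bounded_ops H) S T = compose (hcarr H) S T"
  "star (bounded_ops H) = adjoint_op H"
  "x \<in> hcarr H \<Longrightarrow> add (bounded_ops H) S T x = hadd H (S x) (T x)"
  "x \<in> hcarr H \<Longrightarrow> scale (bounded_ops H) c T x = hscale H c (T x)"
  by (auto simp: bounded_ops_def)

lemma ops_add_closed [simp, intro]:
  assumes S: "S \<in> \<B>" and T: "T \<in> \<B>"
  shows "add (bounded_ops H) S T \<in> \<B>"
proof -
  obtain C where C: "0 \<le> C" "\<And>x. x \<in> hcarr H \<Longrightarrow> hnorm H (S x) \<le> C * hnorm H x"
    using op_bounded[OF S] by blast
  obtain C' where C': "0 \<le> C'" "\<And>x. x \<in> hcarr H \<Longrightarrow> hnorm H (T x) \<le> C' * hnorm H x"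
    using op_bounded[OF T] by blast
  have "hnorm H (hadd H (S x) (T x)) \<le> (C + C') * hnorm H x" if x: "x \<in> hcarr H" for x
    using hnorm_triangle[of "S x" "T x", OF op_apply[OF S x] op_apply[OF T x]] C(2)[OF x] C'(2)[OF x]
    by (simp add: distrib_right)
  moreover have "hadd H (S (hadd H x y)) (T (hadd H x y)) =
      hadd H (hadd H (S x) (T x)) (hadd H (S y) (T y))" if "x \<in> hcarr H" "y \<in> hcarr H" for x y
    using that S T by (intro hilbert_eqI) (auto simp: op_add)
  moreover have "hadd H (S (hscale H c x)) (T (hscale H c x)) =
      hscale H c (hadd H (S x) (T x))" if "x \<in> hcarr H" for x c
    using that S T by (intro hilbert_eqI) (auto simp: op_scale algebra_simps)
  ultimately show ?thesis
    using S T by (intro bounded_opsI) (auto, auto simp: bounded_ops_def)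
qed

lemma ops_scale_closed [simp, intro]:
  assumes T: "T \<in> \<B>"
  shows "scale (bounded_ops H) c T \<in> \<B>"
proof -
  obtain C where C: "0 \<le> C" "\<And>x. x \<in> hcarr H \<Longrightarrow> hnorm H (T x) \<le> C * hnorm H x"
    using op_bounded[OF T] by blast
  have "hnorm H (hscale H c (T x)) \<le> (cmod c * C) * hnorm H x" if x: "x \<in> hcarr H" for x
    using C(2)[OF x] T x by (simp add: hnorm_scale mult.assoc mult_left_mono)
  moreover have "hscale H c (T (hadd H x y)) = hadd H (hscale H c (T x)) (hscale H c (T y))"
    if "x \<in> hcarr H" "y \<in> hcarr H" for x y
    using that T by (intro hilbert_eqI) (auto simp: op_add algebra_simps)
  moreover have "hscale H c (T (hscale H d x)) = hscale H d (hscale H c (T x))"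
    if "x \<in> hcarr H" for x d
    using that T by (intro hilbert_eqI) (auto simp: op_scale algebra_simps)
  ultimately show ?thesis
    using T by (intro bounded_opsI) (auto, auto simp: bounded_ops_def)
qed

lemma ops_mult_closed [simp, intro]:
  assumes S: "S \<in> \<B>" and T: "T \<in> \<B>"
  shows "compose (hcarr H) S T \<in> \<B>"
proof -
  obtain C where C: "0 \<le> C" "\<And>x. x \<in> hcarr H \<Longrightarrow> hnorm H (S x) \<le> C * hnorm H x"
    using op_bounded[OF S] by blast
  obtain C' where C': "0 \<le> C'" "\<And>x. x \<in> hcarr H \<Longrightarrow> hnorm H (T x) \<le> C' * hnorm H x"
    using op_bounded[OF T] by blast
  have "hnorm H (S (T x)) \<le> (C * C') * hnorm H x" if x: "x \<in> hcarr H" for x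
  proof -
    have "hnorm H (S (T x)) \<le> C * hnorm H (T x)" using T x by (intro C(2)) auto
    also have "\<dots> \<le> C * (C' * hnorm H x)" by (intro mult_left_mono C'(2) x C(1))
    finally show ?thesis by (simp add: mult.assoc)
  qed
  then show ?thesis
    using S T by (intro bounded_opsI) (auto simp: compose_def op_add op_scale)
qed

section \<open>The operator norm and the C*-identity\<close>

abbreviation "opnorm \<equiv> nrm (bounded_ops H)"

text \<open>Such a vector lies in the unit ball and keeps the set under the supremum in
  \<open>opnorm\<close> nonempty.\<close>

lemma zero_ex: "\<exists>x\<in>hcarr H. hnorm H x = 0"
proof -
  obtain x where "x \<in> hcarr H" using hcarr_nonempty by blast
  then show ?thesis by (intro bexI[of _ "hscale H 0 x"]) (auto simp: hnorm_scale)
qed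

lemma opnorm_le:
  assumes T: "T \<in> \<B>" and C: "0 \<le> C" "\<And>x. x \<in> hcarr H \<Longrightarrow> hnorm H (T x) \<le> C * hnorm H x"
  shows "opnorm T \<le> C"
proof -
  have "hnorm H (T x) \<le> C" if "x \<in> hcarr H" "hnorm H x \<le> 1" for x
    using C(2)[OF that(1)] mult_left_mono[OF that(2) C(1)] by simp
  moreover obtain z where "z \<in> hcarr H" "hnorm H z = 0" using zero_ex by blast
  then have "z \<in> hcarr H \<and> hnorm H z \<le> 1" by simp
  ultimately show ?thesis
    unfolding bounded_ops_def by (simp, intro cSup_least) blast+
qed

lemma hnorm_le_opnorm:
  assumes T: "T \<in> \<B>" and y: "y \<in> hcarr H" "hnorm H y \<le> 1"
  shows "hnorm H (T y) \<le> opnorm T"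
proof -
  obtain C where C: "0 \<le> C" "\<And>x. x \<in> hcarr H \<Longrightarrow> hnorm H (T x) \<le> C * hnorm H x"
    using op_bounded[OF T] by blast
  have "bdd_above {hnorm H (T x) | x. x \<in> hcarr H \<and> hnorm H x \<le> 1}"
    unfolding bdd_above_def
  proof (intro exI[of _ C] ballI)
    fix r assume "r \<in> {hnorm H (T x) | x. x \<in> hcarr H \<and> hnorm H x \<le> 1}"
    then obtain x where x: "r = hnorm H (T x)" "x \<in> hcarr H" "hnorm H x \<le> 1" by blast
    show "r \<le> C" using C(2)[OF x(2)] mult_left_mono[OF x(3) C(1)] x(1) by simp
  qed
  then show ?thesis
    unfolding bounded_ops_def using y by (simp, intro cSup_upper) blast+
qed

lemma opnorm_nonneg:
  assumes "T \<in> \<B>"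
  shows "0 \<le> opnorm T"
proof -
  obtain z where z: "z \<in> hcarr H" "hnorm H z = 0" using zero_ex by blast
  show ?thesis
    using hnorm_le_opnorm[OF assms z(1)] hnorm_nonneg[OF op_apply[OF assms z(1)]] z(2) by linarith
qed

lemma opnorm:
  assumes T: "T \<in> \<B>" and x: "x \<in> hcarr H"
  shows "hnorm H (T x) \<le> opnorm T * hnorm H x"
proof (cases "hnorm H x = 0")
  case True
  then show ?thesis using op_bounded[OF T] x by force
next
  case False
  then have pos: "0 < hnorm H x" using hnorm_nonneg[OF x] by simp
  let ?y = "hscale H (complex_of_real (1 / hnorm H x)) x"
  have "hnorm H (T ?y) \<le> opnorm T"
    using pos x by (intro hnorm_le_opnorm[OF T]) (auto simp: hnorm_scale norm_divide)
  then show ?thesis using pos x T by (simp add: op_scale hnorm_scale norm_divide field_simps)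
qed

lemma cmod_inner_le_opnorm:
  assumes "T \<in> \<B>" "x \<in> hcarr H" "y \<in> hcarr H"
  shows "cmod (hinner H (T x) y) \<le> opnorm T * hnorm H x * hnorm H y"
proof (rule order_trans)
  show "cmod (hinner H (T x) y) \<le> hnorm H (T x) * hnorm H y"
    using assms by (intro Cauchy_Schwarz) auto
  show "hnorm H (T x) * hnorm H y \<le> opnorm T * hnorm H x * hnorm H y"
    by (intro mult_right_mono opnorm hnorm_nonneg assms)
qed

text \<open>The C*-identity rests on \<open>|S x|^2\<close> being the inner product of
  \<open>S^* S x\<close> with \<open>x\<close>, whence \<open>|S|^2 <= |S^* S|\<close> by
  Cauchy-Schwarz. Together with submultiplicativity this gives \<open>|S| <= |S^*|\<close>; applied
  to the adjoint it gives the converse, and then \<open>|S^* S| <= |S|^2\<close>. For homogeneity,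
  the lower bound is the upper one for the factor \<open>1 / c\<close>.\<close>

lemma cstar_seminorm_opnorm: "cstar_seminorm (bounded_ops H) opnorm"
  unfolding cstar_seminorm_def bounded_ops_simps(1-3)
proof (intro conjI ballI allI)
  fix T assume T: "T \<in> \<B>"
  show "0 \<le> opnorm T" by (rule opnorm_nonneg[OF T])
  have sub: "opnorm (compose (hcarr H) T S) \<le> opnorm T * opnorm S" if S: "S \<in> \<B>" and T: "T \<in> \<B>" for S T
  proof (rule opnorm_le)
    fix x assume x: "x \<in> hcarr H"
    have "hnorm H (T (S x)) \<le> opnorm T * hnorm H (S x)"
      using S x by (intro opnorm[OF T]) auto
    also have "\<dots> \<le> opnorm T * (opnorm S * hnorm H x)"
      by (intro mult_left_mono opnorm opnorm_nonneg S T x)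
    finally show "hnorm H (compose (hcarr H) T S x) \<le> opnorm T * opnorm S * hnorm H x"
      using x by (simp add: compose_def)
  qed (use S T opnorm_nonneg in auto)
  {
    fix S assume S: "S \<in> \<B>"
    show "opnorm (compose (hcarr H) T S) \<le> opnorm T * opnorm S" by (rule sub[OF S T])
    show "opnorm (add (bounded_ops H) T S) \<le> opnorm T + opnorm S"
    proof (rule opnorm_le)
      fix x assume x: "x \<in> hcarr H"
      show "hnorm H (add (bounded_ops H) T S x) \<le> (opnorm T + opnorm S) * hnorm H x"
        using hnorm_triangle[of "T x" "S x", OF op_apply[OF T x] op_apply[OF S x]]
          opnorm[OF T x] opnorm[OF S x] x by (simp add: distrib_right)
    qed (use S T opnorm_nonneg in auto)
  }
  have scale_le: "opnorm (scale (bounded_ops H) c S) \<le> cmod c * opnorm S" if S: "S \<in> \<B>" for c S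
  proof (rule opnorm_le)
    fix x assume x: "x \<in> hcarr H"
    show "hnorm H (scale (bounded_ops H) c S x) \<le> cmod c * opnorm S * hnorm H x"
      using mult_left_mono[OF opnorm[OF S x], of "cmod c"] S x
      by (simp add: hnorm_scale mult.assoc)
  qed (use S opnorm_nonneg in auto)
  {
    fix c
    show "opnorm (scale (bounded_ops H) c T) = cmod c * opnorm T"
    proof (cases "c = 0")
      case True
      then show ?thesis using scale_le[OF T, of 0] opnorm_nonneg[of "scale (bounded_ops H) 0 T"] T
        by auto
    next
      case False
      have "scale (bounded_ops H) (1 / c) (scale (bounded_ops H) c T) = T"
        using T False by (intro op_eqI) auto
      then have "opnorm T \<le> cmod (1 / c) * opnorm (scale (bounded_ops H) c T)"
        using scale_le[of "scale (bounded_ops H) c T" "1 / c"] T by auto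
      then show ?thesis using False scale_le[OF T, of c] by (simp add: norm_divide field_simps)
    qed
  }
  let ?A = "adjoint_op H T"
  have sq: "(opnorm S)\<^sup>2 \<le> opnorm (compose (hcarr H) (adjoint_op H S) S)" if S: "S \<in> \<B>" for S
  proof -
    let ?N = "opnorm (compose (hcarr H) (adjoint_op H S) S)"
    have N: "0 \<le> ?N" using S by (intro opnorm_nonneg) auto
    have "opnorm S \<le> sqrt ?N"
    proof (rule opnorm_le[OF S])
      fix x assume x: "x \<in> hcarr H"
      have "(hnorm H (S x))\<^sup>2 = Re (hinner H (adjoint_op H S (S x)) x)"
        using S x by (simp add: inner_adjoint_left Re_inner_self)
      also have "\<dots> \<le> cmod (hinner H (compose (hcarr H) (adjoint_op H S) S x) x)"
        using x by (simp add: compose_def complex_Re_le_cmod)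
      also have "\<dots> \<le> ?N * hnorm H x * hnorm H x"
        using S x by (intro cmod_inner_le_opnorm) auto
      also have "\<dots> = (sqrt ?N * hnorm H x)\<^sup>2" using N by (simp add: power_mult_distrib power2_eq_square)
      finally show "hnorm H (S x) \<le> sqrt ?N * hnorm H x"
        by (rule power2_le_imp_le) (use N x hnorm_nonneg in auto)
    qed (use N in auto)
    then show ?thesis using N opnorm_nonneg[OF S] by (metis power_mono real_sqrt_pow2)
  qed
  have le_adj: "opnorm S \<le> opnorm (adjoint_op H S)" if S: "S \<in> \<B>" for S
  proof (cases "opnorm S = 0")
    case True
    then show ?thesis using S opnorm_nonneg by auto
  next
    case False
    then show ?thesis
      using order_trans[OF sq[OF S] sub[OF S adjoint_closed[OF S]]] opnorm_nonneg[OF S]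
      by (simp add: power2_eq_square)
  qed
  have "opnorm ?A \<le> opnorm T"
    using le_adj[OF adjoint_closed[OF T]] adjoint_adjoint[OF T] by simp
  then have "opnorm (compose (hcarr H) ?A T) \<le> opnorm T * opnorm T"
    using order_trans[OF sub[OF T adjoint_closed[OF T]] mult_right_mono[OF _ opnorm_nonneg[OF T]]]
    by blast
  then show "opnorm (compose (hcarr H) ?A T) = (opnorm T)\<^sup>2"
    using sq[OF T] by (simp add: power2_eq_square)
qed

end

section \<open>The Hilbert space of square integrable functions\<close>

lemma borel_measurable_cnj [measurable]: "cnj \<in> borel_measurable borel"
  by (intro borel_measurable_continuous_onI continuous_intros)

lemma l2_funs_measurable [measurable_dest]: "\<phi> \<in> l2_funs M \<Longrightarrow> \<phi> \<in> borel_measurable M"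
  by (simp add: l2_funs_def)

lemma l2_funs_integrable: "\<phi> \<in> l2_funs M \<Longrightarrow> integrable M (\<lambda>x. (cmod (\<phi> x))\<^sup>2)"
  by (simp add: l2_funs_def)

lemma l2_funs_iff_nn_integral:
  "\<phi> \<in> l2_funs M \<longleftrightarrow> \<phi> \<in> borel_measurable M \<and> (\<integral>\<^sup>+x. ennreal ((cmod (\<phi> x))\<^sup>2) \<partial>M) < \<infinity>"
proof -
  have "(\<lambda>x. (cmod (\<phi> x))\<^sup>2) \<in> borel_measurable M" if "\<phi> \<in> borel_measurable M"
    using that by measurable
  then show ?thesis by (auto simp: l2_funs_def integrable_iff_bounded)
qed

lemma l2_funs_scale: "\<phi> \<in> l2_funs M \<Longrightarrow> (\<lambda>x. c * \<phi> x) \<in> l2_funs M"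
  by (auto simp: l2_funs_def norm_mult power_mult_distrib)

lemma cmod_add_power2_le: "(cmod (a + b))\<^sup>2 \<le> 2 * (cmod a)\<^sup>2 + 2 * (cmod b)\<^sup>2"
proof -
  have "(cmod (a + b))\<^sup>2 \<le> (cmod a + cmod b)\<^sup>2" by (intro power_mono norm_triangle_ineq norm_ge_zero)
  also have "\<dots> \<le> 2 * (cmod a)\<^sup>2 + 2 * (cmod b)\<^sup>2"
    using zero_le_power2[of "cmod a - cmod b"] by (simp add: power2_sum power2_diff)
  finally show ?thesis .
qed

lemma l2_funs_add:
  assumes \<phi>: "\<phi> \<in> l2_funs M" and \<psi>: "\<psi> \<in> l2_funs M"
  shows "(\<lambda>x. \<phi> x + \<psi> x) \<in> l2_funs M"
proof -
  have [measurable]: "\<phi> \<in> borel_measurable M" "\<psi> \<in> borel_measurable M"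
    using assms by (auto simp: l2_funs_def)
  have "integrable M (\<lambda>x. 2 * (cmod (\<phi> x))\<^sup>2 + 2 * (cmod (\<psi> x))\<^sup>2)"
    using assms by (auto simp: l2_funs_def)
  then have "integrable M (\<lambda>x. (cmod (\<phi> x + \<psi> x))\<^sup>2)"
    by (rule Bochner_Integration.integrable_bound) (auto simp: cmod_add_power2_le)
  then show ?thesis by (simp add: l2_funs_def)
qed

lemma l2_funs_diff: "\<phi> \<in> l2_funs M \<Longrightarrow> \<psi> \<in> l2_funs M \<Longrightarrow> (\<lambda>x. \<phi> x - \<psi> x) \<in> l2_funs M"
  using l2_funs_add[OF _ l2_funs_scale[of \<psi> M "-1"]] by simp

lemma l2_inner_integrable:
  assumes "\<phi> \<in> l2_funs M" "\<psi> \<in> l2_funs M"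
  shows "integrable M (\<lambda>x. \<phi> x * cnj (\<psi> x))"
proof -
  have [measurable]: "\<phi> \<in> borel_measurable M" "\<psi> \<in> borel_measurable M"
    using assms by (auto simp: l2_funs_def)
  have "integrable M (\<lambda>x. (cmod (\<phi> x))\<^sup>2 + (cmod (\<psi> x))\<^sup>2)"
    using assms by (auto simp: l2_funs_def)
  then show ?thesis
  proof (rule Bochner_Integration.integrable_bound)
    have "cmod (\<phi> x) * cmod (\<psi> x) \<le> (cmod (\<phi> x))\<^sup>2 + (cmod (\<psi> x))\<^sup>2" for x
      using sum_squares_bound[of "cmod (\<phi> x)" "cmod (\<psi> x)"] zero_le_power2[of "cmod (\<phi> x)"]
        zero_le_power2[of "cmod (\<psi> x)"] by linarith
    then show "AE x in M. norm (\<phi> x * cnj (\<psi> x)) \<le> norm ((cmod (\<phi> x))\<^sup>2 + (cmod (\<psi> x))\<^sup>2)"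
      by (simp add: norm_mult)
  qed measurable
qed

lemma equiv_l2_rel: "equiv (l2_funs M) (l2_rel M)"
proof (rule equivI)
  show "l2_rel M \<subseteq> l2_funs M \<times> l2_funs M" by (auto simp: l2_rel_def)
  show "refl_on (l2_funs M) (l2_rel M)" by (auto simp: refl_on_def l2_rel_def)
  show "sym (l2_rel M)" by (auto simp: sym_def l2_rel_def elim: eventually_mono)
  show "trans (l2_rel M)"
  proof (rule transI)
    fix \<phi> \<psi> \<xi> assume "(\<phi>, \<psi>) \<in> l2_rel M" "(\<psi>, \<xi>) \<in> l2_rel M"
    then have "AE x in M. \<phi> x = \<psi> x" "AE x in M. \<psi> x = \<xi> x" "\<phi> \<in> l2_funs M" "\<xi> \<in> l2_funs M"
      by (auto simp: l2_rel_def)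
    then show "(\<phi>, \<xi>) \<in> l2_rel M" unfolding l2_rel_def by auto
  qed
qed

lemma l2_class_eq_iff:
  "\<phi> \<in> l2_funs M \<Longrightarrow> \<psi> \<in> l2_funs M \<Longrightarrow> l2_class M \<phi> = l2_class M \<psi> \<longleftrightarrow> (AE x in M. \<phi> x = \<psi> x)"
  unfolding l2_class_def by (subst eq_equiv_class_iff[OF equiv_l2_rel]) (auto simp: l2_rel_def)

lemma hcarr_l2: "hcarr (l2 M) = l2_class M ` l2_funs M"
  by (auto simp: l2_def l2_class_def quotient_def)

lemma l2_class_in [simp, intro]: "\<phi> \<in> l2_funs M \<Longrightarrow> l2_class M \<phi> \<in> hcarr (l2 M)"
  by (auto simp: hcarr_l2)

text \<open>The operations of \<open>l2\<close> compute with chosen representatives; this lemma is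
  what replaces them by arbitrary members of the classes, at the price of a null set.\<close>

lemma rep_l2_class:
  assumes "\<phi> \<in> l2_funs M"
  shows "rep (l2_class M \<phi>) \<in> l2_funs M" "AE x in M. rep (l2_class M \<phi>) x = \<phi> x"
proof -
  have "\<phi> \<in> l2_class M \<phi>" using assms by (auto simp: l2_class_def l2_rel_def)
  then have "rep (l2_class M \<phi>) \<in> l2_class M \<phi>" unfolding rep_def by (rule someI[where P = "\<lambda>\<xi>. \<xi> \<in> l2_class M \<phi>"])
  then show "rep (l2_class M \<phi>) \<in> l2_funs M" "AE x in M. rep (l2_class M \<phi>) x = \<phi> x"
    by (auto simp: l2_class_def l2_rel_def elim: eventually_mono)
qed

lemma rep_l2:
  assumes "F \<in> hcarr (l2 M)"
  shows "rep F \<in> l2_funs M" "l2_class M (rep F) = F"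
proof -
  obtain \<phi> where \<phi>: "\<phi> \<in> l2_funs M" "F = l2_class M \<phi>" using assms by (auto simp: hcarr_l2)
  then show "rep F \<in> l2_funs M" using rep_l2_class by blast
  then show "l2_class M (rep F) = F" using rep_l2_class[OF \<phi>(1)] \<phi> by (simp add: l2_class_eq_iff)
qed

lemma hadd_l2_class:
  assumes "\<phi> \<in> l2_funs M" "\<psi> \<in> l2_funs M"
  shows "hadd (l2 M) (l2_class M \<phi>) (l2_class M \<psi>) = l2_class M (\<lambda>x. \<phi> x + \<psi> x)"
  using rep_l2_class[OF assms(1)] rep_l2_class[OF assms(2)]
  by (auto simp: l2_def l2_class_eq_iff l2_funs_add assms)

lemma hscale_l2_class:
  assumes "\<phi> \<in> l2_funs M"
  shows "hscale (l2 M) c (l2_class M \<phi>) = l2_class M (\<lambda>x. c * \<phi> x)"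
  using rep_l2_class[OF assms] by (auto simp: l2_def l2_class_eq_iff l2_funs_scale assms)

lemma hinner_l2_class:
  assumes "\<phi> \<in> l2_funs M" "\<psi> \<in> l2_funs M"
  shows "hinner (l2 M) (l2_class M \<phi>) (l2_class M \<psi>) = (\<integral>x. \<phi> x * cnj (\<psi> x) \<partial>M)"
  unfolding l2_def hilbert.simps
proof (rule integral_cong_AE)
  note [measurable] = l2_funs_measurable[OF assms(1)] l2_funs_measurable[OF assms(2)]
    l2_funs_measurable[OF rep_l2_class(1)[OF assms(1)]]
    l2_funs_measurable[OF rep_l2_class(1)[OF assms(2)]]
  show "(\<lambda>x. rep (l2_class M \<phi>) x * cnj (rep (l2_class M \<psi>) x)) \<in> borel_measurable M"
    "(\<lambda>x. \<phi> x * cnj (\<psi> x)) \<in> borel_measurable M" by measurable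
  show "AE x in M. rep (l2_class M \<phi>) x * cnj (rep (l2_class M \<psi>) x) = \<phi> x * cnj (\<psi> x)"
    using rep_l2_class(2)[OF assms(1)] rep_l2_class(2)[OF assms(2)] by auto
qed

lemma hinner_l2_class_self:
  assumes "\<phi> \<in> l2_funs M"
  shows "hinner (l2 M) (l2_class M \<phi>) (l2_class M \<phi>)
    = complex_of_real (\<integral>x. (cmod (\<phi> x))\<^sup>2 \<partial>M)"
  using assms
  by (simp only: hinner_l2_class complex_norm_square integral_complex_of_real[symmetric])

lemma hnorm_l2_class:
  assumes "\<phi> \<in> l2_funs M"
  shows "hnorm (l2 M) (l2_class M \<phi>) = sqrt (\<integral>x. (cmod (\<phi> x))\<^sup>2 \<partial>M)"
  using assms by (simp add: hnorm_def hinner_l2_class_self)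

lemma hdiff_l2_class:
  assumes "\<phi> \<in> l2_funs M" "\<psi> \<in> l2_funs M"
  shows "hadd (l2 M) (l2_class M \<phi>) (hscale (l2 M) (-1) (l2_class M \<psi>))
    = l2_class M (\<lambda>x. \<phi> x - \<psi> x)"
  using assms by (simp add: hscale_l2_class hadd_l2_class l2_funs_scale[of \<psi> M "-1", simplified])

text \<open>The estimates to come are made with nonnegative integrals, which exist before square
  integrability is known; this translates them back into norms.\<close>

lemma nn_integral_l2:
  assumes "\<phi> \<in> l2_funs M"
  shows "(\<integral>\<^sup>+x. ennreal ((cmod (\<phi> x))\<^sup>2) \<partial>M) = ennreal ((hnorm (l2 M) (l2_class M \<phi>))\<^sup>2)"
  using l2_funs_integrable[OF assms] by (simp add: hnorm_l2_class[OF assms] nn_integral_eq_integral)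

text \<open>Riesz--Fischer. Along a subsequence whose consecutive differences \<open>\<delta>\<^sub>k\<close> satisfy
  \<open>\<parallel>\<delta>\<^sub>k\<parallel>\<^sup>2 \<le> 8\<^sup>-\<^sup>k\<close>, the function \<open>\<Sum>k. 4\<^sup>k \<bar>\<delta>\<^sub>k\<bar>\<^sup>2\<close> is integrable, hence almost everywhere
  \<open>\<bar>\<delta>\<^sub>k\<bar> \<le> 2\<^sup>-\<^sup>k\<close> eventually and the subsequence converges; Fatou's lemma does the rest.\<close>

lemma l2_complete:
  assumes \<phi>: "\<And>n. \<phi> n \<in> l2_funs M"
    and cauchy: "\<And>\<epsilon>. 0 < \<epsilon> \<Longrightarrow> \<exists>N::nat. \<forall>m\<ge>N. \<forall>n\<ge>N.
      (\<integral>\<^sup>+x. ennreal ((cmod (\<phi> m x - \<phi> n x))\<^sup>2) \<partial>M) \<le> ennreal \<epsilon>"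
  obtains \<psi> where "\<psi> \<in> l2_funs M" "\<And>\<epsilon>. 0 < \<epsilon> \<Longrightarrow> \<exists>N. \<forall>n\<ge>N.
      (\<integral>\<^sup>+x. ennreal ((cmod (\<phi> n x - \<psi> x))\<^sup>2) \<partial>M) \<le> ennreal \<epsilon>"
proof -
  have [measurable]: "\<phi> n \<in> borel_measurable M" for n using \<phi> by (simp add: l2_funs_def)
  have "\<forall>k. \<exists>N::nat. \<forall>m\<ge>N. \<forall>n\<ge>N.
      (\<integral>\<^sup>+x. ennreal ((cmod (\<phi> m x - \<phi> n x))\<^sup>2) \<partial>M) \<le> ennreal ((1/8)^k)"
    using cauchy by simp
  then obtain N :: "nat \<Rightarrow> nat" where N: "\<And>k m n. N k \<le> m \<Longrightarrow> N k \<le> n \<Longrightarrow>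
      (\<integral>\<^sup>+x. ennreal ((cmod (\<phi> m x - \<phi> n x))\<^sup>2) \<partial>M) \<le> ennreal ((1/8)^k)" by metis
  \<comment> \<open>The sum puts \<open>r k\<close> and \<open>r (Suc k)\<close> both beyond
    \<open>N k\<close> without assuming \<open>N\<close> monotone, and the summand \<open>k\<close>
    sends \<open>r\<close> to infinity.\<close>
  define r where "r k = k + (\<Sum>i\<le>k. N i)" for k
  have r_ge: "k \<le> r k" "N k \<le> r k" "N k \<le> r (Suc k)" for k
    using member_le_sum[of k "{..k}" N] by (auto simp: r_def)
  define \<delta> where "\<delta> k x = \<phi> (r (Suc k)) x - \<phi> (r k) x" for k x
  have [measurable]: "\<delta> k \<in> borel_measurable M" for k unfolding \<delta>_def by measurable
  have "(\<integral>\<^sup>+x. (\<Sum>k. ennreal (4^k * (cmod (\<delta> k x))\<^sup>2)) \<partial>M)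
      = (\<Sum>k. \<integral>\<^sup>+x. ennreal (4^k * (cmod (\<delta> k x))\<^sup>2) \<partial>M)"
    by (rule nn_integral_suminf) measurable
  also have "\<dots> \<le> (\<Sum>k. ennreal ((1/2)^k))"
  proof (rule suminf_le)
    fix k
    have "(\<integral>\<^sup>+x. ennreal (4^k * (cmod (\<delta> k x))\<^sup>2) \<partial>M)
        = ennreal (4^k) * (\<integral>\<^sup>+x. ennreal ((cmod (\<delta> k x))\<^sup>2) \<partial>M)"
      by (simp add: ennreal_mult nn_integral_cmult)
    also have "\<dots> \<le> ennreal (4^k) * ennreal ((1/8)^k)"
      unfolding \<delta>_def by (intro mult_left_mono N r_ge) auto
    also have "\<dots> = ennreal ((4 * (1/8))^k)" by (simp only: power_mult_distrib ennreal_mult zero_le_power)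
    finally show "(\<integral>\<^sup>+x. ennreal (4^k * (cmod (\<delta> k x))\<^sup>2) \<partial>M) \<le> ennreal ((1/2)^k)" by simp
  qed auto
  also have "\<dots> = ennreal (\<Sum>k. (1/2)^k)"
    by (rule suminf_ennreal2) (auto intro: summable_geometric)
  also have "\<dots> < \<infinity>" by (rule ennreal_less_top[folded infinity_ennreal_def])
  finally have "AE x in M. (\<Sum>k. ennreal (4^k * (cmod (\<delta> k x))\<^sup>2)) \<noteq> \<infinity>"
    by (intro nn_integral_noteq_infinite) measurable
  then have conv: "AE x in M. convergent (\<lambda>k. \<phi> (r k) x)"
  proof eventually_elim
    case (elim x)
    have "summable (\<lambda>k. 4^k * (cmod (\<delta> k x))\<^sup>2)"
      using elim by (intro summable_suminf_not_top) auto
    then have "\<forall>\<^sub>F k in sequentially. 4^k * (cmod (\<delta> k x))\<^sup>2 < 1"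
      by (intro order_tendstoD(2)[OF summable_LIMSEQ_zero]) auto
    then have "\<forall>\<^sub>F k in sequentially. norm (cmod (\<delta> k x)) \<le> (1/2)^k"
    proof eventually_elim
      case (elim k)
      have "((2::real)^k)\<^sup>2 = 4^k" by (simp add: power_even_eq[symmetric] power2_eq_square flip: power_mult_distrib)
      with elim have "(2^k * cmod (\<delta> k x))\<^sup>2 \<le> 1\<^sup>2" by (simp add: power_mult_distrib)
      then have "2^k * cmod (\<delta> k x) \<le> 1" by (rule power2_le_imp_le) simp
      then show ?case by (simp add: field_simps)
    qed
    then have "summable (\<lambda>k. cmod (\<delta> k x))"
      by (rule summable_comparison_test_ev) (simp add: summable_geometric)
    then have "summable (\<lambda>k. \<delta> k x)" by (rule summable_norm_cancel)
    then have "convergent (\<lambda>m. (\<Sum>k<m. \<delta> k x) + \<phi> (r 0) x)"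
      by (intro convergent_add convergent_const) (simp add: summable_iff_convergent)
    then show ?case
      unfolding \<delta>_def sum_lessThan_telescope[of "\<lambda>k. \<phi> (r k) x"] by simp
  qed
  define \<psi> where "\<psi> x = lim (\<lambda>k. \<phi> (r k) x)" for x
  have [measurable]: "\<psi> \<in> borel_measurable M"
    unfolding \<psi>_def by (rule borel_measurable_lim_metric) measurable
  have close: "\<exists>N. \<forall>n\<ge>N. (\<integral>\<^sup>+x. ennreal ((cmod (\<phi> n x - \<psi> x))\<^sup>2) \<partial>M) \<le> ennreal \<epsilon>"
    if "0 < \<epsilon>" for \<epsilon> :: real
  proof -
    obtain N where N: "\<And>m n. N \<le> m \<Longrightarrow> N \<le> n \<Longrightarrow>
      (\<integral>\<^sup>+x. ennreal ((cmod (\<phi> m x - \<phi> n x))\<^sup>2) \<partial>M) \<le> ennreal \<epsilon>" using cauchy[OF \<open>0 < \<epsilon>\<close>] by blast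
    have "(\<integral>\<^sup>+x. ennreal ((cmod (\<phi> n x - \<psi> x))\<^sup>2) \<partial>M) \<le> ennreal \<epsilon>" if n: "N \<le> n" for n
    proof -
      have "AE x in M. ennreal ((cmod (\<phi> n x - \<psi> x))\<^sup>2)
          = liminf (\<lambda>k. ennreal ((cmod (\<phi> n x - \<phi> (r k) x))\<^sup>2))"
        using conv
      proof eventually_elim
        case (elim x)
        then have "(\<lambda>k. \<phi> (r k) x) \<longlonglongrightarrow> \<psi> x" unfolding \<psi>_def by (simp add: convergent_LIMSEQ_iff)
        then have "(\<lambda>k. ennreal ((cmod (\<phi> n x - \<phi> (r k) x))\<^sup>2))
            \<longlonglongrightarrow> ennreal ((cmod (\<phi> n x - \<psi> x))\<^sup>2)"
          by (intro tendsto_intros)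
        then show ?case by (intro lim_imp_Liminf[symmetric]) auto
      qed
      then have "(\<integral>\<^sup>+x. ennreal ((cmod (\<phi> n x - \<psi> x))\<^sup>2) \<partial>M)
          = (\<integral>\<^sup>+x. liminf (\<lambda>k. ennreal ((cmod (\<phi> n x - \<phi> (r k) x))\<^sup>2)) \<partial>M)"
        by (rule nn_integral_cong_AE)
      also have "\<dots> \<le> liminf (\<lambda>k. \<integral>\<^sup>+x. ennreal ((cmod (\<phi> n x - \<phi> (r k) x))\<^sup>2) \<partial>M)"
        by (rule nn_integral_liminf) measurable
      also have "\<dots> \<le> limsup (\<lambda>k. \<integral>\<^sup>+x. ennreal ((cmod (\<phi> n x - \<phi> (r k) x))\<^sup>2) \<partial>M)"
        by (rule Liminf_le_Limsup) simp
      also have "\<dots> \<le> ennreal \<epsilon>"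
      proof (rule Limsup_bounded)
        show "\<forall>\<^sub>F k in sequentially.
            (\<integral>\<^sup>+x. ennreal ((cmod (\<phi> n x - \<phi> (r k) x))\<^sup>2) \<partial>M) \<le> ennreal \<epsilon>"
          using eventually_ge_at_top[of N]
        proof eventually_elim
          case (elim k)
          then show ?case using r_ge(1)[of k] by (intro N n) auto
        qed
      qed
      finally show ?thesis .
    qed
    then show ?thesis by blast
  qed
  \<comment> \<open>One square integrable difference is enough: \<psi> is then
    \<open>\<phi> n\<close> minus a member of \<open>l2_funs M\<close>.\<close>
  obtain n where n: "(\<integral>\<^sup>+x. ennreal ((cmod (\<phi> n x - \<psi> x))\<^sup>2) \<partial>M) \<le> ennreal 1"
    using close[of 1] by auto
  have "(\<lambda>x. \<phi> n x - \<psi> x) \<in> l2_funs M"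
    using n by (auto simp: l2_funs_iff_nn_integral intro: le_less_trans)
  from l2_funs_diff[OF \<phi>[of n] this] have "\<psi> \<in> l2_funs M" by simp
  then show ?thesis using close that by blast
qed

lemma hilbert_space_l2: "hilbert_space (l2 M)"
proof
  have zero: "(\<lambda>x. 0) \<in> l2_funs M" by (simp add: l2_funs_def)
  then show "hcarr (l2 M) \<noteq> {}" by (auto simp: hcarr_l2)
  fix F G K assume F: "F \<in> hcarr (l2 M)"
  obtain \<phi> where \<phi>: "\<phi> \<in> l2_funs M" "F = l2_class M \<phi>" using F by (auto simp: hcarr_l2)
  show "hscale (l2 M) c F \<in> hcarr (l2 M)" for c
    using \<phi> by (simp add: hscale_l2_class l2_class_in l2_funs_scale)
  show "0 \<le> Re (hinner (l2 M) F F)" using \<phi> by (simp add: hinner_l2_class_self)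
  assume G: "G \<in> hcarr (l2 M)"
  obtain \<psi> where \<psi>: "\<psi> \<in> l2_funs M" "G = l2_class M \<psi>" using G by (auto simp: hcarr_l2)
  show "hadd (l2 M) F G \<in> hcarr (l2 M)"
    using \<phi> \<psi> by (simp add: hadd_l2_class l2_class_in l2_funs_add)
  show "hinner (l2 M) (hscale (l2 M) c F) G = c * hinner (l2 M) F G" for c
    using \<phi> \<psi> by (simp add: hscale_l2_class hinner_l2_class l2_funs_scale mult.assoc)
  show "hinner (l2 M) G F = cnj (hinner (l2 M) F G)"
    using \<phi> \<psi>
    by (simp add: hinner_l2_class mult.commute flip: Bochner_Integration.integral_cnj)
  show "F = G" if "hnorm (l2 M) (hadd (l2 M) F (hscale (l2 M) (-1) G)) = 0"
  proof -
    have d: "(\<lambda>x. \<phi> x - \<psi> x) \<in> l2_funs M" using \<phi> \<psi> by (simp add: l2_funs_diff)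
    have "(\<integral>x. (cmod (\<phi> x - \<psi> x))\<^sup>2 \<partial>M) = 0"
      using that \<phi> \<psi> d by (simp add: hdiff_l2_class hnorm_l2_class)
    then have "AE x in M. (cmod (\<phi> x - \<psi> x))\<^sup>2 = 0"
      using l2_funs_integrable[OF d] by (subst (asm) integral_nonneg_eq_0_iff_AE) auto
    then show ?thesis using \<phi> \<psi> by (simp add: l2_class_eq_iff)
  qed
  assume K: "K \<in> hcarr (l2 M)"
  obtain \<xi> where \<xi>: "\<xi> \<in> l2_funs M" "K = l2_class M \<xi>" using K by (auto simp: hcarr_l2)
  show "hinner (l2 M) (hadd (l2 M) F G) K = hinner (l2 M) F K + hinner (l2 M) G K"
    using \<phi> \<psi> \<xi>
    by (simp add: hadd_l2_class hinner_l2_class l2_funs_add distrib_right l2_inner_integrable)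
next
  fix X assume X: "\<And>n::nat. X n \<in> hcarr (l2 M)"
    and cauchy: "\<And>\<epsilon>. 0 < \<epsilon> \<Longrightarrow> \<exists>N. \<forall>m\<ge>N. \<forall>n\<ge>N.
      hnorm (l2 M) (hadd (l2 M) (X m) (hscale (l2 M) (-1) (X n))) < \<epsilon>"
  define \<phi> where "\<phi> n = rep (X n)" for n
  have \<phi>: "\<phi> n \<in> l2_funs M" "X n = l2_class M (\<phi> n)" for n
    using rep_l2[OF X[of n]] by (auto simp: \<phi>_def)
  have "\<exists>N. \<forall>m\<ge>N. \<forall>n\<ge>N. (\<integral>\<^sup>+x. ennreal ((cmod (\<phi> m x - \<phi> n x))\<^sup>2) \<partial>M) \<le> ennreal \<epsilon>"
    if "0 < \<epsilon>" for \<epsilon>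
  proof -
    have "\<exists>N. \<forall>m\<ge>N. \<forall>n\<ge>N. hnorm (l2 M) (l2_class M (\<lambda>x. \<phi> m x - \<phi> n x)) < sqrt \<epsilon>"
      using cauchy[of "sqrt \<epsilon>"] that by (simp add: \<phi> hdiff_l2_class)
    then obtain N where N: "\<And>m n. N \<le> m \<Longrightarrow> N \<le> n \<Longrightarrow>
        hnorm (l2 M) (l2_class M (\<lambda>x. \<phi> m x - \<phi> n x)) < sqrt \<epsilon>" by blast
    have "(hnorm (l2 M) (l2_class M (\<lambda>x. \<phi> m x - \<phi> n x)))\<^sup>2 \<le> \<epsilon>" if "N \<le> m" "N \<le> n" for m n
      using power_mono[OF less_imp_le[OF N[OF that]], of 2] \<open>0 < \<epsilon>\<close>
      by (simp add: hnorm_l2_class l2_funs_diff \<phi>)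
    then show ?thesis using nn_integral_l2[OF l2_funs_diff[OF \<phi>(1) \<phi>(1)]] by (auto intro!: ennreal_leI)
  qed
  from l2_complete[OF \<phi>(1) this] obtain \<psi> where \<psi>: "\<psi> \<in> l2_funs M"
    and lim: "\<And>\<epsilon>. 0 < \<epsilon> \<Longrightarrow> \<exists>N. \<forall>n\<ge>N.
      (\<integral>\<^sup>+x. ennreal ((cmod (\<phi> n x - \<psi> x))\<^sup>2) \<partial>M) \<le> ennreal \<epsilon>" by blast
  have "(\<lambda>n. hnorm (l2 M) (l2_class M (\<lambda>x. \<phi> n x - \<psi> x))) \<longlonglongrightarrow> 0"
  proof (rule LIMSEQ_I)
    fix \<epsilon> :: real assume "0 < \<epsilon>"
    then obtain N where N: "\<And>n. N \<le> n \<Longrightarrow>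
        (\<integral>\<^sup>+x. ennreal ((cmod (\<phi> n x - \<psi> x))\<^sup>2) \<partial>M) \<le> ennreal ((\<epsilon>/2)\<^sup>2)"
      using lim[of "(\<epsilon>/2)\<^sup>2"] by auto
    have "norm (hnorm (l2 M) (l2_class M (\<lambda>x. \<phi> n x - \<psi> x)) - 0) < \<epsilon>" if "N \<le> n" for n
    proof -
      have "ennreal ((hnorm (l2 M) (l2_class M (\<lambda>x. \<phi> n x - \<psi> x)))\<^sup>2) \<le> ennreal ((\<epsilon>/2)\<^sup>2)"
        using N[OF that] nn_integral_l2[OF l2_funs_diff[OF \<phi>(1) \<psi>]] by simp
      then have "(hnorm (l2 M) (l2_class M (\<lambda>x. \<phi> n x - \<psi> x)))\<^sup>2 \<le> (\<epsilon>/2)\<^sup>2"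
        by (subst (asm) ennreal_le_iff) auto
      then have "hnorm (l2 M) (l2_class M (\<lambda>x. \<phi> n x - \<psi> x)) \<le> \<epsilon>/2"
        by (rule power2_le_imp_le) (use \<open>0 < \<epsilon>\<close> in simp)
      moreover have "0 \<le> hnorm (l2 M) (l2_class M (\<lambda>x. \<phi> n x - \<psi> x))"
        using l2_funs_diff[OF \<phi>(1)[of n] \<psi>] by (simp add: hnorm_l2_class)
      ultimately show ?thesis using \<open>0 < \<epsilon>\<close> by simp
    qed
    then show "\<exists>N. \<forall>n\<ge>N. norm (hnorm (l2 M) (l2_class M (\<lambda>x. \<phi> n x - \<psi> x)) - 0) < \<epsilon>" by blast
  qed
  then show "\<exists>u\<in>hcarr (l2 M).
      (\<lambda>n. hnorm (l2 M) (hadd (l2 M) (X n) (hscale (l2 M) (-1) u))) \<longlonglongrightarrow> 0"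
    by (intro bexI[of _ "l2_class M \<psi>"]) (auto simp: \<phi> \<psi> hdiff_l2_class)
qed

section \<open>The operators of a branching system\<close>

locale branching_edge =
  fixes M :: "'x measure" and D R :: "'x set" and f g :: "'x \<Rightarrow> 'x"
  assumes sigma_finite: "sigma_finite_measure M"
    and R [measurable]: "R \<in> sets M" and D [measurable]: "D \<in> sets M"
    and f [measurable]: "f \<in> measurable (restrict_space M D) (restrict_space M R)"
    and g [measurable]: "g \<in> measurable (restrict_space M R) (restrict_space M D)"
    and f_g: "AE x in restrict_space M R. f (g x) = x"
    and g_f: "AE x in restrict_space M D. g (f x) = x"
    and ac_g: "absolutely_continuous (restrict_space M D)
      (distr (restrict_space M R) (restrict_space M D) g)"
    and ac_f: "absolutely_continuous (restrict_space M R)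
      (distr (restrict_space M D) (restrict_space M R) f)"
begin

abbreviation "MD \<equiv> restrict_space M D"
abbreviation "MR \<equiv> restrict_space M R"

text \<open>The body is that of \<open>RN_inv\<close> with the edge fixed, so that the two unfold to
  the same term.\<close>

definition \<Phi> :: "'x \<Rightarrow> real" where
  "\<Phi> x = enn2real (RN_deriv MR (distr MD MR f) x)"

lemma \<Phi>_nonneg: "0 \<le> \<Phi> x"
  by (simp add: \<Phi>_def)

lemma \<Phi>_measurable [measurable]: "\<Phi> \<in> borel_measurable MR"
  unfolding \<Phi>_def by measurable

lemma space_restrict: "space MD = D" "space MR = R"
  using sets.sets_into_space[OF D] sets.sets_into_space[OF R] by (auto simp: space_restrict_space)

lemma f_in: "x \<in> D \<Longrightarrow> f x \<in> R" and g_in: "x \<in> R \<Longrightarrow> g x \<in> D"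
  using measurable_space[OF f] measurable_space[OF g] by (auto simp: space_restrict)

lemma AE_MR: "(AE x in MR. P x) \<longleftrightarrow> (AE x in M. x \<in> R \<longrightarrow> P x)"
  and AE_MD: "(AE x in MD. P x) \<longleftrightarrow> (AE x in M. x \<in> D \<longrightarrow> P x)"
  by (rule AE_restrict_space_iff; simp)+

text \<open>By \<open>ac_g\<close> the preimage under \<open>g\<close> of a null set is null. Every
  passage of an almost everywhere statement from \<open>D\<close> to \<open>R\<close> goes through
  here.\<close>

lemma AE_pull_g: "AE x in MD. P x \<Longrightarrow> AE y in MR. P (g y)"
  by (rule AE_distrD[OF g absolutely_continuous_AE[OF _ ac_g]]) auto

text \<open>The push-forward is \<open>\<sigma>\<close>-finite because \<open>f\<close> is invertible almost everywhere; without this its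
  Radon--Nikodym derivative could be infinite.\<close>

lemma sigma_finite_distr_f: "sigma_finite_measure (distr MD MR f)"
proof -
  obtain A where A: "countable A" "A \<subseteq> sets MD" "\<Union>A = space MD" "\<forall>a\<in>A. emeasure MD a \<noteq> \<infinity>"
    using sigma_finite_measure.sigma_finite_countable[OF sigma_finite_measure_restrict_space[OF sigma_finite D]]
    by blast
  let ?B = "(\<lambda>a. g -` a \<inter> space MR) ` A"
  show ?thesis
  proof (rule sigma_finite_measure.intro, intro exI[of _ ?B] conjI ballI)
    show "countable ?B" using A by simp
    show "?B \<subseteq> sets (distr MD MR f)" using A measurable_sets[OF g] by auto
    show "\<Union>?B = space (distr MD MR f)"
      using A(3) measurable_space[OF g] by (auto simp: set_eq_iff)
    fix b assume "b \<in> ?B"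
    then obtain a where a: "a \<in> A" "b = g -` a \<inter> space MR" by auto
    have [measurable]: "a \<in> sets MD" using A a by auto
    have b: "b \<in> sets MR" using a measurable_sets[OF g] by auto
    have "emeasure (distr MD MR f) b = emeasure MD (f -` b \<inter> space MD)"
      by (rule emeasure_distr[OF f b])
    also have "\<dots> = emeasure MD a"
    proof (rule emeasure_eq_AE)
      show "AE x in MD. x \<in> f -` b \<inter> space MD \<longleftrightarrow> x \<in> a"
        using g_f AE_space
      proof eventually_elim
        case (elim x)
        then show ?case using a f_in by (auto simp: space_restrict)
      qed
      show "f -` b \<inter> space MD \<in> sets MD" by (rule measurable_sets[OF f b])
    qed measurable
    finally show "emeasure (distr MD MR f) b \<noteq> \<infinity>" using A a by simp
  qed
qed

text \<open>\<open>enn2real\<close> sends infinity to 0, so the real valued \<Phi> could have lost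
  mass; it has not, because the derivative of a \<sigma>-finite measure is finite almost
  everywhere.\<close>

lemma density_\<Phi>: "density MR (\<lambda>x. ennreal (\<Phi> x)) = distr MD MR f"
proof -
  interpret MR: sigma_finite_measure MR
    by (rule sigma_finite_measure_restrict_space[OF sigma_finite R])
  have "AE x in MR. RN_deriv MR (distr MD MR f) x \<noteq> \<infinity>"
    by (rule MR.RN_deriv_finite[OF sigma_finite_distr_f ac_f]) simp
  then have "AE x in MR. ennreal (\<Phi> x) = RN_deriv MR (distr MD MR f) x"
    by eventually_elim (simp add: \<Phi>_def less_top)
  then have "density MR (\<lambda>x. ennreal (\<Phi> x)) = density MR (RN_deriv MR (distr MD MR f))"
    by (intro density_cong) measurable
  also have "\<dots> = distr MD MR f" by (rule MR.density_RN_deriv[OF ac_f]) simp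
  finally show ?thesis .
qed

lemma \<Phi>_pos_f: "AE x in MD. 0 < \<Phi> (f x)"
proof -
  have "AE y in density MR (\<lambda>x. ennreal (\<Phi> x)). 0 < \<Phi> y"
    by (subst AE_density) (auto simp: ennreal_less_zero_iff)
  then show ?thesis unfolding density_\<Phi> by (rule AE_distrD[OF f])
qed

text \<open>A density is always positive almost everywhere for the measure that it defines. Here the
  same is obtained for \<open>MR\<close> itself, by pulling back along \<open>g\<close> and using
  \<open>f (g y) = y\<close>; this is what permits division by the root of \<Phi>.\<close>

lemma \<Phi>_pos: "AE y in MR. 0 < \<Phi> y"
  using AE_pull_g[OF \<Phi>_pos_f] f_g by eventually_elim simp

lemma nn_integral_\<Phi>:
  assumes [measurable]: "h \<in> borel_measurable MR"
  shows "(\<integral>\<^sup>+y. ennreal (\<Phi> y) * h y \<partial>MR) = (\<integral>\<^sup>+x. h (f x) \<partial>MD)"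
proof -
  have "(\<integral>\<^sup>+y. ennreal (\<Phi> y) * h y \<partial>MR) = (\<integral>\<^sup>+y. h y \<partial>distr MD MR f)"
    unfolding density_\<Phi>[symmetric] by (rule nn_integral_density[symmetric]) measurable
  also have "\<dots> = (\<integral>\<^sup>+x. h (f x) \<partial>MD)" by (rule nn_integral_distr) measurable
  finally show ?thesis .
qed

text \<open>\<open>E\<close> and the following \<open>F\<close> are the partial isometry of the edge
  and its adjoint on functions instead of classes. Where \<Phi> vanishes at \<open>f x\<close>, the
  division in \<open>F\<close> takes its default value 0, which happens on a null set only.\<close>

definition E :: "('x \<Rightarrow> complex) \<Rightarrow> 'x \<Rightarrow> complex" where
  "E \<phi> x = (if x \<in> R then complex_of_real (sqrt (\<Phi> x)) * \<phi> (g x) else 0)"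

definition F :: "('x \<Rightarrow> complex) \<Rightarrow> 'x \<Rightarrow> complex" where
  "F \<psi> x = (if x \<in> D then \<psi> (f x) / complex_of_real (sqrt (\<Phi> (f x))) else 0)"

lemma measurable_g_comp: "\<phi> \<in> borel_measurable M \<Longrightarrow> (\<lambda>y. \<phi> (g y)) \<in> borel_measurable MR"
  by (rule measurable_compose[OF g]) (rule measurable_restrict_space1)

lemma measurable_f_comp: "\<psi> \<in> borel_measurable MR \<Longrightarrow> (\<lambda>x. \<psi> (f x)) \<in> borel_measurable MD"
  by (rule measurable_compose[OF f])

lemma E_measurable: "\<phi> \<in> borel_measurable M \<Longrightarrow> E \<phi> \<in> borel_measurable M"
proof -
  assume \<phi>: "\<phi> \<in> borel_measurable M"
  note [measurable] = measurable_g_comp[OF \<phi>]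
  have "(\<lambda>x. complex_of_real (sqrt (\<Phi> x)) * \<phi> (g x)) \<in> borel_measurable MR" by measurable
  then show ?thesis unfolding E_def[abs_def] by (subst (asm) measurable_restrict_space_iff) auto
qed

lemma F_measurable: "\<psi> \<in> borel_measurable M \<Longrightarrow> F \<psi> \<in> borel_measurable M"
proof -
  assume \<psi>: "\<psi> \<in> borel_measurable M"
  note [measurable] = measurable_f_comp[OF measurable_restrict_space1[OF \<psi>]]
  have "(\<lambda>x. \<psi> (f x) / complex_of_real (sqrt (\<Phi> (f x)))) \<in> borel_measurable MD" by measurable
  then show ?thesis unfolding F_def[abs_def] by (subst (asm) measurable_restrict_space_iff) auto
qed

text \<open>The density acts as a Jacobian: \<open>\<Phi> |\<phi> o g|^2\<close> on \<open>R\<close>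
  pulls back along \<open>f\<close> to \<open>|\<phi>|^2\<close> on \<open>D\<close>. Only the part
  of \<phi> outside \<open>D\<close> is lost, whence an inequality.\<close>

lemma nn_integral_E:
  assumes [measurable]: "\<phi> \<in> borel_measurable M"
  shows "(\<integral>\<^sup>+x. ennreal ((cmod (E \<phi> x))\<^sup>2) \<partial>M) \<le> (\<integral>\<^sup>+x. ennreal ((cmod (\<phi> x))\<^sup>2) \<partial>M)"
proof -
  note [measurable] = measurable_g_comp[OF assms] measurable_restrict_space1[OF assms]
  have "(\<integral>\<^sup>+x. ennreal ((cmod (E \<phi> x))\<^sup>2) \<partial>M)
      = (\<integral>\<^sup>+y. ennreal (\<Phi> y) * ennreal ((cmod (\<phi> (g y)))\<^sup>2) \<partial>MR)"
    by (subst nn_integral_restrict_space)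
      (auto intro!: nn_integral_cong simp: E_def norm_mult power_mult_distrib \<Phi>_nonneg ennreal_mult
        split: split_indicator)
  also have "\<dots> = (\<integral>\<^sup>+x. ennreal ((cmod (\<phi> (g (f x))))\<^sup>2) \<partial>MD)"
    by (rule nn_integral_\<Phi>) measurable
  also have "\<dots> = (\<integral>\<^sup>+x. ennreal ((cmod (\<phi> x))\<^sup>2) \<partial>MD)"
    by (rule nn_integral_cong_AE) (use g_f in eventually_elim, simp)
  also have "\<dots> \<le> (\<integral>\<^sup>+x. ennreal ((cmod (\<phi> x))\<^sup>2) \<partial>M)"
    by (subst nn_integral_restrict_space) (auto intro!: nn_integral_mono split: split_indicator)
  finally show ?thesis .
qed

text \<open>The same change of variables in the other direction; the weight \<Phi> cancels the
  denominator because \<Phi> is positive almost everywhere on \<open>R\<close>.\<close>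

lemma nn_integral_F:
  assumes [measurable]: "\<psi> \<in> borel_measurable M"
  shows "(\<integral>\<^sup>+x. ennreal ((cmod (F \<psi> x))\<^sup>2) \<partial>M) \<le> (\<integral>\<^sup>+x. ennreal ((cmod (\<psi> x))\<^sup>2) \<partial>M)"
proof -
  note [measurable] = measurable_restrict_space1[OF assms]
  let ?h = "\<lambda>y. ennreal ((cmod (\<psi> y / complex_of_real (sqrt (\<Phi> y))))\<^sup>2)"
  have "(\<integral>\<^sup>+x. ennreal ((cmod (F \<psi> x))\<^sup>2) \<partial>M) = (\<integral>\<^sup>+x. ?h (f x) \<partial>MD)"
    by (subst nn_integral_restrict_space)
      (auto intro!: nn_integral_cong simp: F_def split: split_indicator)
  also have "\<dots> = (\<integral>\<^sup>+y. ennreal (\<Phi> y) * ?h y \<partial>MR)"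
    by (rule nn_integral_\<Phi>[symmetric]) measurable
  also have "\<dots> = (\<integral>\<^sup>+y. ennreal ((cmod (\<psi> y))\<^sup>2) \<partial>MR)"
  proof (rule nn_integral_cong_AE)
    show "AE y in MR. ennreal (\<Phi> y) * ?h y = ennreal ((cmod (\<psi> y))\<^sup>2)"
      using \<Phi>_pos by eventually_elim (simp add: norm_divide power_divide flip: ennreal_mult)
  qed
  also have "\<dots> \<le> (\<integral>\<^sup>+x. ennreal ((cmod (\<psi> x))\<^sup>2) \<partial>M)"
    by (subst nn_integral_restrict_space) (auto intro!: nn_integral_mono split: split_indicator)
  finally show ?thesis .
qed

lemma E_l2: "\<phi> \<in> l2_funs M \<Longrightarrow> E \<phi> \<in> l2_funs M"
  using nn_integral_E[of \<phi>] E_measurable[of \<phi>]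
  by (auto simp: l2_funs_iff_nn_integral intro: le_less_trans)

lemma F_l2: "\<psi> \<in> l2_funs M \<Longrightarrow> F \<psi> \<in> l2_funs M"
  using nn_integral_F[of \<psi>] F_measurable[of \<psi>]
  by (auto simp: l2_funs_iff_nn_integral intro: le_less_trans)

lemma E_adjoint:
  assumes \<phi>: "\<phi> \<in> borel_measurable M" and \<psi>: "\<psi> \<in> borel_measurable M"
  shows "(\<integral>x. E \<phi> x * cnj (\<psi> x) \<partial>M) = (\<integral>x. \<phi> x * cnj (F \<psi> x) \<partial>M)"
proof -
  note [measurable] = measurable_g_comp[OF \<phi>] measurable_restrict_space1[OF \<phi>]
    measurable_restrict_space1[OF \<psi>]
  let ?s = "\<lambda>y. complex_of_real (sqrt (\<Phi> y))"
  \<comment> \<open>The integrand with the full weight \<Phi> split off, since the root of \<Phi>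
    equals \<Phi> divided by its root; with that weight the integral becomes one over the
    push-forward.\<close>
  let ?h = "\<lambda>y. \<phi> (g y) * cnj (\<psi> y) / ?s y"
  have h [measurable]: "?h \<in> borel_measurable MR" by measurable
  have "(\<integral>x. E \<phi> x * cnj (\<psi> x) \<partial>M) = (\<integral>y. ?s y * \<phi> (g y) * cnj (\<psi> y) \<partial>MR)"
    by (subst integral_restrict_space)
      (auto intro!: Bochner_Integration.integral_cong simp: E_def split: split_indicator)
  also have "\<dots> = (\<integral>y. \<Phi> y *\<^sub>R ?h y \<partial>MR)"
  proof (rule integral_cong_AE)
    show "AE y in MR. ?s y * \<phi> (g y) * cnj (\<psi> y) = \<Phi> y *\<^sub>R ?h y"
      using \<Phi>_pos
    proof eventually_elim
      case (elim y)
      have "complex_of_real (\<Phi> y) = ?s y * ?s y" using elim by (simp flip: of_real_mult)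
      then show ?case using elim by (simp add: scaleR_conv_of_real)
    qed
  qed measurable
  also have "\<dots> = (\<integral>y. ?h y \<partial>distr MD MR f)"
    unfolding density_\<Phi>[symmetric]
    by (rule integral_density[symmetric]) (auto simp: \<Phi>_nonneg h)
  also have "\<dots> = (\<integral>x. ?h (f x) \<partial>MD)" by (rule integral_distr) measurable
  also have "\<dots> = (\<integral>x. \<phi> x * cnj (\<psi> (f x) / ?s (f x)) \<partial>MD)"
  proof (rule integral_cong_AE)
    show "(\<lambda>x. ?h (f x)) \<in> borel_measurable MD" by (rule measurable_f_comp[OF h])
    note [measurable] = measurable_f_comp[OF measurable_restrict_space1[OF \<psi>]]
    show "(\<lambda>x. \<phi> x * cnj (\<psi> (f x) / ?s (f x))) \<in> borel_measurable MD" by measurable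
    show "AE x in MD. ?h (f x) = \<phi> x * cnj (\<psi> (f x) / ?s (f x))"
      using g_f by eventually_elim simp
  qed
  also have "\<dots> = (\<integral>x. \<phi> x * cnj (F \<psi> x) \<partial>M)"
    by (subst integral_restrict_space)
      (auto intro!: Bochner_Integration.integral_cong simp: F_def split: split_indicator)
  finally show ?thesis .
qed

lemma E_cong: "AE x in M. \<phi> x = \<psi> x \<Longrightarrow> AE x in M. E \<phi> x = E \<psi> x"
proof -
  assume "AE x in M. \<phi> x = \<psi> x"
  then have "AE x in MD. \<phi> x = \<psi> x" unfolding AE_MD by eventually_elim simp
  from AE_pull_g[OF this] show ?thesis unfolding AE_MR by eventually_elim (simp add: E_def)
qed

lemma F_E: "AE x in M. F (E \<phi>) x = indicator D x * \<phi> x"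
  using \<Phi>_pos_f g_f unfolding AE_MD by eventually_elim (auto simp: E_def F_def f_in)

lemma E_F: "AE x in M. E (F \<psi>) x = indicator R x * \<psi> x"
  using \<Phi>_pos f_g unfolding AE_MR by eventually_elim (auto simp: E_def F_def g_in)

end

section \<open>Free *-algebras\<close>

definition sp_mono :: "('g \<times> bool) list \<Rightarrow> 'g star_poly" where
  "sp_mono u = (\<lambda>w. if w = u then 1 else 0)"

definition word_star :: "('g \<times> bool) list \<Rightarrow> ('g \<times> bool) list" where
  "word_star w = rev (map (\<lambda>(g, b). (g, \<not> b)) w)"

lemma word_star_simps [simp]:
  "word_star [] = []" "word_star (w @ u) = word_star u @ word_star w"
  "word_star (l # w) = word_star w @ [(fst l, \<not> snd l)]"
  by (auto simp: word_star_def split: prod.splits)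

lemma word_star_word_star [simp]: "word_star (word_star w) = w"
  by (induction w) auto

lemma word_star_Nil_iff [simp]: "word_star w = [] \<longleftrightarrow> w = []"
  by (simp add: word_star_def)

lemma length_word_star [simp]: "length (word_star w) = length w"
  by (simp add: word_star_def)

lemma fst_set_word_star [simp]: "fst ` set (word_star w) = fst ` set w"
  by (auto simp: word_star_def image_iff split: prod.splits) (metis fst_conv)+

lemma sp_star_apply: "sp_star x w = cnj (x (word_star w))"
  by (simp add: sp_star_def word_star_def)

lemma sp_var_eq_mono: "sp_var g = sp_mono [(g, False)]"
  by (simp add: sp_var_def sp_mono_def)

lemma sp_star_mono: "sp_star (sp_mono u) = sp_mono (word_star u)"
  by (auto simp: fun_eq_iff sp_star_apply sp_mono_def)

lemma sp_star_add [simp]: "sp_star (x + y) = sp_star x + sp_star y"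
  and sp_star_scale [simp]: "sp_star (\<lambda>w. c * x w) = (\<lambda>w. cnj c * sp_star x w)"
  and sp_star_star [simp]: "sp_star (sp_star x) = x"
  by (auto simp: fun_eq_iff sp_star_apply)

lemma sp_star_diff [simp]: "sp_star (x - y) = sp_star x - sp_star y"
  by (auto simp: fun_eq_iff sp_star_apply)

lemma sp_mult_add_left: "(x + y) \<odot> z = x \<odot> z + y \<odot> z"
  and sp_mult_add_right: "z \<odot> (x + y) = z \<odot> x + z \<odot> y"
  and sp_mult_diff_left: "(x - y) \<odot> z = x \<odot> z - y \<odot> z"
  and sp_mult_diff_right: "z \<odot> (x - y) = z \<odot> x - z \<odot> y"
  and sp_mult_scale_left: "(\<lambda>w. c * x w) \<odot> z = (\<lambda>w. c * (x \<odot> z) w)"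
  and sp_mult_scale_right: "z \<odot> (\<lambda>w. c * x w) = (\<lambda>w. c * (z \<odot> x) w)"
  by (auto simp: fun_eq_iff sp_mult_def algebra_simps sum.distrib sum_subtractf sum_distrib_left)

lemma sp_mult_zero [simp]: "0 \<odot> z = 0" "z \<odot> 0 = 0"
  by (auto simp: fun_eq_iff sp_mult_def)

lemma sp_star_zero [simp]: "sp_star 0 = 0"
  by (auto simp: fun_eq_iff sp_star_apply)

text \<open>Among all ways to cut \<open>w\<close> in two, only the cut at \<open>length u\<close>
  can contribute, and only for \<open>w = u @ v\<close>.\<close>

lemma sp_mult_mono: "sp_mono u \<odot> sp_mono v = sp_mono (u @ v)"
proof
  fix w
  show "(sp_mono u \<odot> sp_mono v) w = sp_mono (u @ v) w"
  proof (cases "w = u @ v")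
    case True
    have "(sp_mono u \<odot> sp_mono v) w
        = (\<Sum>i\<le>length w. if i = length u then 1 else 0)"
      unfolding sp_mult_def
    proof (rule sum.cong)
      fix i assume "i \<in> {..length w}"
      then have "take i w = u \<and> drop i w = v \<longleftrightarrow> i = length u"
        using True by (metis append_eq_conv_conj atMost_iff length_take min.absorb2)
      then show "sp_mono u (take i w) * sp_mono v (drop i w) = (if i = length u then 1 else 0)"
        by (auto simp: sp_mono_def)
    qed simp
    then show ?thesis by (simp add: True sp_mono_def)
  next
    case False
    then have "\<not> (take i w = u \<and> drop i w = v)" for i by (metis append_take_drop_id)
    then show ?thesis using False by (auto simp: sp_mult_def sp_mono_def intro!: sum.neutral)
  qed
qed

text \<open>Reversing a word turns its cut at \<open>i\<close> into the cut at
  \<open>length w - i\<close> and exchanges the two pieces, so the two sums differ by a reflection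
  of the index.\<close>

lemma sp_star_mult: "sp_star (x \<odot> y) = sp_star y \<odot> sp_star x"
proof
  fix w :: "('a \<times> bool) list"
  have ws: "take i (word_star w) = word_star (drop (length w - i) w)"
    "drop i (word_star w) = word_star (take (length w - i) w)" for i
    by (simp_all add: word_star_def take_map drop_map rev_take rev_drop take_rev drop_rev)
  have "sp_star (x \<odot> y) w
      = (\<Sum>i\<le>length w. cnj (x (word_star (drop (length w - i) w)))
          * cnj (y (word_star (take (length w - i) w))))"
    by (simp add: sp_star_apply sp_mult_def ws)
  also have "\<dots> = (\<Sum>i\<le>length w. cnj (x (word_star (drop i w))) * cnj (y (word_star (take i w))))"
    by (rule sum.reindex_bij_witness[of _ "\<lambda>i. length w - i" "\<lambda>i. length w - i"]) auto
  also have "\<dots> = (sp_star y \<odot> sp_star x) w"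
    by (simp add: sp_mult_def sp_star_apply mult.commute)
  finally show "sp_star (x \<odot> y) w = (sp_star y \<odot> sp_star x) w" .
qed

abbreviation sp_carr :: "'g set \<Rightarrow> 'g star_poly set" where
  "sp_carr X \<equiv> carr (free_star_algebra X)"

lemma free_star_algebra_simps [simp]:
  "add (free_star_algebra X) = (\<lambda>x y. x + y)"
  "scale (free_star_algebra X) = (\<lambda>c x w. c * x w)"
  "mult (free_star_algebra X) = sp_mult"
  "star (free_star_algebra X) = sp_star"
  by (simp_all add: free_star_algebra_def)

lemma sp_carr_iff:
  "x \<in> sp_carr X \<longleftrightarrow> finite {w. x w \<noteq> 0} \<and> (\<forall>w. x w \<noteq> 0 \<longrightarrow> w \<noteq> [] \<and> fst ` set w \<subseteq> X)"
  by (simp add: free_star_algebra_def)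

lemma sp_carr_zero [simp, intro]: "0 \<in> sp_carr X"
  by (simp add: sp_carr_iff)

lemma sp_carr_mono [intro]: "w \<noteq> [] \<Longrightarrow> fst ` set w \<subseteq> X \<Longrightarrow> sp_mono w \<in> sp_carr X"
  by (auto simp: sp_carr_iff sp_mono_def)

lemma sp_carr_var [simp, intro]: "g \<in> X \<Longrightarrow> sp_var g \<in> sp_carr X"
  by (auto simp: sp_var_eq_mono)

lemma sp_carr_add [simp, intro]:
  assumes "x \<in> sp_carr X" "y \<in> sp_carr X"
  shows "x + y \<in> sp_carr X"
proof -
  have "{w. (x + y) w \<noteq> 0} \<subseteq> {w. x w \<noteq> 0} \<union> {w. y w \<noteq> 0}" by auto
  then show ?thesis using assms unfolding sp_carr_iff by (blast intro: finite_subset)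
qed

lemma sp_carr_scale [simp, intro]: "x \<in> sp_carr X \<Longrightarrow> (\<lambda>w. c * x w) \<in> sp_carr X"
  unfolding sp_carr_iff by (cases "c = 0") auto

text \<open>The algebra record has no subtraction; in this form the laws of homomorphisms and the
  definition of \<open>sn_dist\<close> apply to differences.\<close>

lemma sp_diff_eq: "x - y = x + (\<lambda>w. - 1 * y w)" for x y :: "'g star_poly"
  by (auto simp: fun_eq_iff)

lemma sp_carr_diff [simp, intro]: "x \<in> sp_carr X \<Longrightarrow> y \<in> sp_carr X \<Longrightarrow> x - y \<in> sp_carr X"
  unfolding sp_diff_eq by (intro sp_carr_add sp_carr_scale)

lemma sp_carr_star [simp, intro]:
  assumes "x \<in> sp_carr X"
  shows "sp_star x \<in> sp_carr X"
proof -
  have "{w. sp_star x w \<noteq> 0} = word_star ` {w. x w \<noteq> 0}"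
    by (auto simp: sp_star_apply image_iff) (metis word_star_word_star)
  moreover have "w \<noteq> [] \<and> fst ` set w \<subseteq> X" if "sp_star x w \<noteq> 0" for w
    using that assms unfolding sp_carr_iff sp_star_apply complex_cnj_zero_iff
    by (metis word_star_Nil_iff fst_set_word_star)
  ultimately show ?thesis using assms unfolding sp_carr_iff by (metis finite_imageI)
qed

lemma sp_carr_mult [simp, intro]:
  assumes "x \<in> sp_carr X" "y \<in> sp_carr X"
  shows "x \<odot> y \<in> sp_carr X"
proof -
  have *: "\<exists>u v. w = u @ v \<and> x u \<noteq> 0 \<and> y v \<noteq> 0" if "(x \<odot> y) w \<noteq> 0" for w
  proof -
    obtain i where "x (take i w) * y (drop i w) \<noteq> 0"
      using \<open>(x \<odot> y) w \<noteq> 0\<close> unfolding sp_mult_def by (meson sum.neutral)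
    then show ?thesis
      by (intro exI[of _ "take i w"] exI[of _ "drop i w"]) auto
  qed
  have "{w. (x \<odot> y) w \<noteq> 0} \<subseteq> (\<lambda>(u, v). u @ v) ` ({w. x w \<noteq> 0} \<times> {w. y w \<noteq> 0})"
    using * by fastforce
  then have "finite {w. (x \<odot> y) w \<noteq> 0}"
    by (rule finite_subset) (use assms in \<open>auto simp: sp_carr_iff\<close>)
  moreover have "w \<noteq> [] \<and> fst ` set w \<subseteq> X" if w: "(x \<odot> y) w \<noteq> 0" for w
  proof -
    obtain u v where "w = u @ v" "x u \<noteq> 0" "y v \<noteq> 0" using *[OF w] by blast
    moreover have "u \<noteq> []" "fst ` set u \<subseteq> X" "fst ` set v \<subseteq> X"
      using assms calculation unfolding sp_carr_iff by blast+
    ultimately show ?thesis by (simp add: image_Un)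
  qed
  ultimately show ?thesis unfolding sp_carr_iff by blast
qed

lemma sp_carr_sum [intro]: "(\<And>i. i \<in> I \<Longrightarrow> x i \<in> sp_carr X) \<Longrightarrow> sum x I \<in> sp_carr X"
  by (induction I rule: infinite_finite_induct) auto

text \<open>Monomials are split off one at a time, by induction on a finite set containing the
  support. The premise \<open>x u = 0\<close> says that the word is new, which is needed when sums
  of coefficients are compared.\<close>

lemma sp_carr_induct [consumes 1, case_names zero add]:
  assumes "x \<in> sp_carr X"
    and zero: "P 0"
    and add: "\<And>x c u. x \<in> sp_carr X \<Longrightarrow> P x \<Longrightarrow> u \<noteq> [] \<Longrightarrow> fst ` set u \<subseteq> X \<Longrightarrow> x u = 0 \<Longrightarrow>
      P (x + (\<lambda>w. c * sp_mono u w))"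
  shows "P x"
proof -
  have "P x" if "finite S" "x \<in> sp_carr X" "{w. x w \<noteq> 0} \<subseteq> S" for S x
    using that
  proof (induction S arbitrary: x rule: finite_induct)
    case empty
    then have "x = 0" by (auto simp: fun_eq_iff)
    then show ?case using zero by metis
  next
    case (insert u S)
    show ?case
    proof (cases "x u = 0")
      case True
      then show ?thesis using insert by (intro insert.IH) auto
    next
      case False
      then have u: "u \<noteq> []" "fst ` set u \<subseteq> X" using insert.prems unfolding sp_carr_iff by auto
      define y where "y = x - (\<lambda>w. x u * sp_mono u w)"
      have y: "y \<in> sp_carr X" unfolding y_def using insert.prems u by auto
      have "P y"
        by (rule insert.IH[OF y]) (use insert.prems in \<open>auto simp: y_def sp_mono_def split: if_splits\<close>)
      then have "P (y + (\<lambda>w. x u * sp_mono u w))"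
        by (rule add[OF y _ u]) (simp add: y_def sp_mono_def)
      then show ?thesis by (simp only: y_def diff_add_cancel)
    qed
  qed
  from this[of "{w. x w \<noteq> 0}" x] show ?thesis using assms(1) by (simp add: sp_carr_iff)
qed

section \<open>*-homomorphisms\<close>

lemma star_homsD:
  assumes "h \<in> star_homs A B"
  shows "x \<in> carr A \<Longrightarrow> h x \<in> carr B"
    and "x \<in> carr A \<Longrightarrow> y \<in> carr A \<Longrightarrow> h (add A x y) = add B (h x) (h y)"
    and "x \<in> carr A \<Longrightarrow> h (scale A c x) = scale B c (h x)"
    and "x \<in> carr A \<Longrightarrow> y \<in> carr A \<Longrightarrow> h (mult A x y) = mult B (h x) (h y)"
    and "x \<in> carr A \<Longrightarrow> h (star A x) = star B (h x)"
    and "h \<in> extensional (carr A)"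
  using assms unfolding star_homs_def PiE_def by blast+

lemma star_homs_compose:
  assumes h: "h \<in> star_homs A B" and k: "k \<in> star_homs B C"
    and closed: "\<And>x y. x \<in> carr A \<Longrightarrow> y \<in> carr A \<Longrightarrow> add A x y \<in> carr A"
      "\<And>c x. x \<in> carr A \<Longrightarrow> scale A c x \<in> carr A"
      "\<And>x y. x \<in> carr A \<Longrightarrow> y \<in> carr A \<Longrightarrow> mult A x y \<in> carr A"
      "\<And>x. x \<in> carr A \<Longrightarrow> star A x \<in> carr A"
  shows "compose (carr A) k h \<in> star_homs A C"
  unfolding star_homs_def
  by (auto simp: compose_def closed star_homsD(1-5)[OF h] star_homsD(1-5)[OF k])

lemma cstar_seminorm_compose:
  assumes h: "h \<in> star_homs A B" and q: "cstar_seminorm B q"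
    and closed: "\<And>x. x \<in> carr A \<Longrightarrow> star A x \<in> carr A"
  shows "cstar_seminorm A (\<lambda>x. q (h x))"
  using q unfolding cstar_seminorm_def
  by (simp add: star_homsD(1-5)[OF h] closed)

lemma star_homs_free_eqI:
  assumes h: "h \<in> star_homs (free_star_algebra X) B" and k: "k \<in> star_homs (free_star_algebra X) B"
    and "X \<noteq> {}" and gen: "\<And>g. g \<in> X \<Longrightarrow> h (sp_var g) = k (sp_var g)"
  shows "h = k"
proof (rule extensionalityI[OF star_homsD(6)[OF h] star_homsD(6)[OF k]])
  note hs = star_homsD(2-5)[OF h, simplified] and ks = star_homsD(2-5)[OF k, simplified]
  have letter: "h (sp_mono [l]) = k (sp_mono [l])" if "fst l \<in> X" for l
  proof (cases l)
    case (Pair g b)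
    then have g: "g \<in> X" using that by simp
    show ?thesis
    proof (cases b)
      case True
      then have "sp_mono [l] = sp_star (sp_var g)"
        by (simp add: Pair sp_var_eq_mono sp_star_mono)
      then show ?thesis using g by (simp add: hs ks gen)
    next
      case False
      then show ?thesis using gen[OF g] by (simp add: Pair sp_var_eq_mono)
    qed
  qed
  have mono: "h (sp_mono w) = k (sp_mono w)" if "w \<noteq> []" "fst ` set w \<subseteq> X" for w
    using that
  proof (induction w rule: list_nonempty_induct)
    case (single l)
    then show ?case using letter by simp
  next
    case (cons l w)
    then have "sp_mono [l] \<in> sp_carr X" "sp_mono w \<in> sp_carr X" by (auto intro: sp_carr_mono)
    moreover have "sp_mono (l # w) = sp_mono [l] \<odot> sp_mono w" by (simp add: sp_mult_mono)
    ultimately show ?case using cons letter by (simp add: hs ks)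
  qed
  obtain g where g: "g \<in> X" using \<open>X \<noteq> {}\<close> by blast
  \<comment> \<open>Homomorphisms come with no law for zero, so zero is written as a multiple of a
    generator; this is where \<open>X \<noteq> {}\<close> enters.\<close>
  have zero: "(0 :: 'a star_poly) = (\<lambda>w. 0 * sp_var g w)" by (auto simp: fun_eq_iff)
  show "h x = k x" if "x \<in> sp_carr X" for x
    using that
  proof (induction rule: sp_carr_induct)
    case zero
    show ?case unfolding \<open>0 = (\<lambda>w. 0 * sp_var g w)\<close>
      using hs(2)[of "sp_var g" 0] ks(2)[of "sp_var g" 0] gen[OF g] g by simp
  next
    case (add x c u)
    show ?case
      using mono[of u] add.hyps add.IH by (simp only: hs ks sp_carr_mono sp_carr_scale simp_thms)
  qed
qed

section \<open>Evaluation of *-polynomials at bounded operators\<close>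

context hilbert_space
begin

definition letter_op :: "('g \<Rightarrow> 'h \<Rightarrow> 'h) \<Rightarrow> 'g \<times> bool \<Rightarrow> 'h \<Rightarrow> 'h" where
  "letter_op T l = (if snd l then adjoint_op H (T (fst l)) else T (fst l))"

definition word_op :: "('g \<Rightarrow> 'h \<Rightarrow> 'h) \<Rightarrow> ('g \<times> bool) list \<Rightarrow> 'h \<Rightarrow> 'h" where
  "word_op T w = foldr (letter_op T) w"

text \<open>The value of a polynomial is first given as a form, because the finite sum over words is
  then a sum of complex numbers; \<open>sp_op\<close> recovers the operator.\<close>

definition sp_form :: "('g \<Rightarrow> 'h \<Rightarrow> 'h) \<Rightarrow> 'g star_poly \<Rightarrow> 'h \<Rightarrow> 'h \<Rightarrow> complex" where
  "sp_form T p x y = (\<Sum>w | p w \<noteq> 0. p w * hinner H (word_op T w x) y)"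

definition sp_op :: "('g \<Rightarrow> 'h \<Rightarrow> 'h) \<Rightarrow> 'g star_poly \<Rightarrow> 'h \<Rightarrow> 'h" where
  "sp_op T p = (SOME S. S \<in> \<B> \<and> (\<forall>x\<in>hcarr H. \<forall>y\<in>hcarr H. hinner H (S x) y = sp_form T p x y))"

lemma word_op_append: "word_op T (u @ v) x = word_op T u (word_op T v x)"
  by (simp add: word_op_def)

lemma word_op_Cons: "word_op T (l # w) x = letter_op T l (word_op T w x)"
  by (simp add: word_op_def)

lemma letter_op_closed: "\<forall>g\<in>X. T g \<in> \<B> \<Longrightarrow> fst l \<in> X \<Longrightarrow> letter_op T l \<in> \<B>"
  by (simp add: letter_op_def)

text \<open>The empty word acts as the identity function, which is in general not extensional on
  \<open>hcarr H\<close>, so \<open>word_op T w\<close> need not lie in \<open>\<B>\<close>. The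
  properties of a bounded operator are therefore recorded one by one.\<close>

lemma word_op_linear:
  assumes T: "\<forall>g\<in>X. T g \<in> \<B>" and "fst ` set w \<subseteq> X"
  shows "x \<in> hcarr H \<Longrightarrow> word_op T w x \<in> hcarr H"
    and "x \<in> hcarr H \<Longrightarrow> y \<in> hcarr H \<Longrightarrow>
      word_op T w (hadd H x y) = hadd H (word_op T w x) (word_op T w y)"
    and "x \<in> hcarr H \<Longrightarrow> word_op T w (hscale H c x) = hscale H c (word_op T w x)"
    and "\<exists>C\<ge>0. \<forall>x\<in>hcarr H. hnorm H (word_op T w x) \<le> C * hnorm H x"
proof -
  have "(\<forall>x\<in>hcarr H. word_op T w x \<in> hcarr H) \<and>
    (\<forall>x\<in>hcarr H. \<forall>y\<in>hcarr H. word_op T w (hadd H x y) = hadd H (word_op T w x) (word_op T w y)) \<and>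
    (\<forall>c. \<forall>x\<in>hcarr H. word_op T w (hscale H c x) = hscale H c (word_op T w x)) \<and>
    (\<exists>C\<ge>0. \<forall>x\<in>hcarr H. hnorm H (word_op T w x) \<le> C * hnorm H x)"
    using assms(2)
  proof (induction w)
    case Nil
    have "\<exists>C\<ge>0. \<forall>x\<in>hcarr H. hnorm H x \<le> C * hnorm H x" by (rule exI[of _ 1]) simp
    then show ?case by (simp add: word_op_def)
  next
    case (Cons l w)
    then have l: "letter_op T l \<in> \<B>" by (intro letter_op_closed[OF T]) auto
    from Cons obtain C where C: "0 \<le> C" "\<And>x. x \<in> hcarr H \<Longrightarrow> hnorm H (word_op T w x) \<le> C * hnorm H x"
      by auto
    have "hnorm H (word_op T (l # w) x) \<le> (opnorm (letter_op T l) * C) * hnorm H x"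
      if x: "x \<in> hcarr H" for x
    proof -
      have "word_op T w x \<in> hcarr H" using Cons x by simp
      then have "hnorm H (word_op T (l # w) x) \<le> opnorm (letter_op T l) * hnorm H (word_op T w x)"
        unfolding word_op_Cons by (intro opnorm l)
      also have "\<dots> \<le> opnorm (letter_op T l) * (C * hnorm H x)"
        by (intro mult_left_mono C x opnorm_nonneg l)
      finally show ?thesis by (simp add: mult.assoc)
    qed
    then have "\<exists>C\<ge>0. \<forall>x\<in>hcarr H. hnorm H (word_op T (l # w) x) \<le> C * hnorm H x"
      using C(1) opnorm_nonneg[OF l] by (intro exI[of _ "opnorm (letter_op T l) * C"]) simp
    then show ?case using Cons l by (simp add: word_op_Cons op_add op_scale)
  qed
  then show "x \<in> hcarr H \<Longrightarrow> word_op T w x \<in> hcarr H"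
    and "x \<in> hcarr H \<Longrightarrow> y \<in> hcarr H \<Longrightarrow>
      word_op T w (hadd H x y) = hadd H (word_op T w x) (word_op T w y)"
    and "x \<in> hcarr H \<Longrightarrow> word_op T w (hscale H c x) = hscale H c (word_op T w x)"
    and "\<exists>C\<ge>0. \<forall>x\<in>hcarr H. hnorm H (word_op T w x) \<le> C * hnorm H x"
    by blast+
qed

text \<open>The letters cross to the other argument one after the other, each as its adjoint, and so
  arrive in reversed order.\<close>

lemma inner_word_op:
  assumes T: "\<forall>g\<in>X. T g \<in> \<B>" and "fst ` set w \<subseteq> X" "x \<in> hcarr H" "y \<in> hcarr H"
  shows "hinner H (word_op T w x) y = hinner H x (word_op T (word_star w) y)"
  using assms(2-4)
proof (induction w arbitrary: y)
  case Nil
  then show ?case by (simp add: word_op_def)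
next
  case (Cons l w)
  have l: "fst l \<in> X" using Cons by simp
  have wx: "word_op T w x \<in> hcarr H" using Cons by (intro word_op_linear(1)[OF T]) auto
  let ?l' = "(fst l, \<not> snd l)"
  have l': "letter_op T ?l' \<in> \<B>" using l by (intro letter_op_closed[OF T]) auto
  have "hinner H (word_op T (l # w) x) y = hinner H (word_op T w x) (letter_op T ?l' y)"
    using T[rule_format, OF l] wx Cons.prems
    by (simp add: word_op_Cons letter_op_def inner_adjoint inner_adjoint_left)
  also have "\<dots> = hinner H x (word_op T (word_star w) (letter_op T ?l' y))"
    using Cons l' by (intro Cons.IH) auto
  also have "word_op T (word_star w) (letter_op T ?l' y) = word_op T (word_star (l # w)) y"
    by (simp add: word_op_append) (simp add: word_op_def)
  finally show ?case .
qed

lemma sp_form_superset: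
  assumes "finite S" "{w. p w \<noteq> 0} \<subseteq> S"
  shows "sp_form T p x y = (\<Sum>w\<in>S. p w * hinner H (word_op T w x) y)"
  unfolding sp_form_def by (rule sum.mono_neutral_left) (use assms in auto)

lemma sp_form_zero [simp]: "sp_form T 0 x y = 0"
  by (simp add: sp_form_def)

lemma sp_form_add:
  assumes "p \<in> sp_carr X" "q \<in> sp_carr X"
  shows "sp_form T (p + q) x y = sp_form T p x y + sp_form T q x y"
proof -
  let ?S = "{w. p w \<noteq> 0} \<union> {w. q w \<noteq> 0}"
  have S: "finite ?S" using assms by (simp add: sp_carr_iff)
  show ?thesis
    by (subst (1 2 3) sp_form_superset[OF S]) (auto simp: distrib_right sum.distrib)
qed

lemma sp_form_scale:
  assumes "p \<in> sp_carr X"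
  shows "sp_form T (\<lambda>w. c * p w) x y = c * sp_form T p x y"
proof -
  have S: "finite {w. p w \<noteq> 0}" using assms by (simp add: sp_carr_iff)
  show ?thesis
    by (subst (1 2) sp_form_superset[OF S]) (auto simp: sum_distrib_left mult.assoc)
qed

lemma sp_form_mono: "sp_form T (sp_mono w) x y = hinner H (word_op T w x) y"
  by (subst sp_form_superset[of "{w}"]) (auto simp: sp_mono_def)

lemma sp_op:
  assumes T: "\<forall>g\<in>X. T g \<in> \<B>" and p: "p \<in> sp_carr X"
  shows "sp_op T p \<in> \<B>"
    and "x \<in> hcarr H \<Longrightarrow> y \<in> hcarr H \<Longrightarrow> hinner H (sp_op T p x) y = sp_form T p x y"
proof -
  let ?S = "{w. p w \<noteq> 0}"
  have S: "finite ?S" "\<And>w. w \<in> ?S \<Longrightarrow> fst ` set w \<subseteq> X" using p by (auto simp: sp_carr_iff)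
  have "\<forall>w\<in>?S. \<exists>C\<ge>0. \<forall>x\<in>hcarr H. hnorm H (word_op T w x) \<le> C * hnorm H x"
    using word_op_linear(4)[OF T] S(2) by blast
  then obtain C where C: "\<And>w. w \<in> ?S \<Longrightarrow> 0 \<le> C w"
    "\<And>w x. w \<in> ?S \<Longrightarrow> x \<in> hcarr H \<Longrightarrow> hnorm H (word_op T w x) \<le> C w * hnorm H x" by metis
  have "\<exists>U\<in>\<B>. \<forall>x\<in>hcarr H. \<forall>y\<in>hcarr H. hinner H (U x) y = sp_form T p x y"
  proof (rule sesquilinear_operator[where C = "\<Sum>w\<in>?S. cmod (p w) * C w"])
    note W = word_op_linear(1-3)[OF T S(2)]
    fix x y assume x: "x \<in> hcarr H" and y: "y \<in> hcarr H"
    show "sp_form T p (hscale H c x) y = c * sp_form T p x y" for c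
      using x y by (auto simp: sp_form_def W sum_distrib_left intro!: sum.cong)
    show "sp_form T p x (hscale H c y) = cnj c * sp_form T p x y" for c
      using x y by (auto simp: sp_form_def W sum_distrib_left intro!: sum.cong)
    show "cmod (sp_form T p x y) \<le> (\<Sum>w\<in>?S. cmod (p w) * C w) * hnorm H x * hnorm H y"
      unfolding sp_form_def sum_distrib_right
    proof (rule sum_norm_le)
      fix w assume w: "w \<in> ?S"
      have "cmod (hinner H (word_op T w x) y) \<le> hnorm H (word_op T w x) * hnorm H y"
        using W[OF w] x y by (intro Cauchy_Schwarz) auto
      also have "\<dots> \<le> (C w * hnorm H x) * hnorm H y"
        by (intro mult_right_mono C w x hnorm_nonneg y)
      finally have "cmod (p w) * cmod (hinner H (word_op T w x) y)
          \<le> cmod (p w) * ((C w * hnorm H x) * hnorm H y)" by (rule mult_left_mono) simp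
      then show "cmod (p w * hinner H (word_op T w x) y) \<le> cmod (p w) * C w * hnorm H x * hnorm H y"
        by (simp add: norm_mult mult.assoc)
    qed
    fix z assume z: "z \<in> hcarr H"
    show "sp_form T p (hadd H x y) z = sp_form T p x z + sp_form T p y z"
      using x y z by (auto simp: sp_form_def W sum.distrib[symmetric] algebra_simps intro!: sum.cong)
    show "sp_form T p z (hadd H x y) = sp_form T p z x + sp_form T p z y"
      using x y z by (auto simp: sp_form_def W sum.distrib[symmetric] algebra_simps intro!: sum.cong)
  qed
  then have "\<exists>U. U \<in> \<B> \<and> (\<forall>x\<in>hcarr H. \<forall>y\<in>hcarr H. hinner H (U x) y = sp_form T p x y)" by blast
  then have "sp_op T p \<in> \<B> \<and>
      (\<forall>x\<in>hcarr H. \<forall>y\<in>hcarr H. hinner H (sp_op T p x) y = sp_form T p x y)"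
    unfolding sp_op_def by (rule someI_ex)
  then show "sp_op T p \<in> \<B>"
    and "x \<in> hcarr H \<Longrightarrow> y \<in> hcarr H \<Longrightarrow> hinner H (sp_op T p x) y = sp_form T p x y" by blast+
qed

lemma sp_form_star:
  assumes T: "\<forall>g\<in>X. T g \<in> \<B>" and p: "p \<in> sp_carr X"
    and x: "x \<in> hcarr H" and y: "y \<in> hcarr H"
  shows "sp_form T (sp_star p) x y = cnj (sp_form T p y x)"
  using p
proof (induction rule: sp_carr_induct)
  case (add p c u)
  have u: "sp_mono u \<in> sp_carr X" "sp_mono (word_star u) \<in> sp_carr X"
    using add by (intro sp_carr_mono; simp)+
  have "hinner H (word_op T (word_star u) x) y = cnj (hinner H y (word_op T (word_star u) x))"
    using add x y by (intro inner_commute word_op_linear(1)[OF T]) auto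
  also have "hinner H y (word_op T (word_star u) x) = hinner H (word_op T u y) x"
    using add x y by (intro inner_word_op[OF T, symmetric]) auto
  finally show ?case
    using add.hyps add.IH u
    by (simp only: sp_star_add sp_star_scale sp_form_add[of _ X] sp_form_scale[of _ X] sp_star_mono
        sp_form_mono sp_carr_scale sp_carr_star complex_cnj_add complex_cnj_mult complex_cnj_cnj)
qed (simp only: sp_star_zero sp_form_zero complex_cnj_zero)

text \<open>Both sides are linear in \<open>p\<close> and in \<open>q\<close>, so two nested
  inductions reduce the claim to words, where evaluation turns concatenation into
  composition.\<close>

lemma sp_form_mult:
  assumes T: "\<forall>g\<in>X. T g \<in> \<B>" and p: "p \<in> sp_carr X" and q: "q \<in> sp_carr X"
    and x: "x \<in> hcarr H" and y: "y \<in> hcarr H"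
  shows "sp_form T (p \<odot> q) x y = sp_form T p (sp_op T q x) y"
  using p
proof (induction rule: sp_carr_induct)
  case (add p c u)
  have u: "sp_mono u \<in> sp_carr X" using add by auto
  have "sp_form T (sp_mono u \<odot> q) x y = hinner H (word_op T u (sp_op T q x)) y"
  proof -
    have y': "word_op T (word_star u) y \<in> hcarr H"
      using add y by (intro word_op_linear(1)[OF T]) auto
    \<comment> \<open>With \<open>u\<close> moved to the second argument, only \<open>q\<close> is
      evaluated on the right, so the inner induction has linear expressions in \<open>q\<close> on
      both sides.\<close>
    have "sp_form T (sp_mono u \<odot> q) x y = sp_form T q x (word_op T (word_star u) y)"
      using q
    proof (induction rule: sp_carr_induct)
      case (add q d v)
      have v: "sp_mono v \<in> sp_carr X" "sp_mono (u @ v) \<in> sp_carr X" "word_op T v x \<in> hcarr H"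
        using add \<open>u \<noteq> []\<close> \<open>fst ` set u \<subseteq> X\<close> x word_op_linear(1)[OF T, of v x]
        by (simp_all add: sp_carr_mono image_Un)
      have "hinner H (word_op T u (word_op T v x)) y
          = hinner H (word_op T v x) (word_op T (word_star u) y)"
        using v \<open>fst ` set u \<subseteq> X\<close> y by (intro inner_word_op[OF T]) auto
      then show ?case
        using add.hyps add.IH v u
        by (simp only: sp_mult_add_right sp_mult_scale_right sp_mult_mono sp_form_add[of _ X]
            sp_form_scale[of _ X] sp_form_mono word_op_append sp_carr_scale sp_carr_mult)
    qed (simp only: sp_mult_zero sp_form_zero)
    also have "\<dots> = hinner H (sp_op T q x) (word_op T (word_star u) y)"
      using sp_op(2)[OF T q x y'] by simp
    also have "\<dots> = hinner H (word_op T u (sp_op T q x)) y"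
      using add x y sp_op(1)[OF T q] by (intro inner_word_op[OF T, symmetric]) auto
    finally show ?thesis .
  qed
  then show ?case
    using add.hyps add.IH u q
    by (simp only: sp_mult_add_left sp_mult_scale_left sp_form_add[of _ X] sp_form_scale[of _ X]
        sp_form_mono sp_carr_scale sp_carr_mult)
qed (simp only: sp_mult_zero sp_form_zero)

theorem free_star_algebra_universal:
  assumes T: "\<forall>g\<in>X. T g \<in> \<B>"
  obtains \<rho> where "\<rho> \<in> star_homs (free_star_algebra X) (bounded_ops H)"
    "\<And>g. g \<in> X \<Longrightarrow> \<rho> (sp_var g) = T g"
proof
  let ?\<rho> = "restrict (sp_op T) (sp_carr X)"
  note sp_op = sp_op[OF T]
  have add: "sp_op T (p + q) = add (bounded_ops H) (sp_op T p) (sp_op T q)"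
    if "p \<in> sp_carr X" "q \<in> sp_carr X" for p q
    by (rule op_eqI) (use that sp_op in \<open>auto simp: sp_form_add[of _ X]\<close>)
  have scale: "sp_op T (\<lambda>w. c * p w) = scale (bounded_ops H) c (sp_op T p)"
    if "p \<in> sp_carr X" for p c
    by (rule op_eqI) (use that sp_op in \<open>auto simp: sp_form_scale[of _ X]\<close>)
  have mult: "sp_op T (p \<odot> q) = compose (hcarr H) (sp_op T p) (sp_op T q)"
    if "p \<in> sp_carr X" "q \<in> sp_carr X" for p q
    by (rule op_eqI) (use that sp_op in \<open>auto simp: sp_form_mult[OF T] compose_eq\<close>)
  have star: "sp_op T (sp_star p) = adjoint_op H (sp_op T p)" if p: "p \<in> sp_carr X" for p
  proof (rule adjointI[symmetric])
    fix x y assume xy: "x \<in> hcarr H" "y \<in> hcarr H"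
    have "hinner H x (sp_op T (sp_star p) y) = cnj (hinner H (sp_op T (sp_star p) y) x)"
      using sp_op(1)[of "sp_star p"] p xy by (intro inner_commute) auto
    then show "hinner H (sp_op T p x) y = hinner H x (sp_op T (sp_star p) y)"
      using xy p by (simp add: sp_op sp_form_star[OF T])
  qed (use sp_op p in auto)
  show "?\<rho> \<in> star_homs (free_star_algebra X) (bounded_ops H)"
    unfolding star_homs_def by (auto simp: add scale mult star sp_op(1))
  show "?\<rho> (sp_var g) = T g" if g: "g \<in> X" for g
  proof -
    have "sp_op T (sp_var g) = T g"
    proof (rule op_eqI)
      show "hinner H (sp_op T (sp_var g) x) y = hinner H (T g x) y"
        if "x \<in> hcarr H" "y \<in> hcarr H" for x y
        using that g sp_op(2)[of "sp_var g" x y]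
        by (simp add: sp_var_eq_mono sp_form_mono word_op_def letter_op_def sp_carr_mono)
    qed (use g T sp_op(1) in auto)
    then show ?thesis using g by simp
  qed
qed

end

section \<open>C*-seminorms on free *-algebras and their completions\<close>

locale sp_cstar_seminorm =
  fixes X :: "'g set" and q :: "'g star_poly \<Rightarrow> real"
  assumes seminorm: "cstar_seminorm (free_star_algebra X) q"
begin

abbreviation "\<A> \<equiv> free_star_algebra X"
abbreviation "\<C> \<equiv> completion \<A> q"

lemma q_nonneg: "x \<in> sp_carr X \<Longrightarrow> 0 \<le> q x"
  and q_add: "x \<in> sp_carr X \<Longrightarrow> y \<in> sp_carr X \<Longrightarrow> q (x + y) \<le> q x + q y"
  and q_scale: "x \<in> sp_carr X \<Longrightarrow> q (\<lambda>w. c * x w) = cmod c * q x"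
  and q_mult: "x \<in> sp_carr X \<Longrightarrow> y \<in> sp_carr X \<Longrightarrow> q (x \<odot> y) \<le> q x * q y"
  and q_star_mult: "x \<in> sp_carr X \<Longrightarrow> q (sp_star x \<odot> x) = (q x)\<^sup>2"
  using seminorm by (simp_all add: cstar_seminorm_def)

lemma q_minus_commute:
  assumes "x \<in> sp_carr X" "y \<in> sp_carr X"
  shows "q (x - y) = q (y - x)"
proof -
  have "x - y = (\<lambda>w. (-1) * (y - x) w)" by (auto simp: fun_eq_iff)
  then show ?thesis using q_scale[of "y - x" "-1"] assms by simp
qed

lemma q_triangle:
  assumes "x \<in> sp_carr X" "y \<in> sp_carr X" "z \<in> sp_carr X"
  shows "q (x - z) \<le> q (x - y) + q (y - z)"
  using q_add[of "x - y" "y - z"] assms by (simp only: sp_carr_diff add_diff_eq diff_add_cancel)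

lemma q_diff_le:
  assumes "x \<in> sp_carr X" "y \<in> sp_carr X"
  shows "q x \<le> q y + q (x - y)"
  using q_add[of y "x - y"] assms by (simp only: sp_carr_diff add_diff_eq add_diff_cancel_left')

lemma q_zero: "q 0 = 0"
proof -
  have "(0 :: 'g star_poly) = (\<lambda>w. 0 * (0 :: 'g star_poly) w)" by (auto simp: fun_eq_iff)
  then have "q 0 = q (\<lambda>w. 0 * (0 :: 'g star_poly) w)" by (rule arg_cong)
  also have "\<dots> = 0" by (subst q_scale) auto
  finally show ?thesis .
qed

text \<open>That the involution is isometric is not among the axioms of a C*-seminorm. The
  C*-identity and submultiplicativity give \<open>q y * q y <= q (sp_star y) * q y\<close>; cancel,
  then apply the result to the adjoint as well.\<close>

lemma q_star:
  assumes x: "x \<in> sp_carr X"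
  shows "q (sp_star x) = q x"
proof -
  have le: "q y \<le> q (sp_star y)" if y: "y \<in> sp_carr X" for y
  proof (cases "q y = 0")
    case True
    then show ?thesis using q_nonneg[of "sp_star y"] y by (simp only: sp_carr_star)
  next
    case False
    then have "0 < q y" using q_nonneg[OF y] by simp
    moreover have "q y * q y \<le> q (sp_star y) * q y"
      using q_star_mult[OF y] q_mult[OF sp_carr_star[OF y] y] by (simp add: power2_eq_square)
    ultimately show ?thesis by simp
  qed
  show ?thesis using le[OF x] le[OF sp_carr_star[OF x]] by simp
qed

lemma q_mult_diff:
  assumes "x \<in> sp_carr X" "y \<in> sp_carr X" "x' \<in> sp_carr X" "y' \<in> sp_carr X"
  shows "q (x \<odot> y - x' \<odot> y') \<le> q (x - x') * q y + q x' * q (y - y')"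
proof -
  have "x \<odot> y - x' \<odot> y' = (x - x') \<odot> y + x' \<odot> (y - y')"
    by (simp add: sp_mult_diff_left sp_mult_diff_right)
  then have "q (x \<odot> y - x' \<odot> y') = q ((x - x') \<odot> y + x' \<odot> (y - y'))" by (rule arg_cong)
  also have "\<dots> \<le> q ((x - x') \<odot> y) + q (x' \<odot> (y - y'))"
    using assms by (intro q_add sp_carr_mult sp_carr_diff)
  also have "\<dots> \<le> q (x - x') * q y + q x' * q (y - y')"
    using assms by (intro add_mono q_mult sp_carr_diff)
  finally show ?thesis .
qed

lemma sn_dist_eq: "sn_dist \<A> q x y = q (x - y)"
  by (simp only: sn_dist_def free_star_algebra_simps sp_diff_eq)

section \<open>Cauchy sequences of *-polynomials and the operations on their classes\<close>

abbreviation "\<K> \<equiv> cauchy_seqs \<A> q"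

definition cls :: "(nat \<Rightarrow> 'g star_poly) \<Rightarrow> (nat \<Rightarrow> 'g star_poly) set" where
  "cls x = null_rel \<A> q `` {x}"

lemma cauchy_iff:
  "x \<in> \<K> \<longleftrightarrow> (\<forall>n. x n \<in> sp_carr X) \<and> (\<forall>\<epsilon>>0. \<exists>N. \<forall>m\<ge>N. \<forall>n\<ge>N. q (x m - x n) < \<epsilon>)"
  by (simp only: cauchy_seqs_def sn_dist_eq mem_Collect_eq)

lemma cauchy_carr: "x \<in> \<K> \<Longrightarrow> x n \<in> sp_carr X"
  by (simp add: cauchy_iff)

lemma cauchy_bounded:
  assumes x: "x \<in> \<K>"
  shows "\<exists>C\<ge>0. \<forall>n. q (x n) \<le> C"
proof -
  obtain N where N: "\<And>m n. N \<le> m \<Longrightarrow> N \<le> n \<Longrightarrow> q (x m - x n) < 1"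
    using x[unfolded cauchy_iff] zero_less_one by blast
  define C where "C = Max (q ` x ` {..N}) + 1"
  have "q (x n) \<le> C" for n
  proof (cases "n \<le> N")
    case True
    then have "q (x n) \<le> Max (q ` x ` {..N})" by (intro Max_ge) auto
    then show ?thesis by (simp add: C_def)
  next
    case False
    have "q (x n) \<le> q (x N) + q (x n - x N)" by (intro q_diff_le cauchy_carr x)
    moreover have "q (x N) \<le> Max (q ` x ` {..N})" by (intro Max_ge) auto
    moreover have "q (x n - x N) < 1" using False by (intro N) auto
    ultimately show ?thesis unfolding C_def by linarith
  qed
  moreover have "0 \<le> q (x 0)" by (intro q_nonneg cauchy_carr x)
  ultimately show ?thesis by (metis order_trans)
qed

lemma cauchyI:
  assumes "\<And>n. x n \<in> sp_carr X"
    and "\<And>\<epsilon>. 0 < \<epsilon> \<Longrightarrow> \<exists>N. \<forall>m\<ge>N. \<forall>n\<ge>N. q (x m - x n) < \<epsilon>"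
  shows "x \<in> \<K>"
  unfolding cauchy_iff using assms by blast

lemma cauchyD:
  assumes "x \<in> \<K>" "0 < \<epsilon>"
  obtains N where "\<And>m n. N \<le> m \<Longrightarrow> N \<le> n \<Longrightarrow> q (x m - x n) < \<epsilon>"
  using assms unfolding cauchy_iff by blast

lemma cauchy_const: "x \<in> sp_carr X \<Longrightarrow> (\<lambda>n. x) \<in> \<K>"
  unfolding cauchy_iff diff_self q_zero by blast

lemma cauchy_add:
  assumes "x \<in> \<K>" "y \<in> \<K>"
  shows "(\<lambda>n. x n + y n) \<in> \<K>"
proof (rule cauchyI)
  note c = cauchy_carr[OF assms(1)] cauchy_carr[OF assms(2)]
  fix \<epsilon> :: real assume "0 < \<epsilon>"
  then obtain N M where N: "\<And>m n. N \<le> m \<Longrightarrow> N \<le> n \<Longrightarrow> q (x m - x n) < \<epsilon>/2"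
    and M: "\<And>m n. M \<le> m \<Longrightarrow> M \<le> n \<Longrightarrow> q (y m - y n) < \<epsilon>/2"
    using cauchyD[OF assms(1), of "\<epsilon>/2"] cauchyD[OF assms(2), of "\<epsilon>/2"] by (metis half_gt_zero)
  have "q (x m + y m - (x n + y n)) < \<epsilon>" if "max N M \<le> m" "max N M \<le> n" for m n
  proof -
    have "q (x m + y m - (x n + y n)) \<le> q (x m - x n) + q (y m - y n)"
      using q_add[of "x m - x n" "y m - y n"] c by (simp only: sp_carr_diff add_diff_add)
    then show ?thesis using N[of m n] M[of m n] that by simp
  qed
  then show "\<exists>N. \<forall>m\<ge>N. \<forall>n\<ge>N. q (x m + y m - (x n + y n)) < \<epsilon>" by blast
qed (intro sp_carr_add cauchy_carr assms)

lemma sp_scale_diff: "(\<lambda>w. c * x w) - (\<lambda>w. c * y w) = (\<lambda>w. c * (x - y) w)" for x y :: "'g star_poly"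
  by (auto simp: fun_eq_iff algebra_simps)

lemma cauchy_scale:
  assumes "x \<in> \<K>"
  shows "(\<lambda>n w. c * x n w) \<in> \<K>"
proof (rule cauchyI)
  note carr = cauchy_carr[OF assms(1)]
  fix \<epsilon> :: real assume \<epsilon>: "0 < \<epsilon>"
  have pos: "0 < cmod c + 1" by (simp add: add_nonneg_pos)
  then obtain N where N: "\<And>m n. N \<le> m \<Longrightarrow> N \<le> n \<Longrightarrow> q (x m - x n) < \<epsilon> / (cmod c + 1)"
    using cauchyD[OF assms(1), of "\<epsilon> / (cmod c + 1)"] \<epsilon> by (metis divide_pos_pos)
  have "q ((\<lambda>w. c * x m w) - (\<lambda>w. c * x n w)) < \<epsilon>" if "N \<le> m" "N \<le> n" for m n
  proof -
    have "q ((\<lambda>w. c * x m w) - (\<lambda>w. c * x n w)) = cmod c * q (x m - x n)"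
      unfolding sp_scale_diff by (intro q_scale sp_carr_diff carr)
    also have "\<dots> \<le> (cmod c + 1) * q (x m - x n)"
      by (intro mult_right_mono q_nonneg sp_carr_diff carr) simp
    also have "\<dots> < \<epsilon>" using N[OF that] pos by (simp add: pos_less_divide_eq mult.commute)
    finally show ?thesis .
  qed
  then show "\<exists>N. \<forall>m\<ge>N. \<forall>n\<ge>N. q ((\<lambda>w. c * x m w) - (\<lambda>w. c * x n w)) < \<epsilon>" by blast
qed (intro sp_carr_scale cauchy_carr assms)

lemma cauchy_star:
  assumes "x \<in> \<K>"
  shows "(\<lambda>n. sp_star (x n)) \<in> \<K>"
proof (rule cauchyI)
  note carr = cauchy_carr[OF assms(1)]
  have "q (sp_star (x m) - sp_star (x n)) = q (x m - x n)" for m n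
    by (simp only: sp_star_diff[symmetric] q_star sp_carr_diff carr)
  then show "\<exists>N. \<forall>m\<ge>N. \<forall>n\<ge>N. q (sp_star (x m) - sp_star (x n)) < \<epsilon>" if "0 < \<epsilon>" for \<epsilon>
    using assms that unfolding cauchy_iff by simp
qed (intro sp_carr_star cauchy_carr assms)

lemma cauchy_mult:
  assumes "x \<in> \<K>" "y \<in> \<K>"
  shows "(\<lambda>n. x n \<odot> y n) \<in> \<K>"
proof (rule cauchyI)
  note c = cauchy_carr[OF assms(1)] cauchy_carr[OF assms(2)]
  obtain C where C: "0 \<le> C" "\<And>n. q (x n) \<le> C" using cauchy_bounded[OF assms(1)] by blast
  obtain D where D: "0 \<le> D" "\<And>n. q (y n) \<le> D" using cauchy_bounded[OF assms(2)] by blast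
  fix \<epsilon> :: real assume \<epsilon>: "0 < \<epsilon>"
  define \<delta> where "\<delta> = \<epsilon> / (C + D + 1)"
  have \<delta>: "0 < \<delta>" "(C + D) * \<delta> < \<epsilon>" using \<epsilon> C(1) D(1) by (auto simp: \<delta>_def field_simps)
  obtain N where N: "\<And>m n. N \<le> m \<Longrightarrow> N \<le> n \<Longrightarrow> q (x m - x n) < \<delta>"
    using cauchyD[OF assms(1) \<delta>(1)] by blast
  obtain M where M: "\<And>m n. M \<le> m \<Longrightarrow> M \<le> n \<Longrightarrow> q (y m - y n) < \<delta>"
    using cauchyD[OF assms(2) \<delta>(1)] by blast
  have "q (x m \<odot> y m - x n \<odot> y n) < \<epsilon>" if "max N M \<le> m" "max N M \<le> n" for m n
  proof -
    have "q (x m \<odot> y m - x n \<odot> y n) \<le> q (x m - x n) * q (y m) + q (x n) * q (y m - y n)"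
      by (intro q_mult_diff c)
    also have "\<dots> \<le> \<delta> * D + C * \<delta>"
    proof (intro add_mono mult_mono C D q_nonneg c sp_carr_diff)
      show "q (x m - x n) \<le> \<delta>" using that by (intro less_imp_le[OF N]) auto
      show "q (y m - y n) \<le> \<delta>" using that by (intro less_imp_le[OF M]) auto
    qed (use \<delta> in simp)
    finally show ?thesis using \<delta>(2) by (simp add: algebra_simps)
  qed
  then show "\<exists>N. \<forall>m\<ge>N. \<forall>n\<ge>N. q (x m \<odot> y m - x n \<odot> y n) < \<epsilon>" by blast
qed (intro sp_carr_mult cauchy_carr assms)

lemma null_rel_iff: "(x, y) \<in> null_rel \<A> q \<longleftrightarrow> x \<in> \<K> \<and> y \<in> \<K> \<and> (\<lambda>n. q (x n - y n)) \<longlonglongrightarrow> 0"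
  by (simp only: null_rel_def sn_dist_eq mem_Collect_eq case_prod_conv)

lemma null_relI:
  assumes "x \<in> \<K>" "y \<in> \<K>" "\<And>n. q (x n - y n) \<le> e n" "e \<longlonglongrightarrow> 0"
  shows "(x, y) \<in> null_rel \<A> q"
  unfolding null_rel_iff
proof (intro conjI assms)
  show "(\<lambda>n. q (x n - y n)) \<longlonglongrightarrow> 0"
  proof (rule tendsto_sandwich[OF _ _ tendsto_const assms(4)])
    show "\<forall>\<^sub>F n in sequentially. 0 \<le> q (x n - y n)"
      by (intro always_eventually allI q_nonneg sp_carr_diff cauchy_carr assms)
    show "\<forall>\<^sub>F n in sequentially. q (x n - y n) \<le> e n"
      by (intro always_eventually allI assms)
  qed
qed

lemma equiv_null_rel: "equiv \<K> (null_rel \<A> q)"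
proof (rule equivI)
  show "null_rel \<A> q \<subseteq> \<K> \<times> \<K>" by (auto simp: null_rel_iff)
  show "refl_on \<K> (null_rel \<A> q)" unfolding refl_on_def null_rel_iff diff_self q_zero by auto
  show "sym (null_rel \<A> q)"
  proof (rule symI)
    fix x y assume xy: "(x, y) \<in> null_rel \<A> q"
    then have "q (x n - y n) = q (y n - x n)" for n
      unfolding null_rel_iff by (intro q_minus_commute cauchy_carr) auto
    then show "(y, x) \<in> null_rel \<A> q" using xy unfolding null_rel_iff by simp
  qed
  show "trans (null_rel \<A> q)"
  proof (rule transI)
    fix x y z assume *: "(x, y) \<in> null_rel \<A> q" "(y, z) \<in> null_rel \<A> q"
    show "(x, z) \<in> null_rel \<A> q"
    proof (rule null_relI)
      show "q (x n - z n) \<le> q (x n - y n) + q (y n - z n)" for n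
        using * unfolding null_rel_iff by (intro q_triangle cauchy_carr) auto
      show "(\<lambda>n. q (x n - y n) + q (y n - z n)) \<longlonglongrightarrow> 0"
        using * unfolding null_rel_iff by (intro tendsto_add_zero) auto
    qed (use * in \<open>auto simp: null_rel_iff\<close>)
  qed
qed

lemma cls_eq_iff: "x \<in> \<K> \<Longrightarrow> y \<in> \<K> \<Longrightarrow> cls x = cls y \<longleftrightarrow> (x, y) \<in> null_rel \<A> q"
  unfolding cls_def by (rule eq_equiv_class_iff[OF equiv_null_rel])

lemma carr_completion: "carr \<C> = cls ` \<K>"
  by (auto simp: completion_def quotient_def cls_def)

lemma cls_in: "x \<in> \<K> \<Longrightarrow> cls x \<in> carr \<C>"
  by (simp add: carr_completion)

lemma rep_cls:
  assumes "x \<in> \<K>"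
  shows "(rep (cls x), x) \<in> null_rel \<A> q"
proof -
  have "x \<in> cls x" using assms equiv_class_self[OF equiv_null_rel] by (simp add: cls_def)
  then have "rep (cls x) \<in> cls x" unfolding rep_def by (rule someI[where P = "\<lambda>y. y \<in> cls x"])
  then show ?thesis using equiv_null_rel unfolding cls_def equiv_def by (blast dest: symD)
qed

lemma rep_cls_cauchy: "x \<in> \<K> \<Longrightarrow> rep (cls x) \<in> \<K>"
  using rep_cls[of x] by (simp add: null_rel_iff)

lemma rep_cls_lim: "x \<in> \<K> \<Longrightarrow> (\<lambda>n. q (rep (cls x) n - x n)) \<longlonglongrightarrow> 0"
  using rep_cls[of x] by (simp only: null_rel_iff)

text \<open>The completion adds chosen representatives. They differ from the given sequences by null
  sequences, and the operation is continuous, so the class is the same; scaling, star and product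
  are treated alike.\<close>

lemma add_cls:
  assumes x: "x \<in> \<K>" and y: "y \<in> \<K>"
  shows "add \<C> (cls x) (cls y) = cls (\<lambda>n. x n + y n)"
proof -
  note r = rep_cls_cauchy[OF x] rep_cls_cauchy[OF y]
  note c = cauchy_carr[OF x] cauchy_carr[OF y] cauchy_carr[OF r(1)] cauchy_carr[OF r(2)]
  have "add \<C> (cls x) (cls y) = cls (\<lambda>n. rep (cls x) n + rep (cls y) n)"
    by (simp add: completion_def cls_def)
  also have "\<dots> = cls (\<lambda>n. x n + y n)"
  proof (subst cls_eq_iff)
    show "((\<lambda>n. rep (cls x) n + rep (cls y) n), (\<lambda>n. x n + y n)) \<in> null_rel \<A> q"
    proof (rule null_relI)
      show "q (rep (cls x) n + rep (cls y) n - (x n + y n))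
          \<le> q (rep (cls x) n - x n) + q (rep (cls y) n - y n)" for n
        using q_add[of "rep (cls x) n - x n" "rep (cls y) n - y n"] c
        by (simp only: sp_carr_diff add_diff_add)
      show "(\<lambda>n. q (rep (cls x) n - x n) + q (rep (cls y) n - y n)) \<longlonglongrightarrow> 0"
        by (intro tendsto_add_zero rep_cls_lim x y)
    qed (intro cauchy_add r x y)+
  qed (intro cauchy_add r x y)+
  finally show ?thesis .
qed

lemma scale_cls:
  assumes x: "x \<in> \<K>"
  shows "scale \<C> c (cls x) = cls (\<lambda>n w. c * x n w)"
proof -
  note r = rep_cls_cauchy[OF x]
  note c = cauchy_carr[OF x] cauchy_carr[OF r(1)]
  have "scale \<C> c (cls x) = cls (\<lambda>n w. c * rep (cls x) n w)"
    by (simp add: completion_def cls_def)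
  also have "\<dots> = cls (\<lambda>n w. c * x n w)"
  proof (subst cls_eq_iff)
    show "((\<lambda>n w. c * rep (cls x) n w), (\<lambda>n w. c * x n w)) \<in> null_rel \<A> q"
    proof (rule null_relI)
      show "q ((\<lambda>w. c * rep (cls x) n w) - (\<lambda>w. c * x n w)) \<le> cmod c * q (rep (cls x) n - x n)" for n
        unfolding sp_scale_diff using c by (simp only: q_scale sp_carr_diff)
      show "(\<lambda>n. cmod c * q (rep (cls x) n - x n)) \<longlonglongrightarrow> 0"
        by (intro tendsto_mult_right_zero rep_cls_lim x)
    qed (intro cauchy_scale r x)+
  qed (intro cauchy_scale r x)+
  finally show ?thesis .
qed

lemma star_cls:
  assumes x: "x \<in> \<K>"
  shows "star \<C> (cls x) = cls (\<lambda>n. sp_star (x n))"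
proof -
  note r = rep_cls_cauchy[OF x]
  note c = cauchy_carr[OF x] cauchy_carr[OF r(1)]
  have "star \<C> (cls x) = cls (\<lambda>n. sp_star (rep (cls x) n))"
    by (simp add: completion_def cls_def)
  also have "\<dots> = cls (\<lambda>n. sp_star (x n))"
  proof (subst cls_eq_iff)
    show "((\<lambda>n. sp_star (rep (cls x) n)), (\<lambda>n. sp_star (x n))) \<in> null_rel \<A> q"
    proof (rule null_relI)
      show "q (sp_star (rep (cls x) n) - sp_star (x n)) \<le> q (rep (cls x) n - x n)" for n
        using c by (simp only: sp_star_diff[symmetric] q_star sp_carr_diff)
      show "(\<lambda>n. q (rep (cls x) n - x n)) \<longlonglongrightarrow> 0" by (intro rep_cls_lim x)
    qed (intro cauchy_star r x)+
  qed (intro cauchy_star r x)+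
  finally show ?thesis .
qed

lemma mult_cls:
  assumes x: "x \<in> \<K>" and y: "y \<in> \<K>"
  shows "mult \<C> (cls x) (cls y) = cls (\<lambda>n. x n \<odot> y n)"
proof -
  note r = rep_cls_cauchy[OF x] rep_cls_cauchy[OF y]
  note c = cauchy_carr[OF x] cauchy_carr[OF y] cauchy_carr[OF r(1)] cauchy_carr[OF r(2)]
  \<comment> \<open>Multiplication is not uniformly continuous: the null differences appear
    multiplied by terms of Cauchy sequences, which have to be bounded.\<close>
  obtain C where C: "0 \<le> C" "\<And>n. q (x n) \<le> C" using cauchy_bounded[OF x] by blast
  obtain D where D: "0 \<le> D" "\<And>n. q (rep (cls y) n) \<le> D" using cauchy_bounded[OF r(2)] by blast
  have "mult \<C> (cls x) (cls y) = cls (\<lambda>n. rep (cls x) n \<odot> rep (cls y) n)"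
    by (simp add: completion_def cls_def)
  also have "\<dots> = cls (\<lambda>n. x n \<odot> y n)"
  proof (subst cls_eq_iff)
    show "((\<lambda>n. rep (cls x) n \<odot> rep (cls y) n), (\<lambda>n. x n \<odot> y n)) \<in> null_rel \<A> q"
    proof (rule null_relI)
      fix n
      have "q (rep (cls x) n \<odot> rep (cls y) n - x n \<odot> y n)
          \<le> q (rep (cls x) n - x n) * q (rep (cls y) n) + q (x n) * q (rep (cls y) n - y n)"
        by (intro q_mult_diff c)
      also have "\<dots> \<le> q (rep (cls x) n - x n) * D + C * q (rep (cls y) n - y n)"
        by (intro add_mono mult_mono C D q_nonneg sp_carr_diff c order_refl)
      finally show "q (rep (cls x) n \<odot> rep (cls y) n - x n \<odot> y n)
          \<le> q (rep (cls x) n - x n) * D + C * q (rep (cls y) n - y n)" .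
    next
      show "(\<lambda>n. q (rep (cls x) n - x n) * D + C * q (rep (cls y) n - y n)) \<longlonglongrightarrow> 0"
        by (intro tendsto_add_zero tendsto_mult_left_zero tendsto_mult_right_zero rep_cls_lim x y)
    qed (intro cauchy_mult r x y)+
  qed (intro cauchy_mult r x y)+
  finally show ?thesis .
qed

text \<open>This turns a recursion for \<open>x (n + 1)\<close> into a fixed point equation for the
  class of \<open>x\<close>, and allows a class to be represented by a tail.\<close>

lemma cauchy_shift:
  assumes x: "x \<in> \<K>"
  shows "(\<lambda>n. x (n + k)) \<in> \<K>" "cls (\<lambda>n. x (n + k)) = cls x"
proof -
  show *: "(\<lambda>n. x (n + k)) \<in> \<K>"
  proof (rule cauchyI)
    fix \<epsilon> :: real assume "0 < \<epsilon>"
    from cauchyD[OF x this] obtain N where "\<And>m n. N \<le> m \<Longrightarrow> N \<le> n \<Longrightarrow> q (x m - x n) < \<epsilon>" by blast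
    then show "\<exists>N. \<forall>m\<ge>N. \<forall>n\<ge>N. q (x (m + k) - x (n + k)) < \<epsilon>" by (meson trans_le_add1)
  qed (rule cauchy_carr[OF x])
  have "(\<lambda>n. q (x (n + k) - x n)) \<longlonglongrightarrow> 0"
  proof (rule LIMSEQ_I)
    fix \<epsilon> :: real assume "0 < \<epsilon>"
    from cauchyD[OF x this] obtain N where N: "\<And>m n. N \<le> m \<Longrightarrow> N \<le> n \<Longrightarrow> q (x m - x n) < \<epsilon>" by blast
    have "norm (q (x (n + k) - x n) - 0) < \<epsilon>" if "N \<le> n" for n
      using N[of "n + k" n] that q_nonneg[OF sp_carr_diff[OF cauchy_carr[OF x] cauchy_carr[OF x]]] by simp
    then show "\<exists>N. \<forall>n\<ge>N. norm (q (x (n + k) - x n) - 0) < \<epsilon>" by blast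
  qed
  then show "cls (\<lambda>n. x (n + k)) = cls x"
    using * x by (simp only: cls_eq_iff null_rel_iff)
qed

lemma to_completion_eq: "to_completion \<A> q x = cls (\<lambda>n. x)"
  by (simp add: to_completion_def cls_def)

lemma to_completion_hom: "restrict (to_completion \<A> q) (sp_carr X) \<in> star_homs \<A> \<C>"
  unfolding star_homs_def
  by (auto simp: to_completion_eq cls_in cauchy_const add_cls scale_cls star_cls mult_cls)

end

section \<open>Operator distance, completeness, and continuity of the operations\<close>

context hilbert_space
begin

abbreviation op_dist :: "('h \<Rightarrow> 'h) \<Rightarrow> ('h \<Rightarrow> 'h) \<Rightarrow> real" where
  "op_dist \<equiv> sn_dist (bounded_ops H) opnorm"

lemma inner_op_diff:
  assumes "S \<in> \<B>" "T \<in> \<B>" "x \<in> hcarr H" "y \<in> hcarr H"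
  shows "hinner H (add (bounded_ops H) S (scale (bounded_ops H) (-1) T) x) y
    = hinner H (S x) y - hinner H (T x) y"
  using assms by simp

lemma op_dist_bound:
  assumes "S \<in> \<B>" "T \<in> \<B>" "x \<in> hcarr H" "y \<in> hcarr H"
  shows "cmod (hinner H (S x) y - hinner H (T x) y) \<le> op_dist S T * hnorm H x * hnorm H y"
  unfolding sn_dist_def inner_op_diff[OF assms, symmetric]
  using assms by (intro cmod_inner_le_opnorm) auto

lemma op_dist_nonneg: "S \<in> \<B> \<Longrightarrow> T \<in> \<B> \<Longrightarrow> 0 \<le> op_dist S T"
  unfolding sn_dist_def by (intro opnorm_nonneg) auto

text \<open>Testing the difference against its own value, \<open>y = ?D x\<close>, and cancelling
  one factor turns a bound on the form into a bound on the operator norm.\<close>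

lemma op_dist_le:
  assumes S: "S \<in> \<B>" and T: "T \<in> \<B>" and e: "0 \<le> e"
    and bound: "\<And>x y. x \<in> hcarr H \<Longrightarrow> y \<in> hcarr H \<Longrightarrow>
      cmod (hinner H (S x) y - hinner H (T x) y) \<le> e * hnorm H x * hnorm H y"
  shows "op_dist S T \<le> e"
  unfolding sn_dist_def
proof (rule opnorm_le[OF _ e])
  let ?D = "add (bounded_ops H) S (scale (bounded_ops H) (-1) T)"
  show D: "?D \<in> \<B>" using S T by auto
  fix x assume x: "x \<in> hcarr H"
  have Dx: "?D x \<in> hcarr H" using D x by (rule op_apply)
  show "hnorm H (?D x) \<le> e * hnorm H x"
  proof (cases "hnorm H (?D x) = 0")
    case True
    then show ?thesis using e hnorm_nonneg[OF x] by simp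
  next
    case False
    then have pos: "0 < hnorm H (?D x)" using hnorm_nonneg[OF Dx] by simp
    have "hnorm H (?D x) * hnorm H (?D x) = cmod (hinner H (?D x) (?D x))"
      using Dx by (simp only: inner_self norm_of_real power2_eq_square abs_mult abs_mult_self_eq)
    also have "\<dots> \<le> (e * hnorm H x) * hnorm H (?D x)"
      using bound[OF x Dx] by (simp only: inner_op_diff[OF S T x Dx])
    finally show ?thesis using pos by simp
  qed
qed

text \<open>The matrix coefficients converge, their limit is a bounded form and hence comes from an
  operator. The Cauchy estimate survives the limit with a constant independent of \<open>x\<close>
  and \<open>y\<close>, which gives convergence in norm.\<close>

lemma op_complete:
  assumes U: "\<And>n. U n \<in> \<B>"
    and cauchy: "\<And>\<epsilon>. 0 < \<epsilon> \<Longrightarrow> \<exists>N. \<forall>m\<ge>N. \<forall>n\<ge>N. op_dist (U m) (U n) < \<epsilon>"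
  shows "\<exists>T\<in>\<B>. (\<lambda>n. op_dist (U n) T) \<longlonglongrightarrow> 0"
proof -
  have conv: "convergent (\<lambda>n. hinner H (U n x) y)" if x: "x \<in> hcarr H" and y: "y \<in> hcarr H" for x y
  proof (intro Cauchy_convergent metric_CauchyI)
    fix \<epsilon> :: real assume \<epsilon>: "0 < \<epsilon>"
    define \<delta> where "\<delta> = \<epsilon> / (hnorm H x * hnorm H y + 1)"
    have nn: "0 \<le> hnorm H x * hnorm H y" using x y hnorm_nonneg by simp
    then have \<delta>: "0 < \<delta>" "\<delta> * (hnorm H x * hnorm H y) < \<epsilon>"
      using \<epsilon> by (auto simp: \<delta>_def field_simps)
    obtain N where N: "\<And>m n. N \<le> m \<Longrightarrow> N \<le> n \<Longrightarrow> op_dist (U m) (U n) < \<delta>"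
      using cauchy[OF \<delta>(1)] by blast
    have "dist (hinner H (U m x) y) (hinner H (U n x) y) < \<epsilon>" if "N \<le> m" "N \<le> n" for m n
    proof -
      have "dist (hinner H (U m x) y) (hinner H (U n x) y)
          \<le> op_dist (U m) (U n) * (hnorm H x * hnorm H y)"
        using op_dist_bound[OF U U x y, of m n] by (simp add: dist_norm mult.assoc)
      also have "\<dots> \<le> \<delta> * (hnorm H x * hnorm H y)"
        by (intro mult_right_mono less_imp_le[OF N] that nn)
      finally show ?thesis using \<delta>(2) by simp
    qed
    then show "\<exists>N. \<forall>m\<ge>N. \<forall>n\<ge>N. dist (hinner H (U m x) y) (hinner H (U n x) y) < \<epsilon>" by blast
  qed
  define b where "b x y = lim (\<lambda>n. hinner H (U n x) y)" for x y
  have b: "(\<lambda>n. hinner H (U n x) y) \<longlonglongrightarrow> b x y" if "x \<in> hcarr H" "y \<in> hcarr H" for x y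
    using conv[OF that] unfolding b_def by (simp add: convergent_LIMSEQ_iff)
  have close: "cmod (hinner H (U n x) y - b x y) \<le> \<epsilon> * hnorm H x * hnorm H y"
    if N: "\<And>m n. N \<le> m \<Longrightarrow> N \<le> n \<Longrightarrow> op_dist (U m) (U n) < \<epsilon>" and n: "N \<le> n"
      and x: "x \<in> hcarr H" and y: "y \<in> hcarr H" for N n \<epsilon> x y
  proof (rule LIMSEQ_le_const2)
    show "(\<lambda>m. cmod (hinner H (U n x) y - hinner H (U m x) y)) \<longlonglongrightarrow> cmod (hinner H (U n x) y - b x y)"
      by (intro tendsto_intros b x y)
    have "cmod (hinner H (U n x) y - hinner H (U m x) y) \<le> \<epsilon> * hnorm H x * hnorm H y" if "N \<le> m" for m
    proof -
      have "op_dist (U n) (U m) * hnorm H x * hnorm H y \<le> \<epsilon> * hnorm H x * hnorm H y"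
        by (intro mult_right_mono less_imp_le[OF N] hnorm_nonneg x y n that)
      then show ?thesis using op_dist_bound[OF U U x y, of n m] by linarith
    qed
    then show "\<exists>M. \<forall>m\<ge>M. cmod (hinner H (U n x) y - hinner H (U m x) y) \<le> \<epsilon> * hnorm H x * hnorm H y"
      by blast
  qed
  obtain N where N: "\<And>m n. N \<le> m \<Longrightarrow> N \<le> n \<Longrightarrow> op_dist (U m) (U n) < 1"
    using cauchy[of 1] by auto
  have "\<exists>T\<in>\<B>. \<forall>x\<in>hcarr H. \<forall>y\<in>hcarr H. hinner H (T x) y = b x y"
  proof (rule sesquilinear_operator[where C = "opnorm (U N) + 1"])
    fix x y assume x: "x \<in> hcarr H" and y: "y \<in> hcarr H"
    show "b (hscale H c x) y = c * b x y" for c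
      by (rule LIMSEQ_unique[OF b]) (use tendsto_mult_left[OF b[OF x y], of c] x y U in \<open>simp_all add: op_scale\<close>)
    show "b x (hscale H c y) = cnj c * b x y" for c
      by (rule LIMSEQ_unique[OF b]) (use tendsto_mult_left[OF b[OF x y], of "cnj c"] x y U in simp_all)
    have "cmod (b x y) \<le> cmod (hinner H (U N x) y) + cmod (hinner H (U N x) y - b x y)"
      using norm_triangle_ineq4[of "hinner H (U N x) y" "hinner H (U N x) y - b x y"] by simp
    also have "\<dots> \<le> opnorm (U N) * hnorm H x * hnorm H y + 1 * hnorm H x * hnorm H y"
      by (intro add_mono cmod_inner_le_opnorm U x y close[OF N]) auto
    finally show "cmod (b x y) \<le> (opnorm (U N) + 1) * hnorm H x * hnorm H y"
      by (simp add: algebra_simps)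
    fix z assume z: "z \<in> hcarr H"
    show "b (hadd H x y) z = b x z + b y z"
      by (rule LIMSEQ_unique[OF b])
        (use tendsto_add[OF b[OF x z] b[OF y z]] x y z U in \<open>simp_all add: op_add\<close>)
    show "b z (hadd H x y) = b z x + b z y"
      by (rule LIMSEQ_unique[OF b])
        (use tendsto_add[OF b[OF z x] b[OF z y]] x y z U in simp_all)
  qed
  then obtain T where T: "T \<in> \<B>" "\<And>x y. x \<in> hcarr H \<Longrightarrow> y \<in> hcarr H \<Longrightarrow> hinner H (T x) y = b x y" by blast
  have "(\<lambda>n. op_dist (U n) T) \<longlonglongrightarrow> 0"
  proof (rule LIMSEQ_I)
    fix \<epsilon> :: real assume \<epsilon>: "0 < \<epsilon>"
    then obtain N where N: "\<And>m n. N \<le> m \<Longrightarrow> N \<le> n \<Longrightarrow> op_dist (U m) (U n) < \<epsilon>/2"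
      using cauchy[of "\<epsilon>/2"] by auto
    have "op_dist (U n) T \<le> \<epsilon>/2" if "N \<le> n" for n
      using \<epsilon> that close[OF N] by (intro op_dist_le U T(1)) (auto simp: T(2))
    then show "\<exists>N. \<forall>n\<ge>N. norm (op_dist (U n) T - 0) < \<epsilon>"
      using \<epsilon> op_dist_nonneg[OF U T(1)] by (intro exI[of _ N]) force
  qed
  then show ?thesis using T(1) by blast
qed

text \<open>The middle operator stands first in both distances. This fits distances from
  \<open>\<rho> (x n)\<close> to candidates for its limit, without appeal to symmetry.\<close>

lemma op_dist_triangle:
  assumes "S \<in> \<B>" "T \<in> \<B>" "U \<in> \<B>"
  shows "op_dist S U \<le> op_dist T S + op_dist T U"
proof (rule op_dist_le[OF assms(1,3)])
  show "0 \<le> op_dist T S + op_dist T U" using assms by (intro add_nonneg_nonneg op_dist_nonneg)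
  fix x y assume xy: "x \<in> hcarr H" "y \<in> hcarr H"
  have "cmod (hinner H (S x) y - hinner H (U x) y)
      \<le> cmod (hinner H (T x) y - hinner H (S x) y) + cmod (hinner H (T x) y - hinner H (U x) y)"
    using norm_triangle_ineq4[of "hinner H (T x) y - hinner H (U x) y" "hinner H (T x) y - hinner H (S x) y"]
    by simp
  then show "cmod (hinner H (S x) y - hinner H (U x) y)
      \<le> (op_dist T S + op_dist T U) * hnorm H x * hnorm H y"
    using op_dist_bound[OF assms(2,1) xy] op_dist_bound[OF assms(2,3) xy]
    by (simp only: distrib_right)
qed

lemma op_dist_eq_0:
  assumes "S \<in> \<B>" "T \<in> \<B>" "op_dist S T \<le> 0"
  shows "S = T"
proof (rule op_eqI[OF assms(1,2)])
  fix x y assume xy: "x \<in> hcarr H" "y \<in> hcarr H"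
  have "op_dist S T * hnorm H x * hnorm H y \<le> 0 * hnorm H x * hnorm H y"
    by (intro mult_right_mono assms hnorm_nonneg xy)
  then show "hinner H (S x) y = hinner H (T x) y"
    using order_trans[OF op_dist_bound[OF assms(1,2) xy]] by (metis eq_iff_diff_eq_0 mult_zero_left norm_le_zero_iff)
qed

lemma op_dist_add:
  assumes "S \<in> \<B>" "T \<in> \<B>" "S' \<in> \<B>" "T' \<in> \<B>"
  shows "op_dist (add (bounded_ops H) S T) (add (bounded_ops H) S' T') \<le> op_dist S S' + op_dist T T'"
proof (rule op_dist_le)
  show "0 \<le> op_dist S S' + op_dist T T'" using assms by (intro add_nonneg_nonneg op_dist_nonneg)
  fix x y assume xy: "x \<in> hcarr H" "y \<in> hcarr H"
  have "cmod (hinner H (add (bounded_ops H) S T x) y - hinner H (add (bounded_ops H) S' T' x) y)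
    = cmod ((hinner H (S x) y - hinner H (S' x) y) + (hinner H (T x) y - hinner H (T' x) y))"
    using assms xy by (simp add: algebra_simps)
  also have "\<dots> \<le> cmod (hinner H (S x) y - hinner H (S' x) y) + cmod (hinner H (T x) y - hinner H (T' x) y)"
    by (rule norm_triangle_ineq)
  also have "\<dots> \<le> op_dist S S' * hnorm H x * hnorm H y + op_dist T T' * hnorm H x * hnorm H y"
    by (intro add_mono op_dist_bound assms xy)
  finally show "cmod (hinner H (add (bounded_ops H) S T x) y - hinner H (add (bounded_ops H) S' T' x) y)
      \<le> (op_dist S S' + op_dist T T') * hnorm H x * hnorm H y" by (simp only: distrib_right)
qed (use assms in auto)

lemma op_dist_scale:
  assumes "S \<in> \<B>" "S' \<in> \<B>"
  shows "op_dist (scale (bounded_ops H) c S) (scale (bounded_ops H) c S') \<le> cmod c * op_dist S S'"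
proof (rule op_dist_le)
  show "0 \<le> cmod c * op_dist S S'" using assms by (intro mult_nonneg_nonneg op_dist_nonneg) auto
  fix x y assume xy: "x \<in> hcarr H" "y \<in> hcarr H"
  have "cmod (hinner H (scale (bounded_ops H) c S x) y - hinner H (scale (bounded_ops H) c S' x) y)
    = cmod c * cmod (hinner H (S x) y - hinner H (S' x) y)"
    using assms xy by (simp flip: norm_mult right_diff_distrib)
  also have "\<dots> \<le> cmod c * (op_dist S S' * hnorm H x * hnorm H y)"
    by (intro mult_left_mono op_dist_bound assms xy) simp
  finally show "cmod (hinner H (scale (bounded_ops H) c S x) y - hinner H (scale (bounded_ops H) c S' x) y)
      \<le> cmod c * op_dist S S' * hnorm H x * hnorm H y" by (simp only: mult.assoc)
qed (use assms in auto)

lemma op_dist_adjoint: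
  assumes "S \<in> \<B>" "S' \<in> \<B>"
  shows "op_dist (adjoint_op H S) (adjoint_op H S') \<le> op_dist S S'"
proof (rule op_dist_le)
  show "0 \<le> op_dist S S'" using assms by (intro op_dist_nonneg)
  fix x y assume xy: "x \<in> hcarr H" "y \<in> hcarr H"
  have "hinner H (adjoint_op H S x) y - hinner H (adjoint_op H S' x) y
      = cnj (hinner H (S y) x - hinner H (S' y) x)"
    using assms xy inner_commute[of "S y" x] inner_commute[of "S' y" x]
    by (simp add: inner_adjoint_left)
  then show "cmod (hinner H (adjoint_op H S x) y - hinner H (adjoint_op H S' x) y)
      \<le> op_dist S S' * hnorm H x * hnorm H y"
    using op_dist_bound[OF assms xy(2,1)] by (simp add: ac_simps flip: complex_cnj_diff)
qed (use assms in auto)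

text \<open>The usual splitting \<open>S T - S' T' = (S - S') T + S' (T - T')\<close>, carried out
  inside the inner product. There \<open>S'\<close> crosses to the second argument, which is why the
  norm of its adjoint is the constant.\<close>

lemma op_dist_mult:
  assumes "S \<in> \<B>" "T \<in> \<B>" "S' \<in> \<B>" "T' \<in> \<B>"
  shows "op_dist (compose (hcarr H) S T) (compose (hcarr H) S' T')
    \<le> op_dist S S' * opnorm T + opnorm (adjoint_op H S') * op_dist T T'"
proof (rule op_dist_le)
  show "0 \<le> op_dist S S' * opnorm T + opnorm (adjoint_op H S') * op_dist T T'"
    using assms by (intro add_nonneg_nonneg mult_nonneg_nonneg op_dist_nonneg opnorm_nonneg) auto
  fix x y assume x: "x \<in> hcarr H" and y: "y \<in> hcarr H"
  have Tx: "T x \<in> hcarr H" "T' x \<in> hcarr H" "adjoint_op H S' y \<in> hcarr H" using assms x y by auto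
  have "hinner H (compose (hcarr H) S T x) y - hinner H (compose (hcarr H) S' T' x) y
      = (hinner H (S (T x)) y - hinner H (S' (T x)) y)
        + (hinner H (T x) (adjoint_op H S' y) - hinner H (T' x) (adjoint_op H S' y))"
    using assms x y Tx by (simp add: compose_eq inner_adjoint)
  also have "cmod \<dots> \<le> cmod (hinner H (S (T x)) y - hinner H (S' (T x)) y)
        + cmod (hinner H (T x) (adjoint_op H S' y) - hinner H (T' x) (adjoint_op H S' y))"
    by (rule norm_triangle_ineq)
  also have "\<dots> \<le> op_dist S S' * hnorm H (T x) * hnorm H y
        + op_dist T T' * hnorm H x * hnorm H (adjoint_op H S' y)"
    by (intro add_mono op_dist_bound assms x y Tx)
  also have "\<dots> \<le> op_dist S S' * (opnorm T * hnorm H x) * hnorm H y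
        + op_dist T T' * hnorm H x * (opnorm (adjoint_op H S') * hnorm H y)"
    using assms x y
    by (intro add_mono mult_right_mono mult_left_mono mult_nonneg_nonneg opnorm op_dist_nonneg
        hnorm_nonneg adjoint_closed)
  finally show "cmod (hinner H (compose (hcarr H) S T x) y - hinner H (compose (hcarr H) S' T' x) y)
    \<le> (op_dist S S' * opnorm T + opnorm (adjoint_op H S') * op_dist T T') * hnorm H x * hnorm H y"
    by (simp add: algebra_simps)
qed (use assms in auto)

end

section \<open>Extension of a contractive representation to the completion\<close>

locale completion_rep = hilbert_space H + sp_cstar_seminorm X q
  for H :: "'h hilbert" and X :: "'g set" and q :: "'g star_poly \<Rightarrow> real"
begin

definition ext_rel :: "('g star_poly \<Rightarrow> 'h \<Rightarrow> 'h) \<Rightarrow> (nat \<Rightarrow> 'g star_poly) \<Rightarrow> ('h \<Rightarrow> 'h) \<Rightarrow> bool" where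
  "ext_rel \<rho> x T \<longleftrightarrow> T \<in> \<B> \<and> (\<lambda>n. op_dist (\<rho> (x n)) T) \<longlonglongrightarrow> 0"

definition extension :: "('g star_poly \<Rightarrow> 'h \<Rightarrow> 'h) \<Rightarrow> (nat \<Rightarrow> 'g star_poly) set \<Rightarrow> 'h \<Rightarrow> 'h" where
  "extension \<rho> = (\<lambda>Y\<in>carr \<C>. SOME T. ext_rel \<rho> (rep Y) T)"

context
  fixes \<rho>
  assumes \<rho>: "\<rho> \<in> star_homs \<A> (bounded_ops H)"
    and contractive: "\<And>x. x \<in> sp_carr X \<Longrightarrow> opnorm (\<rho> x) \<le> q x"
begin

lemma \<rho>_closed: "x \<in> sp_carr X \<Longrightarrow> \<rho> x \<in> \<B>"
  using star_homsD(1)[OF \<rho>] by simp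

lemma op_dist_rho:
  assumes x: "x \<in> sp_carr X" and y: "y \<in> sp_carr X"
  shows "op_dist (\<rho> x) (\<rho> y) \<le> q (x - y)"
proof -
  have "\<rho> (x + (\<lambda>w. - 1 * y w)) = add (bounded_ops H) (\<rho> x) (scale (bounded_ops H) (-1) (\<rho> y))"
    using star_homsD(2)[OF \<rho>, of x "\<lambda>w. - 1 * y w"] star_homsD(3)[OF \<rho> y, of "-1"] x
      sp_carr_scale[OF y, of "-1"]
    by (simp only: free_star_algebra_simps)
  then show ?thesis
    using contractive[OF sp_carr_diff[OF x y]] unfolding sn_dist_def sp_diff_eq by simp
qed

lemma ext_rel_exists:
  assumes x: "x \<in> \<K>"
  shows "\<exists>T. ext_rel \<rho> x T"
proof -
  have "\<exists>T\<in>\<B>. (\<lambda>n. op_dist (\<rho> (x n)) T) \<longlonglongrightarrow> 0"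
  proof (rule op_complete)
    show "\<rho> (x n) \<in> \<B>" for n by (intro \<rho>_closed cauchy_carr x)
    fix \<epsilon> :: real assume "0 < \<epsilon>"
    from cauchyD[OF x this] obtain N where "\<And>m n. N \<le> m \<Longrightarrow> N \<le> n \<Longrightarrow> q (x m - x n) < \<epsilon>" by blast
    then show "\<exists>N. \<forall>m\<ge>N. \<forall>n\<ge>N. op_dist (\<rho> (x m)) (\<rho> (x n)) < \<epsilon>"
      using op_dist_rho[OF cauchy_carr[OF x] cauchy_carr[OF x]] by (meson le_less_trans)
  qed
  then show ?thesis unfolding ext_rel_def by blast
qed

lemma ext_relI:
  assumes "T \<in> \<B>" "\<And>n. x n \<in> sp_carr X" "\<And>n. op_dist (\<rho> (x n)) T \<le> e n" "e \<longlonglongrightarrow> 0"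
  shows "ext_rel \<rho> x T"
  unfolding ext_rel_def
proof (intro conjI assms(1) tendsto_sandwich[OF _ _ tendsto_const assms(4)])
  show "\<forall>\<^sub>F n in sequentially. 0 \<le> op_dist (\<rho> (x n)) T"
    by (intro always_eventually allI op_dist_nonneg \<rho>_closed assms)
  show "\<forall>\<^sub>F n in sequentially. op_dist (\<rho> (x n)) T \<le> e n"
    by (intro always_eventually allI assms)
qed

text \<open>Uniqueness of the limit and independence of the representing sequence in one statement:
  contractivity makes the images of equivalent sequences approach each other.\<close>

lemma ext_rel_unique:
  assumes "(x, y) \<in> null_rel \<A> q" "ext_rel \<rho> x S" "ext_rel \<rho> y T"
  shows "S = T"
proof (rule op_dist_eq_0)
  show S: "S \<in> \<B>" and T: "T \<in> \<B>" using assms by (auto simp: ext_rel_def)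
  have x: "\<And>n. x n \<in> sp_carr X" and y: "\<And>n. y n \<in> sp_carr X"
    using assms(1) cauchy_carr unfolding null_rel_iff by blast+
  have "op_dist S T \<le> op_dist (\<rho> (x n)) S + (q (y n - x n) + op_dist (\<rho> (y n)) T)" for n
  proof -
    have "op_dist S T \<le> op_dist (\<rho> (x n)) S + op_dist (\<rho> (x n)) T"
      by (intro op_dist_triangle S T \<rho>_closed x)
    moreover have "op_dist (\<rho> (x n)) T \<le> op_dist (\<rho> (y n)) (\<rho> (x n)) + op_dist (\<rho> (y n)) T"
      by (intro op_dist_triangle S T \<rho>_closed x y)
    ultimately show ?thesis using op_dist_rho[OF y x, of n n] by linarith
  qed
  moreover have "(\<lambda>n. op_dist (\<rho> (x n)) S + (q (y n - x n) + op_dist (\<rho> (y n)) T)) \<longlonglongrightarrow> 0"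
    using assms q_minus_commute[OF x y] unfolding ext_rel_def null_rel_iff
    by (intro tendsto_add_zero) (simp_all only:)
  ultimately show "op_dist S T \<le> 0" by (intro LIMSEQ_le_const) auto
qed

lemma extension_eq:
  assumes x: "x \<in> \<K>" and T: "ext_rel \<rho> x T"
  shows "extension \<rho> (cls x) = T"
proof -
  have "ext_rel \<rho> (rep (cls x)) (SOME T. ext_rel \<rho> (rep (cls x)) T)"
    by (rule someI_ex[OF ext_rel_exists[OF rep_cls_cauchy[OF x]]])
  from ext_rel_unique[OF rep_cls[OF x] this T] show ?thesis
    unfolding extension_def using cls_in[OF x] by simp
qed

lemma ext_rel_extension: "x \<in> \<K> \<Longrightarrow> ext_rel \<rho> x (extension \<rho> (cls x))"
  using ext_rel_exists[of x] extension_eq by metis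

lemma extension_to_completion:
  assumes "x \<in> sp_carr X"
  shows "extension \<rho> (to_completion \<A> q x) = \<rho> x"
  unfolding to_completion_eq
proof (rule extension_eq[OF cauchy_const[OF assms]], rule ext_relI)
  show "op_dist (\<rho> x) (\<rho> x) \<le> 0" for n :: nat
    using op_dist_rho[OF assms assms] by (simp only: diff_self q_zero)
qed (use assms \<rho>_closed in auto)

text \<open>Each operation on operators is continuous, so applied to limits it gives a limit of the
  results; as limits are unique, that is the value of the extension.\<close>

lemma extension_hom: "extension \<rho> \<in> star_homs \<C> (bounded_ops H)"
proof -
  have closed: "extension \<rho> (cls x) \<in> \<B>" if "x \<in> \<K>" for x
    using ext_rel_extension[OF that] by (simp add: ext_rel_def)
  have lim: "(\<lambda>n. op_dist (\<rho> (x n)) (extension \<rho> (cls x))) \<longlonglongrightarrow> 0" if "x \<in> \<K>" for x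
    using ext_rel_extension[OF that] by (simp add: ext_rel_def)
  have add: "extension \<rho> (add \<C> (cls x) (cls y))
      = add (bounded_ops H) (extension \<rho> (cls x)) (extension \<rho> (cls y))"
    if x: "x \<in> \<K>" and y: "y \<in> \<K>" for x y
    unfolding add_cls[OF x y]
  proof (rule extension_eq[OF cauchy_add[OF x y]], rule ext_relI)
    show "op_dist (\<rho> (x n + y n)) (add (bounded_ops H) (extension \<rho> (cls x)) (extension \<rho> (cls y)))
        \<le> op_dist (\<rho> (x n)) (extension \<rho> (cls x)) + op_dist (\<rho> (y n)) (extension \<rho> (cls y))" for n
      using star_homsD(2)[OF \<rho> cauchy_carr[OF x] cauchy_carr[OF y], of n n]
        op_dist_add[OF \<rho>_closed[OF cauchy_carr[OF x]] \<rho>_closed[OF cauchy_carr[OF y]] closed[OF x] closed[OF y], of n n]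
      by (simp only: free_star_algebra_simps)
    show "(\<lambda>n. op_dist (\<rho> (x n)) (extension \<rho> (cls x)) + op_dist (\<rho> (y n)) (extension \<rho> (cls y)))
        \<longlonglongrightarrow> 0" by (intro tendsto_add_zero lim x y)
  qed (intro ops_add_closed closed sp_carr_add cauchy_carr x y)+
  have scale: "extension \<rho> (scale \<C> c (cls x)) = scale (bounded_ops H) c (extension \<rho> (cls x))"
    if x: "x \<in> \<K>" for x c
    unfolding scale_cls[OF x]
  proof (rule extension_eq[OF cauchy_scale[OF x]], rule ext_relI)
    show "op_dist (\<rho> (\<lambda>w. c * x n w)) (scale (bounded_ops H) c (extension \<rho> (cls x)))
        \<le> cmod c * op_dist (\<rho> (x n)) (extension \<rho> (cls x))" for n
      using star_homsD(3)[OF \<rho> cauchy_carr[OF x], of c n]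
        op_dist_scale[OF \<rho>_closed[OF cauchy_carr[OF x]] closed[OF x], of c n]
      by (simp only: free_star_algebra_simps)
    show "(\<lambda>n. cmod c * op_dist (\<rho> (x n)) (extension \<rho> (cls x))) \<longlonglongrightarrow> 0"
      by (intro tendsto_mult_right_zero lim x)
  qed (intro ops_scale_closed closed sp_carr_scale cauchy_carr x)+
  have star: "extension \<rho> (star \<C> (cls x)) = adjoint_op H (extension \<rho> (cls x))" if x: "x \<in> \<K>" for x
    unfolding star_cls[OF x]
  proof (rule extension_eq[OF cauchy_star[OF x]], rule ext_relI)
    show "op_dist (\<rho> (sp_star (x n))) (adjoint_op H (extension \<rho> (cls x)))
        \<le> op_dist (\<rho> (x n)) (extension \<rho> (cls x))" for n
      using star_homsD(5)[OF \<rho> cauchy_carr[OF x], of n]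
        op_dist_adjoint[OF \<rho>_closed[OF cauchy_carr[OF x]] closed[OF x], of n]
      by (simp only: free_star_algebra_simps bounded_ops_simps)
    show "(\<lambda>n. op_dist (\<rho> (x n)) (extension \<rho> (cls x))) \<longlonglongrightarrow> 0" by (intro lim x)
  qed (intro adjoint_closed closed sp_carr_star cauchy_carr x)+
  have mult: "extension \<rho> (mult \<C> (cls x) (cls y))
      = compose (hcarr H) (extension \<rho> (cls x)) (extension \<rho> (cls y))"
    if x: "x \<in> \<K>" and y: "y \<in> \<K>" for x y
    unfolding mult_cls[OF x y]
  proof -
    \<comment> \<open>Contractivity is used a second time here: it carries the bound on
      \<open>q (y n)\<close> over to the norms of the operators \<open>\<rho> (y n)\<close>.\<close>
    obtain C where C: "0 \<le> C" "\<And>n. q (y n) \<le> C" using cauchy_bounded[OF y] by blast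
    let ?K = "opnorm (adjoint_op H (extension \<rho> (cls x)))"
    let ?e = "\<lambda>n. op_dist (\<rho> (x n)) (extension \<rho> (cls x)) * C
      + ?K * op_dist (\<rho> (y n)) (extension \<rho> (cls y))"
    show "extension \<rho> (cls (\<lambda>n. x n \<odot> y n))
        = compose (hcarr H) (extension \<rho> (cls x)) (extension \<rho> (cls y))"
    proof (rule extension_eq[OF cauchy_mult[OF x y]], rule ext_relI)
      fix n
      have "op_dist (\<rho> (x n \<odot> y n)) (compose (hcarr H) (extension \<rho> (cls x)) (extension \<rho> (cls y)))
          \<le> op_dist (\<rho> (x n)) (extension \<rho> (cls x)) * opnorm (\<rho> (y n))
            + ?K * op_dist (\<rho> (y n)) (extension \<rho> (cls y))"
        using star_homsD(4)[OF \<rho> cauchy_carr[OF x] cauchy_carr[OF y], of n n]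
          op_dist_mult[OF \<rho>_closed[OF cauchy_carr[OF x]] \<rho>_closed[OF cauchy_carr[OF y]] closed[OF x] closed[OF y], of n n]
        by (simp only: free_star_algebra_simps bounded_ops_simps)
      also have "\<dots> \<le> ?e n"
        by (intro add_right_mono mult_left_mono op_dist_nonneg \<rho>_closed cauchy_carr closed x
            order_trans[OF contractive C(2)] y)
      finally show "op_dist (\<rho> (x n \<odot> y n))
          (compose (hcarr H) (extension \<rho> (cls x)) (extension \<rho> (cls y))) \<le> ?e n" .
    next
      show "?e \<longlonglongrightarrow> 0"
        by (intro tendsto_add_zero tendsto_mult_left_zero tendsto_mult_right_zero lim x y)
    qed (intro ops_mult_closed closed sp_carr_mult cauchy_carr x y)+
  qed
  have "extension \<rho> \<in> extensional (carr \<C>)" by (simp add: extension_def)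
  then show ?thesis
    unfolding star_homs_def bounded_ops_simps PiE_def
    by (auto simp only: carr_completion image_iff add scale star mult closed mem_Collect_eq Int_iff
        Pi_iff bounded_ops_simps intro!: closed)
qed

end

end

section \<open>Automatic continuity of *-homomorphisms on the completion\<close>

context completion_rep
begin

text \<open>A *-homomorphism out of the completion is automatically contractive. If \<open>\<parallel>a\<parallel> < 1\<close>, then
  iterating \<open>d \<mapsto> (a\<^sup>* a + d\<^sup>2)/2\<close> produces a self-adjoint \<open>d\<close> with \<open>1 - a\<^sup>* a = (1 - d)\<^sup>2\<close>, whence
  \<open>\<parallel>\<phi>\<parallel>\<^sup>2 - \<parallel>h(a) \<phi>\<parallel>\<^sup>2 = \<parallel>\<phi> - h(d) \<phi>\<parallel>\<^sup>2 \<ge> 0\<close>.\<close>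

primrec half_iter :: "(nat \<Rightarrow> 'g star_poly) \<Rightarrow> nat \<Rightarrow> 'g star_poly" where
  "half_iter b 0 = 0"
| "half_iter b (Suc n) = (\<lambda>w. (1/2) * (b n + half_iter b n \<odot> half_iter b n) w)"

lemma half_iter_carr: "(\<And>n. b n \<in> sp_carr X) \<Longrightarrow> half_iter b n \<in> sp_carr X"
  by (induction n) (auto intro!: sp_carr_scale sp_carr_add sp_carr_mult simp only: half_iter.simps sp_carr_zero)

lemma half_iter_star:
  assumes "\<And>n. sp_star (b n) = b n"
  shows "sp_star (half_iter b n) = half_iter b n"
proof (induction n)
  case 0
  then show ?case by (simp only: half_iter.simps sp_star_zero)
next
  case (Suc n)
  have "cnj (1/2) = 1/2" by simp
  then show ?case by (simp only: half_iter.simps sp_star_scale sp_star_add sp_star_mult assms Suc)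
qed

text \<open>The bound reproduces itself: half of \<open>\<beta>^2 + \<beta>^2\<close> is
  \<open>\<beta>^2\<close>, which is at most \<beta>.\<close>

lemma half_iter_bound:
  assumes b: "\<And>n. b n \<in> sp_carr X" "\<And>n. q (b n) \<le> \<beta>\<^sup>2" and \<beta>: "0 \<le> \<beta>" "\<beta> \<le> 1"
  shows "q (half_iter b n) \<le> \<beta>"
proof (induction n)
  case 0
  then show ?case using \<beta> by (simp only: half_iter.simps q_zero)
next
  case (Suc n)
  note d = half_iter_carr[OF b(1)]
  have "q (half_iter b (Suc n)) = cmod (1/2) * q (b n + half_iter b n \<odot> half_iter b n)"
    unfolding half_iter.simps by (intro q_scale sp_carr_add sp_carr_mult b d)
  also have "\<dots> \<le> cmod (1/2) * (\<beta>\<^sup>2 + \<beta> * \<beta>)"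
  proof (rule mult_left_mono)
    have "q (b n + half_iter b n \<odot> half_iter b n) \<le> q (b n) + q (half_iter b n \<odot> half_iter b n)"
      by (intro q_add b d sp_carr_mult)
    also have "\<dots> \<le> \<beta>\<^sup>2 + q (half_iter b n) * q (half_iter b n)" by (intro add_mono b q_mult d)
    also have "\<dots> \<le> \<beta>\<^sup>2 + \<beta> * \<beta>" by (intro add_left_mono mult_mono Suc q_nonneg d \<beta>)
    finally show "q (b n + half_iter b n \<odot> half_iter b n) \<le> \<beta>\<^sup>2 + \<beta> * \<beta>" .
  qed simp
  also have "\<dots> = \<beta> * \<beta>" by (simp add: norm_divide power2_eq_square)
  also have "\<dots> \<le> \<beta>" using \<beta> by (simp add: mult_left_le)
  finally show ?case .
qed

text \<open>The difference of two squares of elements bounded by \<beta> costs a factor of at most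
  \<open>2 \<beta>\<close>, and the factor 1/2 of the iteration leaves \<beta>. The other term is
  there because the datum \<open>b\<close> is itself only a sequence of approximations.\<close>

lemma half_iter_step:
  assumes b: "\<And>n. b n \<in> sp_carr X" "\<And>n. q (b n) \<le> \<beta>\<^sup>2" and \<beta>: "0 \<le> \<beta>" "\<beta> \<le> 1"
  shows "q (half_iter b (Suc m) - half_iter b (Suc n))
    \<le> q (b m - b n) / 2 + \<beta> * q (half_iter b m - half_iter b n)"
proof -
  note d = half_iter_carr[OF b(1)]
  let ?d = "half_iter b"
  have "q (b m + ?d m \<odot> ?d m - (b n + ?d n \<odot> ?d n))
      \<le> q (b m - b n) + q (?d m \<odot> ?d m - ?d n \<odot> ?d n)"
    unfolding add_diff_add by (intro q_add sp_carr_diff sp_carr_mult b d)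
  moreover have "q (?d m \<odot> ?d m - ?d n \<odot> ?d n)
      \<le> q (?d m - ?d n) * q (?d m) + q (?d n) * q (?d m - ?d n)"
    by (intro q_mult_diff d)
  moreover have "q (?d m - ?d n) * q (?d m) + q (?d n) * q (?d m - ?d n)
      \<le> q (?d m - ?d n) * \<beta> + \<beta> * q (?d m - ?d n)"
    by (intro add_mono mult_left_mono mult_right_mono half_iter_bound[OF b \<beta>] q_nonneg sp_carr_diff d)
  moreover have "q (?d (Suc m) - ?d (Suc n))
      = cmod (1/2) * q (b m + ?d m \<odot> ?d m - (b n + ?d n \<odot> ?d n))"
    unfolding half_iter.simps sp_scale_diff by (intro q_scale sp_carr_diff sp_carr_add sp_carr_mult b d)
  moreover have "cmod (1/2) = 1/2" by (simp add: norm_divide)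
  ultimately show ?thesis unfolding mult.commute[of _ \<beta>] by simp
qed

text \<open>The iteration runs diagonally, its n-th step using the n-th term of \<open>b\<close>.
  All iterates are thus polynomials, and their sequence directly represents an element of the
  completion.\<close>

lemma half_iter_cauchy:
  assumes b: "b \<in> \<K>" "\<And>n. q (b n) \<le> \<beta>\<^sup>2" and \<beta>: "0 \<le> \<beta>" "\<beta> < 1"
  shows "half_iter b \<in> \<K>"
proof (rule cauchyI)
  note bc = cauchy_carr[OF b(1)]
  have d: "half_iter b n \<in> sp_carr X" for n by (intro half_iter_carr bc)
  show "half_iter b n \<in> sp_carr X" for n by (rule d)
  fix \<epsilon> :: real assume \<epsilon>: "0 < \<epsilon>"
  \<comment> \<open>Chosen so that \<open>\<epsilon> / 2\<close> is preserved by a step: \<open>(1 -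
    \<beta>) * \<epsilon> / 2 + \<beta> * \<epsilon> / 2 = \<epsilon> / 2\<close>.\<close>
  have "0 < (1 - \<beta>) * \<epsilon>" using \<epsilon> \<beta> by simp
  from cauchyD[OF b(1) this] obtain N where N: "\<And>m n. N \<le> m \<Longrightarrow> N \<le> n \<Longrightarrow> q (b m - b n) < (1 - \<beta>) * \<epsilon>"
    by blast
  have bound: "q (half_iter b n) \<le> \<beta>" for n
    by (rule half_iter_bound) (use bc b(2) \<beta> in auto)
  have step_le: "q (half_iter b (Suc m) - half_iter b (Suc n))
      \<le> q (b m - b n) / 2 + \<beta> * q (half_iter b m - half_iter b n)" for m n
    by (rule half_iter_step) (use bc b(2) \<beta> in auto)
  \<comment> \<open>Two iterates are never more than \<open>2 \<beta> <= 2\<close> apart;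
    \<open>k\<close> common steps shrink that by \<open>\<beta> ^ k\<close>, while the varying datum
    adds at most \<open>\<epsilon> / 2\<close> altogether.\<close>
  have step: "q (half_iter b (m + k) - half_iter b (n + k)) \<le> \<beta> ^ k * 2 + \<epsilon> / 2"
    if "N \<le> m" "N \<le> n" for m n k
  proof (induction k)
    case 0
    have "q (half_iter b m - half_iter b n) \<le> q (half_iter b m) + q (half_iter b n)"
      using q_triangle[OF d[of m] sp_carr_zero d[of n]] q_minus_commute[OF d[of n] sp_carr_zero]
      by (simp only: diff_0_right)
    then show ?case
      unfolding power_0 add_0_right using bound[of m] bound[of n] \<beta> \<epsilon> by linarith
  next
    case (Suc k)
    have "q (half_iter b (m + Suc k) - half_iter b (n + Suc k))
        \<le> q (b (m + k) - b (n + k)) / 2 + \<beta> * q (half_iter b (m + k) - half_iter b (n + k))"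
      using step_le[of "m + k" "n + k"] by (simp only: add_Suc_right)
    also have "\<dots> \<le> (1 - \<beta>) * \<epsilon> / 2 + \<beta> * (\<beta> ^ k * 2 + \<epsilon> / 2)"
      using that by (intro add_mono divide_right_mono mult_left_mono Suc \<beta> less_imp_le[OF N]) auto
    also have "\<dots> = \<beta> ^ Suc k * 2 + \<epsilon> / 2" by (simp add: field_simps)
    finally show ?case .
  qed
  obtain k where k: "\<beta> ^ k < \<epsilon> / 4" using real_arch_pow_inv[of "\<epsilon>/4" \<beta>] \<epsilon> \<beta> by auto
  have "q (half_iter b m - half_iter b n) < \<epsilon>" if "N + k \<le> m" "N + k \<le> n" for m n
  proof -
    have "N \<le> m - k" "N \<le> n - k" using that by simp_all
    from step[OF this, of k] show ?thesis using that k by simp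
  qed
  then show "\<exists>N. \<forall>m\<ge>N. \<forall>n\<ge>N. q (half_iter b m - half_iter b n) < \<epsilon>" by blast
qed

text \<open>The bound is imposed on every term of the representing sequence, and not on the norm of
  its class, because the iteration takes place on the terms.\<close>

lemma star_hom_contractive:
  assumes h: "h \<in> star_homs \<C> (bounded_ops H)"
    and a: "a \<in> \<K>" "\<And>n. q (a n) \<le> \<beta>" and \<beta>: "\<beta> < 1" and x: "x \<in> hcarr H"
  shows "hnorm H (h (cls a) x) \<le> hnorm H x"
proof -
  note hs = star_homsD[OF h]
  have \<beta>0: "0 \<le> \<beta>" using order_trans[OF q_nonneg[OF cauchy_carr[OF a(1)]] a(2)] .
  define b where "b n = sp_star (a n) \<odot> a n" for n
  have b: "b \<in> \<K>" unfolding b_def by (intro cauchy_mult cauchy_star a)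
  have qb: "q (b n) \<le> \<beta>\<^sup>2" for n
    unfolding b_def q_star_mult[OF cauchy_carr[OF a(1)]]
    by (intro power_mono a(2) q_nonneg cauchy_carr[OF a(1)])
  define d where "d = half_iter b"
  have d: "d \<in> \<K>" unfolding d_def by (rule half_iter_cauchy[OF b qb \<beta>0 \<beta>])
  have "sp_star (d n) = d n" for n
    unfolding d_def by (rule half_iter_star) (simp only: b_def sp_star_mult sp_star_star)
  then have star_d: "star \<C> (cls d) = cls d" using star_cls[OF d] by simp
  have dd: "(\<lambda>n. d n \<odot> d n) \<in> \<K>" "(\<lambda>n. b n + d n \<odot> d n) \<in> \<K>"
    by (intro cauchy_add cauchy_mult b d)+
  have "scale \<C> (1/2) (add \<C> (cls b) (mult \<C> (cls d) (cls d)))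
      = cls (\<lambda>n w. (1/2) * (b n + d n \<odot> d n) w)"
    by (simp only: mult_cls d add_cls b dd scale_cls)
  \<comment> \<open>The recursion yields the sequence shifted by one, which has the same class:
    \<open>cls d\<close> solves the quadratic equation exactly.\<close>
  also have "\<dots> = cls (\<lambda>n. d (n + 1))" by (simp add: d_def)
  also have "\<dots> = cls d" by (rule cauchy_shift[OF d])
  finally have rel: "scale \<C> (1/2) (add \<C> (cls b) (mult \<C> (cls d) (cls d))) = cls d" .
  have cls_b: "cls b = mult \<C> (star \<C> (cls a)) (cls a)"
    unfolding b_def by (simp only: star_cls mult_cls a cauchy_star)
  define S where "S = h (cls a)"
  define T where "T = h (cls d)"
  have S: "S \<in> \<B>" and T: "T \<in> \<B>"
    using hs(1)[OF cls_in[OF a(1)]] hs(1)[OF cls_in[OF d]] by (simp_all add: S_def T_def)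
  have adj: "adjoint_op H T = T" using hs(5)[OF cls_in[OF d]] star_d by (simp add: T_def)
  have in_C: "cls a \<in> carr \<C>" "cls b \<in> carr \<C>" "star \<C> (cls a) \<in> carr \<C>"
    "mult \<C> (cls d) (cls d) \<in> carr \<C>" "add \<C> (cls b) (mult \<C> (cls d) (cls d)) \<in> carr \<C>"
    by (simp_all only: mult_cls d add_cls b dd star_cls a cauchy_star cls_in)
  have "h (cls b) = compose (hcarr H) (adjoint_op H S) S"
    unfolding cls_b S_def using hs(4)[OF in_C(3,1)] hs(5)[OF in_C(1)] by (simp only: bounded_ops_simps)
  then have "T = scale (bounded_ops H) (1/2)
      (add (bounded_ops H) (compose (hcarr H) (adjoint_op H S) S) (compose (hcarr H) T T))"
    using arg_cong[OF rel, of h] hs(3)[OF in_C(5), of "1/2"] hs(2)[OF in_C(2,4)]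
      hs(4)[OF cls_in[OF d] cls_in[OF d]] unfolding T_def by (simp only: bounded_ops_simps)
  \<comment> \<open>Paired with \<open>x\<close>, the equation says that twice the inner product of
    \<open>T x\<close> and \<open>x\<close> is \<open>|S x|^2 + |T x|^2\<close>. Completing the
    square gives \<open>|x - T x|^2 = |x|^2 - |S x|^2\<close>; the identity subtracted from here
    acts on vectors and need not belong to the algebra.\<close>
  then have "hinner H (T x) x = hinner H (scale (bounded_ops H) (1/2)
      (add (bounded_ops H) (compose (hcarr H) (adjoint_op H S) S) (compose (hcarr H) T T)) x) x" by simp
  also have "\<dots> = (1/2) * (hinner H (adjoint_op H S (S x)) x + hinner H (T (T x)) x)"
    using S T x by (simp add: compose_eq)
  also have "hinner H (T (T x)) x = hinner H (T x) (T x)"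
    using inner_adjoint_left[OF T op_apply[OF T x] x] adj by simp
  also have "hinner H (adjoint_op H S (S x)) x = hinner H (S x) (S x)"
    using S x by (simp add: inner_adjoint_left)
  finally have "Re (hinner H (T x) x)
      = Re ((1/2) * (hinner H (S x) (S x) + hinner H (T x) (T x)))" by (rule arg_cong)
  then have "Re (hinner H (T x) x) = ((hnorm H (S x))\<^sup>2 + (hnorm H (T x))\<^sup>2) / 2"
    using S T x by (simp add: Re_inner_self)
  moreover have "0 \<le> (hnorm H (hadd H x (hscale H (-1) (T x))))\<^sup>2" by simp
  moreover have "(hnorm H (hadd H x (hscale H (-1) (T x))))\<^sup>2
      = (hnorm H x)\<^sup>2 - 2 * Re (hinner H (T x) x) + (hnorm H (T x))\<^sup>2"
    using T x by (simp add: hnorm_add_power2 hnorm_scale inner_commute[of "T x" x])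
  ultimately have "(hnorm H (S x))\<^sup>2 \<le> (hnorm H x)\<^sup>2" by (simp add: field_simps)
  then show ?thesis unfolding S_def[symmetric] by (rule power2_le_imp_le) (rule hnorm_nonneg[OF x])
qed

text \<open>Scaling by \<open>1 / (2 * \<delta>)\<close> brings all terms down to 1/2, strictly
  below the 1 that contractivity demands; this is the origin of the factor 2, harmless since
  \<delta> is going to be arbitrarily small.\<close>

lemma star_hom_bounded:
  assumes h: "h \<in> star_homs \<C> (bounded_ops H)"
    and a: "a \<in> \<K>" "\<And>n. q (a n) \<le> \<delta>" and \<delta>: "0 < \<delta>" and x: "x \<in> hcarr H"
  shows "hnorm H (h (cls a) x) \<le> 2 * \<delta> * hnorm H x"
proof -
  let ?c = "complex_of_real (1 / (2 * \<delta>))"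
  have c: "cmod ?c = 1 / (2 * \<delta>)" using \<delta> by (simp only: norm_of_real) simp
  have "hnorm H (h (cls (\<lambda>n w. ?c * a n w)) x) \<le> hnorm H x"
  proof (rule star_hom_contractive[OF h cauchy_scale[OF a(1)] _ _ x])
    show "q (\<lambda>w. ?c * a n w) \<le> 1/2" for n
      using a(2)[of n] \<delta> unfolding q_scale[OF cauchy_carr[OF a(1)]] c by (simp add: field_simps)
  qed simp
  also have "h (cls (\<lambda>n w. ?c * a n w)) = scale (bounded_ops H) ?c (h (cls a))"
    using star_homsD(3)[OF h cls_in[OF a(1)], of ?c] by (simp only: scale_cls[OF a(1)])
  finally have "cmod ?c * hnorm H (h (cls a) x) \<le> hnorm H x"
    using star_homsD(1)[OF h cls_in[OF a(1)]] x by (simp only: bounded_ops_simps hnorm_scale op_apply)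
  then show ?thesis unfolding c using \<delta> by (simp add: field_simps)
qed

text \<open>Agreement on generators extends to all polynomials by algebra alone. A general class is
  a constant sequence of one polynomial plus a remainder as small as desired, on which boundedness
  makes both homomorphisms small.\<close>

theorem completion_homs_eqI:
  assumes h: "h \<in> star_homs \<C> (bounded_ops H)" and k: "k \<in> star_homs \<C> (bounded_ops H)"
    and "X \<noteq> {}"
    and gen: "\<And>g. g \<in> X \<Longrightarrow> h (to_completion \<A> q (sp_var g)) = k (to_completion \<A> q (sp_var g))"
  shows "h = k"
proof (rule extensionalityI[OF star_homsD(6)[OF h] star_homsD(6)[OF k]])
  let ?\<iota> = "restrict (to_completion \<A> q) (sp_carr X)"
  have "compose (sp_carr X) f ?\<iota> \<in> star_homs \<A> (bounded_ops H)" if "f \<in> star_homs \<C> (bounded_ops H)" for f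
    by (rule star_homs_compose[OF to_completion_hom that]) (simp_all only: free_star_algebra_simps
        sp_carr_add sp_carr_scale sp_carr_mult sp_carr_star)
  from star_homs_free_eqI[OF this[OF h] this[OF k] \<open>X \<noteq> {}\<close>]
  have "compose (sp_carr X) h ?\<iota> = compose (sp_carr X) k ?\<iota>" using gen by (simp add: compose_eq)
  note eq = this
  have agree: "h (cls (\<lambda>n. y)) = k (cls (\<lambda>n. y))" if "y \<in> sp_carr X" for y
    using fun_cong[OF eq, of y] that by (simp add: compose_eq to_completion_eq)
  fix Y assume "Y \<in> carr \<C>"
  then obtain a where a: "a \<in> \<K>" "Y = cls a" by (auto simp: carr_completion)
  have hY: "h Y \<in> \<B>" and kY: "k Y \<in> \<B>"
    using star_homsD(1)[OF h] star_homsD(1)[OF k] \<open>Y \<in> carr \<C>\<close> by auto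
  show "h Y = k Y"
  proof (rule extensionalityI[OF op_extensional[OF hY] op_extensional[OF kY]])
    fix x assume x: "x \<in> hcarr H"
    let ?D = "hadd H (h Y x) (hscale H (-1) (k Y x))"
    have D: "?D \<in> hcarr H" using hY kY x by auto
    have "hnorm H ?D \<le> \<delta> * (4 * hnorm H x)" if \<delta>: "0 < \<delta>" for \<delta>
    proof -
      obtain N where N: "\<And>m n. N \<le> m \<Longrightarrow> N \<le> n \<Longrightarrow> q (a m - a n) < \<delta>"
        using cauchyD[OF a(1) \<delta>] by blast
      \<comment> \<open>The tail is used so that every term of the remainder, and not just almost
        all, is below \<delta>, as \<open>star_hom_bounded\<close> requires.\<close>
      define e where "e n = a (n + N) - a N" for n
      have aN: "a N \<in> sp_carr X" "(\<lambda>n. a N) \<in> \<K>" by (intro cauchy_const cauchy_carr a)+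
      have "(\<lambda>n. a (n + N) + (\<lambda>w. -1 * a N w)) \<in> \<K>"
        by (rule cauchy_add[OF cauchy_shift(1)[OF a(1)] cauchy_const[OF sp_carr_scale[OF aN(1)]]])
      then have e: "e \<in> \<K>" unfolding e_def sp_diff_eq .
      have "add \<C> (cls e) (cls (\<lambda>n. a N)) = cls (\<lambda>n. e n + a N)" by (rule add_cls[OF e aN(2)])
      also have "\<dots> = Y" using cauchy_shift(2)[OF a(1), of N] by (simp add: e_def a(2))
      finally have Y: "Y = add \<C> (cls e) (cls (\<lambda>n. a N))" ..
      let ?z = "h (cls (\<lambda>n. a N)) x"
      have split: "f Y = add (bounded_ops H) (f (cls e)) (f (cls (\<lambda>n. a N)))"
        if "f \<in> star_homs \<C> (bounded_ops H)" for f
        unfolding Y by (rule star_homsD(2)[OF that cls_in[OF e] cls_in[OF aN(2)]])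
      have hY': "h Y x = hadd H (h (cls e) x) ?z" using split[OF h] x by simp
      have kY': "k Y x = hadd H (k (cls e) x) ?z" using split[OF k] x agree[OF aN(1)] by simp
      have ops: "h (cls e) x \<in> hcarr H" "k (cls e) x \<in> hcarr H" "?z \<in> hcarr H"
        using star_homsD(1)[OF h cls_in[OF e]] star_homsD(1)[OF k cls_in[OF e]]
          star_homsD(1)[OF h cls_in[OF aN(2)]] x by auto
      \<comment> \<open>The common value on the constant part cancels. What remains is at most
        \<open>2 * \<delta>\<close> times the norm of \<open>x\<close> for each homomorphism, hence
        the factor 4.\<close>
      have "?D = hadd H (h (cls e) x) (hscale H (-1) (k (cls e) x))"
        unfolding hY' kY' using ops by (intro hilbert_eqI) auto
      then have "hnorm H ?D \<le> hnorm H (h (cls e) x) + hnorm H (k (cls e) x)"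
        using hnorm_triangle[of "h (cls e) x" "hscale H (-1) (k (cls e) x)"] ops by (simp add: hnorm_scale)
      moreover have "q (e n) \<le> \<delta>" for n unfolding e_def by (rule less_imp_le[OF N]) auto
      ultimately show ?thesis
        using star_hom_bounded[OF h e _ \<delta> x] star_hom_bounded[OF k e _ \<delta> x] by simp
    qed
    then have "hnorm H ?D \<le> 0"
    proof -
      assume *: "\<And>\<delta>. 0 < \<delta> \<Longrightarrow> hnorm H ?D \<le> \<delta> * (4 * hnorm H x)"
      show ?thesis
      proof (rule field_le_epsilon)
        fix \<epsilon> :: real assume \<epsilon>: "0 < \<epsilon>"
        have "0 < 4 * hnorm H x + 1" using hnorm_nonneg[OF x] by simp
        then have "hnorm H ?D \<le> \<epsilon> / (4 * hnorm H x + 1) * (4 * hnorm H x)" using \<epsilon> by (intro *) simp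
        also have "\<dots> \<le> \<epsilon>" using \<epsilon> hnorm_nonneg[OF x] by (simp add: field_simps)
        finally show "hnorm H ?D \<le> 0 + \<epsilon>" by simp
      qed
    qed
    then have "hnorm H ?D = 0" using hnorm_nonneg[OF D] by simp
    then show "h Y x = k Y x" using hY kY x by (intro inner_definite) auto
  qed
qed

end

section \<open>Suprema of C*-seminorms and uniform bounds on them\<close>

lemma cstar_seminorm_SUP:
  fixes A :: "('a, 'm) star_algebra_scheme" and Q :: "('a \<Rightarrow> real) set"
  assumes "Q \<noteq> {}" and Q: "\<And>q. q \<in> Q \<Longrightarrow> cstar_seminorm A q"
    and bdd: "\<And>x. x \<in> carr A \<Longrightarrow> bdd_above ((\<lambda>q. q x) ` Q)"
    and closed: "\<And>x y. x \<in> carr A \<Longrightarrow> y \<in> carr A \<Longrightarrow> add A x y \<in> carr A"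
      "\<And>c x. x \<in> carr A \<Longrightarrow> scale A c x \<in> carr A"
      "\<And>x y. x \<in> carr A \<Longrightarrow> y \<in> carr A \<Longrightarrow> mult A x y \<in> carr A"
      "\<And>x. x \<in> carr A \<Longrightarrow> star A x \<in> carr A"
  shows "cstar_seminorm A (\<lambda>x. SUP q\<in>Q. q x)"
proof -
  define s where "s x = (SUP q\<in>Q. q x)" for x
  have upper: "q x \<le> s x" if "q \<in> Q" "x \<in> carr A" for q x
    unfolding s_def by (rule cSUP_upper[OF that(1) bdd[OF that(2)]])
  have least: "s x \<le> C" if "\<And>q. q \<in> Q \<Longrightarrow> q x \<le> C" for x C
    unfolding s_def by (rule cSUP_least[OF \<open>Q \<noteq> {}\<close> that])
  have nn: "0 \<le> q x" and add: "y \<in> carr A \<Longrightarrow> q (add A x y) \<le> q x + q y"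
    and scale: "q (scale A c x) = cmod c * q x" and mult: "y \<in> carr A \<Longrightarrow> q (mult A x y) \<le> q x * q y"
    and star: "q (mult A (star A x) x) = (q x)\<^sup>2"
    if "q \<in> Q" "x \<in> carr A" for q x y c
    using Q[OF that(1)] that(2) unfolding cstar_seminorm_def by auto
  have s_nn: "0 \<le> s x" if "x \<in> carr A" for x
    using \<open>Q \<noteq> {}\<close> nn upper that by (meson ex_in_conv order_trans)
  have "s (add A x y) \<le> s x + s y" if "x \<in> carr A" "y \<in> carr A" for x y
    using that add upper by (intro least) (meson add_mono order_trans)
  moreover have "s (scale A c x) = cmod c * s x" if x: "x \<in> carr A" for c x
  proof (rule antisym)
    show "s (scale A c x) \<le> cmod c * s x"
      using x upper by (intro least) (simp add: scale mult_left_mono)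
    show "cmod c * s x \<le> s (scale A c x)"
    proof (cases "c = 0")
      case True
      then show ?thesis using s_nn[OF closed(2)[OF x]] by simp
    next
      case False
      have "s x \<le> s (scale A c x) / cmod c"
      proof (rule least)
        fix q assume "q \<in> Q"
        then show "q x \<le> s (scale A c x) / cmod c"
          using upper[OF _ closed(2)[OF x], of q c] scale[of q x c] x False
          by (simp add: pos_le_divide_eq mult.commute)
      qed
      then show ?thesis using False by (simp add: pos_le_divide_eq mult.commute)
    qed
  qed
  moreover have "s (mult A x y) \<le> s x * s y" if "x \<in> carr A" "y \<in> carr A" for x y
  proof (rule least)
    fix q assume q: "q \<in> Q"
    have "q x * q y \<le> s x * s y" by (intro mult_mono upper nn s_nn q that)
    then show "q (mult A x y) \<le> s x * s y" using mult[OF q that] by linarith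
  qed
  \<comment> \<open>Squaring is monotone on nonnegative reals and so commutes with the supremum; one
    inequality is direct, the other is obtained by taking roots under the supremum.\<close>
  moreover have "s (mult A (star A x) x) = (s x)\<^sup>2" if x: "x \<in> carr A" for x
  proof (rule antisym)
    have xx: "mult A (star A x) x \<in> carr A" by (intro closed x)
    show "s (mult A (star A x) x) \<le> (s x)\<^sup>2"
    proof (rule least)
      fix q assume q: "q \<in> Q"
      show "q (mult A (star A x) x) \<le> (s x)\<^sup>2"
        unfolding star[OF q x] by (intro power_mono upper nn q x)
    qed
    have "s x \<le> sqrt (s (mult A (star A x) x))"
    proof (rule least)
      fix q assume q: "q \<in> Q"
      show "q x \<le> sqrt (s (mult A (star A x) x))"
        using upper[OF q xx] unfolding star[OF q x] by (rule real_le_rsqrt)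
    qed
    then have "(s x)\<^sup>2 \<le> (sqrt (s (mult A (star A x) x)))\<^sup>2" by (intro power_mono s_nn x)
    then show "(s x)\<^sup>2 \<le> s (mult A (star A x) x)" using s_nn[OF xx] by simp
  qed
  ultimately show ?thesis using s_nn unfolding cstar_seminorm_def s_def by blast
qed

context sp_cstar_seminorm
begin

text \<open>The right-hand side does not depend on \<open>q\<close>, so it bounds a whole family of
  seminorms at each point. It follows from submultiplicativity, which bounds every monomial by
  1.\<close>

lemma q_le_sum_coeffs:
  assumes gen: "\<And>g. g \<in> X \<Longrightarrow> q (sp_var g) \<le> 1" and x: "x \<in> sp_carr X"
  shows "q x \<le> (\<Sum>w | x w \<noteq> 0. cmod (x w))"
proof -
  have letter: "q (sp_mono [l]) \<le> 1" if "fst l \<in> X" for l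
  proof (cases l)
    case (Pair g b)
    then have g: "g \<in> X" using that by simp
    have "sp_mono [l] = (if b then sp_star (sp_var g) else sp_var g)"
      by (simp add: Pair sp_var_eq_mono sp_star_mono)
    then show ?thesis using gen[OF g] q_star[OF sp_carr_var[OF g]] by simp
  qed
  have mono: "q (sp_mono w) \<le> 1" if "w \<noteq> []" "fst ` set w \<subseteq> X" for w
    using that
  proof (induction w rule: list_nonempty_induct)
    case (single l)
    then show ?case using letter by simp
  next
    case (cons l w)
    then have c: "sp_mono [l] \<in> sp_carr X" "sp_mono w \<in> sp_carr X" by (auto intro: sp_carr_mono)
    have "sp_mono (l # w) = sp_mono [l] \<odot> sp_mono w" by (simp add: sp_mult_mono)
    then have "q (sp_mono (l # w)) \<le> q (sp_mono [l]) * q (sp_mono w)" using q_mult[OF c] by simp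
    also have "\<dots> \<le> 1 * 1" using cons letter by (intro mult_mono q_nonneg c) auto
    finally show ?case by simp
  qed
  show ?thesis using x
  proof (induction rule: sp_carr_induct)
    case zero
    show ?case unfolding q_zero by (intro sum_nonneg) simp
  next
    case (add x c u)
    have "q (x + (\<lambda>w. c * sp_mono u w)) \<le> q x + cmod c * q (sp_mono u)"
      using q_add[OF add.hyps(1) sp_carr_scale[OF sp_carr_mono], of u c]
        q_scale[OF sp_carr_mono, of u c] add.hyps by simp
    also have "\<dots> \<le> (\<Sum>w | x w \<noteq> 0. cmod (x w)) + cmod c * 1"
      using add by (intro add_mono mult_left_mono mono) auto
    also have "\<dots> = (\<Sum>w\<in>insert u {w. x w \<noteq> 0}. cmod ((x + (\<lambda>w. c * sp_mono u w)) w))"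
    proof -
      have "finite {w. x w \<noteq> 0}" "u \<notin> {w. x w \<noteq> 0}" using add by (auto simp: sp_carr_iff)
      moreover have "(\<Sum>w | x w \<noteq> 0. cmod ((x + (\<lambda>w. c * sp_mono u w)) w)) = (\<Sum>w | x w \<noteq> 0. cmod (x w))"
        using add by (intro sum.cong) (auto simp: sp_mono_def)
      ultimately show ?thesis using add by (simp add: sp_mono_def)
    qed
    also have "\<dots> = (\<Sum>w | (x + (\<lambda>w. c * sp_mono u w)) w \<noteq> 0. cmod ((x + (\<lambda>w. c * sp_mono u w)) w))"
      using add by (intro sum.mono_neutral_right) (auto simp: sp_mono_def sp_carr_iff split: if_splits)
    finally show ?case .
  qed
qed

end

section \<open>The universal norm of an ultragraph\<close>

abbreviation ug_gens :: "('v, 'e) ultragraph \<Rightarrow> ('v, 'e) gen set" where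
  "ug_gens G \<equiv> Edge ` edges G \<union> GVert ` gverts G"

lemma src_in_verts: "is_ultragraph G \<Longrightarrow> e \<in> edges G \<Longrightarrow> src G e \<in> verts G"
  by (auto simp: is_ultragraph_def)

definition ug_seminorms :: "('v, 'e) ultragraph \<Rightarrow> (('v, 'e) gen star_poly \<Rightarrow> real) set" where
  "ug_seminorms G = {q. cstar_seminorm (ug_free G) q \<and> (\<forall>t\<in>relators G. q t = 0)}"

lemma ug_norm_eq: "ug_norm G x = (SUP q\<in>ug_seminorms G. q x)"
  unfolding ug_norm_def ug_seminorms_def by (rule arg_cong[where f = Sup]) blast

text \<open>Modulo elements of seminorm 0, \<open>pV A\<close> equals both its adjoint and its
  square, so the C*-identity makes \<open>q (pV A)\<close> a solution of \<open>r^2 = r\<close>,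
  hence 0 or 1. For an edge, the source projection relation gives
  \<open>q (sE e)^2 = q (pV (rng G e))\<close>.\<close>

lemma ug_seminorms_gen_le_1:
  assumes q: "q \<in> ug_seminorms G" and g: "g \<in> ug_gens G"
  shows "q (sp_var g) \<le> 1"
proof -
  interpret sp_cstar_seminorm "ug_gens G" q
    by standard (use q in \<open>simp add: ug_seminorms_def ug_free_def\<close>)
  have vanish: "q t = 0" if "t \<in> relators G" for t using q that by (simp add: ug_seminorms_def)
  have eq_if: "q x = q y" if "q (x - y) = 0" "x \<in> sp_carr (ug_gens G)" "y \<in> sp_carr (ug_gens G)" for x y
    using q_diff_le[OF that(2,3)] q_diff_le[OF that(3,2)] q_minus_commute[OF that(2,3)] that(1) by simp
  have le_1: "r \<le> 1" if "r\<^sup>2 = r" for r :: real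
    using that by (cases "r = 0") (auto simp: power2_eq_square)
  have p_in: "pV A \<in> sp_carr (ug_gens G)" if "A \<in> gverts G" for A
    by (rule sp_carr_var) (use that in simp)
  have p: "q (pV A) \<le> 1" if A: "A \<in> gverts G" for A
  proof (rule le_1)
    note c = p_in[OF A]
    have "q (sp_star (pV A) \<odot> pV A - pV A \<odot> pV A) \<le> q (sp_star (pV A) - pV A) * q (pV A) + q (pV A) * q (pV A - pV A)"
      by (intro q_mult_diff sp_carr_star c)
    also have "\<dots> = 0" using vanish[OF relators.proj_selfadjoint[OF A]] by (simp only: diff_self q_zero)
    finally have "q (sp_star (pV A) \<odot> pV A) = q (pV A \<odot> pV A)"
      using q_nonneg[of "sp_star (pV A) \<odot> pV A - pV A \<odot> pV A"] c
      by (intro eq_if) (simp_all only: sp_carr_star sp_carr_mult sp_carr_diff order_antisym)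
    also have "\<dots> = q (pV A)"
      by (intro eq_if vanish[OF relators.proj_idempotent[OF A]] sp_carr_mult c)
    finally show "(q (pV A))\<^sup>2 = q (pV A)" by (simp only: q_star_mult[OF c])
  qed
  have s: "q (sE e) \<le> 1" if e: "e \<in> edges G" for e
  proof -
    have c: "sE e \<in> sp_carr (ug_gens G)" by (rule sp_carr_var) (use e in simp)
    have r: "rng G e \<in> gverts G" using e by (rule gverts.range)
    have "(q (sE e))\<^sup>2 = q (pV (rng G e))"
      unfolding q_star_mult[OF c, symmetric]
      by (intro eq_if vanish[OF relators.source_projection[OF e]] sp_carr_mult sp_carr_star c p_in r)
    then have "(q (sE e))\<^sup>2 \<le> 1\<^sup>2" using p[OF r] by simp
    then show ?thesis by (rule power2_le_imp_le) simp
  qed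
  show ?thesis using g p s by auto
qed

lemma ug_seminorms_bdd:
  assumes "x \<in> sp_carr (ug_gens G)"
  shows "bdd_above ((\<lambda>q. q x) ` ug_seminorms G)"
proof (rule bdd_aboveI2)
  fix q assume q: "q \<in> ug_seminorms G"
  interpret sp_cstar_seminorm "ug_gens G" q
    by standard (use q in \<open>simp add: ug_seminorms_def ug_free_def\<close>)
  show "q x \<le> (\<Sum>w | x w \<noteq> 0. cmod (x w))"
    by (rule q_le_sum_coeffs[OF ug_seminorms_gen_le_1[OF q] assms])
qed

lemma ug_norm_upper:
  "q \<in> ug_seminorms G \<Longrightarrow> x \<in> sp_carr (ug_gens G) \<Longrightarrow> q x \<le> ug_norm G x"
  unfolding ug_norm_eq by (intro cSUP_upper ug_seminorms_bdd)

lemma cstar_seminorm_ug_norm: "cstar_seminorm (free_star_algebra (ug_gens G)) (ug_norm G)"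
proof -
  have "(\<lambda>x. 0) \<in> ug_seminorms G" by (simp add: ug_seminorms_def cstar_seminorm_def)
  then have "cstar_seminorm (free_star_algebra (ug_gens G)) (\<lambda>x. SUP q\<in>ug_seminorms G. q x)"
    by (intro cstar_seminorm_SUP ug_seminorms_bdd) (auto simp: ug_seminorms_def ug_free_def)
  then show ?thesis by (simp add: ug_norm_eq[abs_def])
qed

section \<open>Operators on classes induced by operations on functions\<close>

interpretation l2: hilbert_space "l2 M" for M
  by (rule hilbert_space_l2)

lemma l2_op_eqI:
  assumes "S \<in> bounded_ops_carr (l2 M)" "T \<in> bounded_ops_carr (l2 M)"
    and "\<And>\<phi>. \<phi> \<in> l2_funs M \<Longrightarrow> S (l2_class M \<phi>) = T (l2_class M \<phi>)"
  shows "S = T"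
  by (rule extensionalityI[OF l2.op_extensional[OF assms(1)] l2.op_extensional[OF assms(2)]])
    (use assms(3) in \<open>auto simp: hcarr_l2\<close>)

definition l2_lift :: "'x measure \<Rightarrow> (('x \<Rightarrow> complex) \<Rightarrow> 'x \<Rightarrow> complex) \<Rightarrow>
    ('x \<Rightarrow> complex) set \<Rightarrow> ('x \<Rightarrow> complex) set" where
  "l2_lift M L = (\<lambda>Y\<in>hcarr (l2 M). l2_class M (L (rep Y)))"

lemma l2_lift_class:
  assumes "\<And>\<phi>. \<phi> \<in> l2_funs M \<Longrightarrow> L \<phi> \<in> l2_funs M"
    and "\<And>\<phi> \<psi>. AE x in M. \<phi> x = \<psi> x \<Longrightarrow> AE x in M. L \<phi> x = L \<psi> x"
    and "\<phi> \<in> l2_funs M"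
  shows "l2_lift M L (l2_class M \<phi>) = l2_class M (L \<phi>)"
proof -
  have "l2_class M (L (rep (l2_class M \<phi>))) = l2_class M (L \<phi>)"
    by (subst l2_class_eq_iff) (intro assms rep_l2_class)+
  then show ?thesis using l2_class_in[OF assms(3)] by (simp add: l2_lift_def)
qed

lemma l2_lift_bounded:
  assumes closed: "\<And>\<phi>. \<phi> \<in> l2_funs M \<Longrightarrow> L \<phi> \<in> l2_funs M"
    and cong: "\<And>\<phi> \<psi>. AE x in M. \<phi> x = \<psi> x \<Longrightarrow> AE x in M. L \<phi> x = L \<psi> x"
    and add: "\<And>\<phi> \<psi>. L (\<lambda>x. \<phi> x + \<psi> x) = (\<lambda>x. L \<phi> x + L \<psi> x)"
    and scale: "\<And>c \<phi>. L (\<lambda>x. c * \<phi> x) = (\<lambda>x. c * L \<phi> x)"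
    and contr: "\<And>\<phi>. \<phi> \<in> l2_funs M \<Longrightarrow>
      (\<integral>\<^sup>+x. ennreal ((cmod (L \<phi> x))\<^sup>2) \<partial>M) \<le> (\<integral>\<^sup>+x. ennreal ((cmod (\<phi> x))\<^sup>2) \<partial>M)"
  shows "l2_lift M L \<in> bounded_ops_carr (l2 M)"
proof (rule l2.bounded_opsI)
  note lift = l2_lift_class[of M L, OF closed cong]
  show "l2_lift M L \<in> extensional (hcarr (l2 M))" by (simp add: l2_lift_def)
  fix Y assume "Y \<in> hcarr (l2 M)"
  then obtain \<phi> where \<phi>: "\<phi> \<in> l2_funs M" "Y = l2_class M \<phi>" by (auto simp: hcarr_l2)
  show "l2_lift M L Y \<in> hcarr (l2 M)" using \<phi> by (simp add: lift closed l2_class_in)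
  show "l2_lift M L (hscale (l2 M) c Y) = hscale (l2 M) c (l2_lift M L Y)" for c
    using \<phi> by (simp add: hscale_l2_class lift closed l2_funs_scale scale)
  have "ennreal ((hnorm (l2 M) (l2_class M (L \<phi>)))\<^sup>2) \<le> ennreal ((hnorm (l2 M) (l2_class M \<phi>))\<^sup>2)"
    using contr[OF \<phi>(1)] nn_integral_l2[OF \<phi>(1)] nn_integral_l2[OF closed[OF \<phi>(1)]] by simp
  then have "(hnorm (l2 M) (l2_class M (L \<phi>)))\<^sup>2 \<le> (hnorm (l2 M) (l2_class M \<phi>))\<^sup>2"
    by (subst (asm) ennreal_le_iff) auto
  then have "hnorm (l2 M) (l2_class M (L \<phi>)) \<le> hnorm (l2 M) (l2_class M \<phi>)"
    by (rule power2_le_imp_le) (intro l2.hnorm_nonneg l2_class_in \<phi>)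
  then show "hnorm (l2 M) (l2_lift M L Y) \<le> 1 * hnorm (l2 M) Y" using \<phi> by (simp add: lift)
  fix Z assume "Z \<in> hcarr (l2 M)"
  then obtain \<psi> where \<psi>: "\<psi> \<in> l2_funs M" "Z = l2_class M \<psi>" by (auto simp: hcarr_l2)
  show "l2_lift M L (hadd (l2 M) Y Z) = hadd (l2 M) (l2_lift M L Y) (l2_lift M L Z)"
    using \<phi> \<psi> by (simp add: hadd_l2_class lift closed l2_funs_add add)
qed

definition mul_op :: "'x measure \<Rightarrow> 'x set \<Rightarrow> ('x \<Rightarrow> complex) set \<Rightarrow> ('x \<Rightarrow> complex) set" where
  "mul_op M A = l2_lift M (\<lambda>\<phi> x. indicator A x * \<phi> x)"

lemma l2_funs_indicator:
  assumes "A \<in> sets M" "\<phi> \<in> l2_funs M"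
  shows "(\<lambda>x. indicator A x * \<phi> x) \<in> l2_funs M"
proof -
  have "(\<lambda>x. indicator A x * \<phi> x) \<in> borel_measurable M"
    using assms by (intro borel_measurable_times borel_measurable_indicator l2_funs_measurable)
  moreover have "(\<integral>\<^sup>+x. ennreal ((cmod (indicator A x * \<phi> x))\<^sup>2) \<partial>M)
      \<le> (\<integral>\<^sup>+x. ennreal ((cmod (\<phi> x))\<^sup>2) \<partial>M)"
    by (intro nn_integral_mono) (auto split: split_indicator)
  ultimately show ?thesis using assms by (auto simp: l2_funs_iff_nn_integral intro: le_less_trans)
qed

lemma mul_op_bounded [simp, intro]: "A \<in> sets M \<Longrightarrow> mul_op M A \<in> bounded_ops_carr (l2 M)"
  unfolding mul_op_def
proof (rule l2_lift_bounded)
  show "(\<lambda>x. indicator A x * \<phi> x) \<in> l2_funs M" if "A \<in> sets M" "\<phi> \<in> l2_funs M" for \<phi>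
    by (rule l2_funs_indicator[OF that])
  show "(\<integral>\<^sup>+x. ennreal ((cmod (indicator A x * \<phi> x))\<^sup>2) \<partial>M)
      \<le> (\<integral>\<^sup>+x. ennreal ((cmod (\<phi> x))\<^sup>2) \<partial>M)" for \<phi>
    by (intro nn_integral_mono) (auto split: split_indicator)
qed (auto simp: algebra_simps)

lemma mul_op_class:
  "A \<in> sets M \<Longrightarrow> \<phi> \<in> l2_funs M \<Longrightarrow>
    mul_op M A (l2_class M \<phi>) = l2_class M (\<lambda>x. indicator A x * \<phi> x)"
  unfolding mul_op_def by (rule l2_lift_class) (auto intro: l2_funs_indicator)

lemma mul_op_cong:
  assumes "A \<in> sets M" "B \<in> sets M" "AE x in M. x \<in> A \<longleftrightarrow> x \<in> B"
  shows "mul_op M A = mul_op M B"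
proof (rule l2_op_eqI)
  fix \<phi> assume \<phi>: "\<phi> \<in> l2_funs M"
  have "AE x in M. indicator A x * \<phi> x = indicator B x * \<phi> x"
    using assms(3) by eventually_elim (simp add: indicator_def)
  then show "mul_op M A (l2_class M \<phi>) = mul_op M B (l2_class M \<phi>)"
    using \<phi> assms by (simp add: mul_op_class l2_class_eq_iff l2_funs_indicator)
qed (use assms in auto)

lemma mul_op_mult:
  assumes "A \<in> sets M" "B \<in> sets M"
  shows "compose (hcarr (l2 M)) (mul_op M A) (mul_op M B) = mul_op M (A \<inter> B)"
proof (rule l2_op_eqI)
  fix \<phi> assume \<phi>: "\<phi> \<in> l2_funs M"
  have "(\<lambda>x. indicator A x * (indicator B x * \<phi> x)) = (\<lambda>x. indicator (A \<inter> B) x * \<phi> x)"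
    by (auto split: split_indicator)
  then show "compose (hcarr (l2 M)) (mul_op M A) (mul_op M B) (l2_class M \<phi>)
      = mul_op M (A \<inter> B) (l2_class M \<phi>)"
    using assms \<phi> by (simp add: compose_eq mul_op_class l2_funs_indicator)
qed (use assms in auto)

lemma mul_op_adjoint:
  assumes "A \<in> sets M"
  shows "adjoint_op (l2 M) (mul_op M A) = mul_op M A"
proof (rule l2.adjointI)
  fix Y Z assume "Y \<in> hcarr (l2 M)" "Z \<in> hcarr (l2 M)"
  then obtain \<phi> \<psi> where "\<phi> \<in> l2_funs M" "\<psi> \<in> l2_funs M" "Y = l2_class M \<phi>" "Z = l2_class M \<psi>"
    by (auto simp: hcarr_l2)
  then show "hinner (l2 M) (mul_op M A Y) Z = hinner (l2 M) Y (mul_op M A Z)"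
    using assms by (auto simp: mul_op_class hinner_l2_class l2_funs_indicator
        intro!: Bochner_Integration.integral_cong split: split_indicator)
qed (use assms in auto)

text \<open>Vanishing is expressed by the norm, in the absence of a named zero vector; it serves the
  relators that are themselves to be sent to zero.\<close>

lemma mul_op_empty:
  assumes "Y \<in> hcarr (l2 M)"
  shows "hnorm (l2 M) (mul_op M {} Y) = 0"
proof -
  obtain \<phi> where \<phi>: "\<phi> \<in> l2_funs M" "Y = l2_class M \<phi>" using assms by (auto simp: hcarr_l2)
  then show ?thesis using l2_funs_indicator[of "{}" M \<phi>]
    by (simp add: mul_op_class hnorm_l2_class)
qed

section \<open>The partial isometry of a single edge\<close>

context branching_edge
begin

definition S :: "('x \<Rightarrow> complex) set \<Rightarrow> ('x \<Rightarrow> complex) set" where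
  "S = l2_lift M E"

lemma S_bounded [simp, intro]: "S \<in> bounded_ops_carr (l2 M)"
  unfolding S_def
proof (rule l2_lift_bounded)
  show "(\<integral>\<^sup>+x. ennreal ((cmod (E \<phi> x))\<^sup>2) \<partial>M) \<le> (\<integral>\<^sup>+x. ennreal ((cmod (\<phi> x))\<^sup>2) \<partial>M)"
    if "\<phi> \<in> l2_funs M" for \<phi> by (rule nn_integral_E[OF l2_funs_measurable[OF that]])
  show "AE x in M. E \<phi> x = E \<psi> x" if "AE x in M. \<phi> x = \<psi> x" for \<phi> \<psi> by (rule E_cong[OF that])
qed (auto intro: E_l2 simp: E_def fun_eq_iff algebra_simps)

lemma S_class: "\<phi> \<in> l2_funs M \<Longrightarrow> S (l2_class M \<phi>) = l2_class M (E \<phi>)"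
  unfolding S_def by (rule l2_lift_class[OF E_l2 E_cong])

lemma S_adjoint_class:
  assumes \<psi>: "\<psi> \<in> l2_funs M"
  shows "adjoint_op (l2 M) S (l2_class M \<psi>) = l2_class M (F \<psi>)"
proof (rule l2.hilbert_eqI)
  fix Z assume "Z \<in> hcarr (l2 M)"
  then obtain \<phi> where \<phi>: "\<phi> \<in> l2_funs M" "Z = l2_class M \<phi>" by (auto simp: hcarr_l2)
  have "hinner (l2 M) Z (adjoint_op (l2 M) S (l2_class M \<psi>)) = hinner (l2 M) (S Z) (l2_class M \<psi>)"
    using \<phi> \<psi> by (intro l2.inner_adjoint) auto
  also have "\<dots> = hinner (l2 M) Z (l2_class M (F \<psi>))"
    using \<phi> \<psi> by (simp add: S_class hinner_l2_class E_l2 F_l2 E_adjoint l2_funs_measurable)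
  finally have eq: "hinner (l2 M) Z (adjoint_op (l2 M) S (l2_class M \<psi>))
    = hinner (l2 M) Z (l2_class M (F \<psi>))" .
  have "adjoint_op (l2 M) S (l2_class M \<psi>) \<in> hcarr (l2 M)"
    by (rule l2.op_apply[OF l2.adjoint_closed[OF S_bounded] l2_class_in[OF \<psi>]])
  from l2.inner_commute[OF \<open>Z \<in> hcarr (l2 M)\<close> this]
    l2.inner_commute[OF \<open>Z \<in> hcarr (l2 M)\<close> l2_class_in[OF F_l2[OF \<psi>]]]
  show "hinner (l2 M) (adjoint_op (l2 M) S (l2_class M \<psi>)) Z = hinner (l2 M) (l2_class M (F \<psi>)) Z"
    unfolding eq by (rule trans[OF _ sym])
qed (use \<psi> F_l2 in auto)

lemma S_adjoint_S: "compose (hcarr (l2 M)) (adjoint_op (l2 M) S) S = mul_op M D"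
proof (rule l2_op_eqI)
  fix \<phi> assume \<phi>: "\<phi> \<in> l2_funs M"
  then show "compose (hcarr (l2 M)) (adjoint_op (l2 M) S) S (l2_class M \<phi>) = mul_op M D (l2_class M \<phi>)"
    using F_E by (simp add: compose_eq S_class S_adjoint_class E_l2 mul_op_class l2_class_eq_iff F_l2
        l2_funs_indicator)
qed auto

lemma S_S_adjoint: "compose (hcarr (l2 M)) S (adjoint_op (l2 M) S) = mul_op M R"
proof (rule l2_op_eqI)
  fix \<phi> assume \<phi>: "\<phi> \<in> l2_funs M"
  then show "compose (hcarr (l2 M)) S (adjoint_op (l2 M) S) (l2_class M \<phi>) = mul_op M R (l2_class M \<phi>)"
    using E_F by (simp add: compose_eq S_class S_adjoint_class E_l2 mul_op_class l2_class_eq_iff F_l2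
        l2_funs_indicator)
qed auto

text \<open>In view of \<open>S_S_adjoint\<close> this is the equation of a partial isometry; it
  holds because \<open>E \<phi>\<close> vanishes outside \<open>R\<close> by definition.\<close>

lemma mul_op_S: "compose (hcarr (l2 M)) (mul_op M R) S = S"
proof (rule l2_op_eqI)
  fix \<phi> assume \<phi>: "\<phi> \<in> l2_funs M"
  have "(\<lambda>x. indicator R x * E \<phi> x) = E \<phi>" by (auto simp: E_def split: split_indicator)
  then show "compose (hcarr (l2 M)) (mul_op M R) S (l2_class M \<phi>) = S (l2_class M \<phi>)"
    using \<phi> by (simp add: compose_eq S_class E_l2 mul_op_class)
qed auto

end

section \<open>The representation attached to a branching system\<close>

locale ug_branching_system =
  fixes G :: "('v, 'e) ultragraph" and M :: "'x measure" and R :: "'e \<Rightarrow> 'x set"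
    and D :: "'v set \<Rightarrow> 'x set" and f g :: "'e \<Rightarrow> 'x \<Rightarrow> 'x"
  assumes ultragraph: "is_ultragraph G"
    and sigma_finite: "sigma_finite_measure M"
    and system: "branching_system G M R D f g"
begin

lemma R_sets: "e \<in> edges G \<Longrightarrow> R e \<in> sets M"
  and D_sets: "A \<in> gverts G \<Longrightarrow> D A \<in> sets M"
  and R_disjoint: "e \<in> edges G \<Longrightarrow> e' \<in> edges G \<Longrightarrow> e \<noteq> e' \<Longrightarrow> AE x in M. x \<notin> R e \<inter> R e'"
  and D_empty: "D {} = {}"
  and D_inter: "A \<in> gverts G \<Longrightarrow> B \<in> gverts G \<Longrightarrow> AE x in M. x \<in> D A \<inter> D B \<longleftrightarrow> x \<in> D (A \<inter> B)"
  and D_union: "A \<in> gverts G \<Longrightarrow> B \<in> gverts G \<Longrightarrow> AE x in M. x \<in> D A \<union> D B \<longleftrightarrow> x \<in> D (A \<union> B)"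
  and R_src: "e \<in> edges G \<Longrightarrow> AE x in M. x \<in> R e \<longrightarrow> x \<in> D {src G e}"
  and D_vertex: "v \<in> verts G \<Longrightarrow> finite (out_edges G v) \<Longrightarrow> out_edges G v \<noteq> {} \<Longrightarrow>
    AE x in M. x \<in> D {v} \<longleftrightarrow> x \<in> (\<Union>e\<in>out_edges G v. R e)"
proof -
  note sys = system[unfolded branching_system_def]
  show "e \<in> edges G \<Longrightarrow> R e \<in> sets M" using conjunct1[OF sys] by blast
  note sys = conjunct2[OF sys]
  show "A \<in> gverts G \<Longrightarrow> D A \<in> sets M" using conjunct1[OF sys] by blast
  note sys = conjunct2[OF sys]
  show "e \<in> edges G \<Longrightarrow> e' \<in> edges G \<Longrightarrow> e \<noteq> e' \<Longrightarrow> AE x in M. x \<notin> R e \<inter> R e'"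
    using conjunct1[OF sys] by blast
  note sys = conjunct2[OF sys]
  show "D {} = {}" by (rule conjunct1[OF sys])
  note sys = conjunct2[OF sys]
  show "A \<in> gverts G \<Longrightarrow> B \<in> gverts G \<Longrightarrow> AE x in M. x \<in> D A \<inter> D B \<longleftrightarrow> x \<in> D (A \<inter> B)"
    by (rule conjunct1[OF sys, rule_format])
  note sys = conjunct2[OF sys]
  show "A \<in> gverts G \<Longrightarrow> B \<in> gverts G \<Longrightarrow> AE x in M. x \<in> D A \<union> D B \<longleftrightarrow> x \<in> D (A \<union> B)"
    by (rule conjunct1[OF sys, rule_format])
  note sys = conjunct2[OF sys]
  show "e \<in> edges G \<Longrightarrow> AE x in M. x \<in> R e \<longrightarrow> x \<in> D {src G e}"
    by (rule bspec[OF conjunct1[OF sys]])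
  note sys = conjunct2[OF sys]
  show "v \<in> verts G \<Longrightarrow> finite (out_edges G v) \<Longrightarrow> out_edges G v \<noteq> {} \<Longrightarrow>
      AE x in M. x \<in> D {v} \<longleftrightarrow> x \<in> (\<Union>e\<in>out_edges G v. R e)"
    by (rule bspec[OF conjunct1[OF sys], THEN mp]) auto
qed

lemma edge:
  assumes e: "e \<in> edges G"
  shows "branching_edge M (D (rng G e)) (R e) (f e) (g e)"
proof (rule branching_edge.intro)
  have "let MD = restrict_space M (D (rng G e)); MR = restrict_space M (R e) in
        f e \<in> measurable MD MR \<and>
        g e \<in> measurable MR MD \<and>
        (AE x in MR. f e (g e x) = x) \<and>
        (AE x in MD. g e (f e x) = x) \<and>
        absolutely_continuous MD (distr MR MD (g e)) \<and>
        absolutely_continuous MR (distr MD MR (f e))"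
    using system unfolding branching_system_def by (elim conjE) (rule bspec[OF _ e])
  then show "f e \<in> measurable (restrict_space M (D (rng G e))) (restrict_space M (R e))"
    "g e \<in> measurable (restrict_space M (R e)) (restrict_space M (D (rng G e)))"
    "AE x in restrict_space M (R e). f e (g e x) = x"
    "AE x in restrict_space M (D (rng G e)). g e (f e x) = x"
    "absolutely_continuous (restrict_space M (D (rng G e)))
      (distr (restrict_space M (R e)) (restrict_space M (D (rng G e))) (g e))"
    "absolutely_continuous (restrict_space M (R e))
      (distr (restrict_space M (D (rng G e))) (restrict_space M (R e)) (f e))"
    unfolding Let_def by blast+
  show "sigma_finite_measure M" by (rule sigma_finite)
  show "R e \<in> sets M" "D (rng G e) \<in> sets M" using e by (auto intro: R_sets D_sets gverts.range)
qed

definition S :: "'e \<Rightarrow> ('x \<Rightarrow> complex) set \<Rightarrow> ('x \<Rightarrow> complex) set" where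
  "S e = branching_edge.S M (D (rng G e)) (R e) (f e) (g e)"

definition T :: "('v, 'e) gen \<Rightarrow> ('x \<Rightarrow> complex) set \<Rightarrow> ('x \<Rightarrow> complex) set" where
  "T = case_gen S (\<lambda>A. mul_op M (D A))"

lemma T_bounded: "\<forall>x\<in>ug_gens G. T x \<in> bounded_ops_carr (l2 M)"
  using branching_edge.S_bounded[OF edge] D_sets by (auto simp: T_def S_def)

definition \<rho> :: "('v, 'e) gen star_poly \<Rightarrow> ('x \<Rightarrow> complex) set \<Rightarrow> ('x \<Rightarrow> complex) set" where
  "\<rho> = (SOME \<rho>. \<rho> \<in> star_homs (free_star_algebra (ug_gens G)) (bounded_ops (l2 M)) \<and>
    (\<forall>x\<in>ug_gens G. \<rho> (sp_var x) = T x))"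

lemma \<rho>: "\<rho> \<in> star_homs (free_star_algebra (ug_gens G)) (bounded_ops (l2 M))"
  and \<rho>_var: "x \<in> ug_gens G \<Longrightarrow> \<rho> (sp_var x) = T x"
proof -
  have "\<exists>\<rho>. \<rho> \<in> star_homs (free_star_algebra (ug_gens G)) (bounded_ops (l2 M)) \<and>
    (\<forall>x\<in>ug_gens G. \<rho> (sp_var x) = T x)"
    by (rule l2.free_star_algebra_universal[OF T_bounded]) blast
  then have "\<rho> \<in> star_homs (free_star_algebra (ug_gens G)) (bounded_ops (l2 M)) \<and>
    (\<forall>x\<in>ug_gens G. \<rho> (sp_var x) = T x)"
    unfolding \<rho>_def by (rule someI_ex)
  then show "\<rho> \<in> star_homs (free_star_algebra (ug_gens G)) (bounded_ops (l2 M))"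
    and "x \<in> ug_gens G \<Longrightarrow> \<rho> (sp_var x) = T x" by blast+
qed

abbreviation "\<Gamma> \<equiv> sp_carr (ug_gens G)"

lemma sE_in [simp]: "e \<in> edges G \<Longrightarrow> sE e \<in> \<Gamma>"
  and pV_in [simp]: "A \<in> gverts G \<Longrightarrow> pV A \<in> \<Gamma>"
  by (auto intro!: sp_carr_var)

lemma \<rho>_edge: "e \<in> edges G \<Longrightarrow> \<rho> (sE e) = S e"
  and \<rho>_vert: "A \<in> gverts G \<Longrightarrow> \<rho> (pV A) = mul_op M (D A)"
  by (simp_all add: \<rho>_var T_def)

lemma \<rho>_closed: "x \<in> \<Gamma> \<Longrightarrow> \<rho> x \<in> bounded_ops_carr (l2 M)"
  using star_homsD(1)[OF \<rho>] by simp

lemma \<rho>_mult: "x \<in> \<Gamma> \<Longrightarrow> y \<in> \<Gamma> \<Longrightarrow> \<rho> (x \<odot> y) = compose (hcarr (l2 M)) (\<rho> x) (\<rho> y)"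
  using star_homsD(4)[OF \<rho>, of x y] by simp

lemma \<rho>_star: "x \<in> \<Gamma> \<Longrightarrow> \<rho> (sp_star x) = adjoint_op (l2 M) (\<rho> x)"
  using star_homsD(5)[OF \<rho>, of x] by simp

lemma \<rho>_add: "x \<in> \<Gamma> \<Longrightarrow> y \<in> \<Gamma> \<Longrightarrow> \<rho> (x + y) = add (bounded_ops (l2 M)) (\<rho> x) (\<rho> y)"
  using star_homsD(2)[OF \<rho>, of x y] by simp

lemma \<rho>_diff:
  assumes x: "x \<in> \<Gamma>" and y: "y \<in> \<Gamma>"
  shows "\<rho> (x - y) = add (bounded_ops (l2 M)) (\<rho> x) (scale (bounded_ops (l2 M)) (-1) (\<rho> y))"
  unfolding sp_diff_eq \<rho>_add[OF x sp_carr_scale[OF y]]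
  using star_homsD(3)[OF \<rho> y, of "-1"] by (simp only: free_star_algebra_simps)

lemma \<rho>_source:
  assumes "e \<in> edges G"
  shows "\<rho> (sp_star (sE e) \<odot> sE e) = mul_op M (D (rng G e))"
proof -
  have "\<rho> (sp_star (sE e) \<odot> sE e) = compose (hcarr (l2 M)) (\<rho> (sp_star (sE e))) (\<rho> (sE e))"
    using assms by (intro \<rho>_mult sp_carr_star sE_in)
  also have "\<rho> (sp_star (sE e)) = adjoint_op (l2 M) (\<rho> (sE e))"
    using assms by (intro \<rho>_star sE_in)
  finally show ?thesis
    unfolding \<rho>_edge[OF assms] S_def branching_edge.S_adjoint_S[OF edge[OF assms]] .
qed

lemma \<rho>_range:
  assumes "e \<in> edges G"
  shows "\<rho> (sE e \<odot> sp_star (sE e)) = mul_op M (R e)"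
proof -
  have "\<rho> (sE e \<odot> sp_star (sE e)) = compose (hcarr (l2 M)) (\<rho> (sE e)) (\<rho> (sp_star (sE e)))"
    using assms by (intro \<rho>_mult sp_carr_star sE_in)
  also have "\<rho> (sp_star (sE e)) = adjoint_op (l2 M) (\<rho> (sE e))"
    using assms by (intro \<rho>_star sE_in)
  finally show ?thesis
    unfolding \<rho>_edge[OF assms] S_def branching_edge.S_S_adjoint[OF edge[OF assms]] .
qed

lemma opnorm_eq_0I:
  assumes "\<And>Y. Y \<in> hcarr (l2 M) \<Longrightarrow> hnorm (l2 M) (U Y) = 0" "U \<in> bounded_ops_carr (l2 M)"
  shows "nrm (bounded_ops (l2 M)) U = 0"
proof (rule antisym)
  show "nrm (bounded_ops (l2 M)) U \<le> 0"
    by (rule l2.opnorm_le[OF assms(2)]) (simp_all add: assms(1))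
  show "0 \<le> nrm (bounded_ops (l2 M)) U" by (rule l2.opnorm_nonneg[OF assms(2)])
qed

text \<open>Most relators are differences, and for these it is enough that both sides have the same
  image; the seminorm of the relator is then the norm of an operator minus itself.\<close>

lemma opnorm_\<rho>_diff:
  assumes x: "x \<in> \<Gamma>" and y: "y \<in> \<Gamma>" and eq: "\<rho> x = \<rho> y"
  shows "nrm (bounded_ops (l2 M)) (\<rho> (x - y)) = 0"
proof (rule opnorm_eq_0I)
  fix Y assume Y: "Y \<in> hcarr (l2 M)"
  have "\<rho> (x - y) = add (bounded_ops (l2 M)) (\<rho> x) (scale (bounded_ops (l2 M)) (-1) (\<rho> x))"
    using \<rho>_diff[OF x y] eq by simp
  then have "\<rho> (x - y) Y = hadd (l2 M) (\<rho> x Y) (hscale (l2 M) (-1) (\<rho> x Y))" using Y by simp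
  moreover have "\<rho> x Y \<in> hcarr (l2 M)" by (rule l2.op_apply[OF \<rho>_closed[OF x] Y])
  ultimately show "hnorm (l2 M) (\<rho> (x - y) Y) = 0"
    using hdiff_l2_class[of "rep (\<rho> x Y)" M "rep (\<rho> x Y)"] rep_l2[of "\<rho> x Y" M]
      hnorm_l2_class[of "\<lambda>x. 0" M] by (simp add: l2_funs_def)
qed (use assms \<rho>_closed in blast)

text \<open>The induction starts at one edge, as the empty sum would need the image of zero. Square
  integrability is carried along because \<open>hadd_l2_class\<close> asks for it at each
  addition.\<close>

lemma \<rho>_sum_ranges:
  assumes "finite I" "I \<noteq> {}" "I \<subseteq> edges G" and \<phi>: "\<phi> \<in> l2_funs M"
  shows "\<rho> (\<Sum>e\<in>I. sE e \<odot> sp_star (sE e)) (l2_class M \<phi>)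
      = l2_class M (\<lambda>x. (\<Sum>e\<in>I. indicator (R e) x) * \<phi> x) \<and>
    (\<lambda>x. (\<Sum>e\<in>I. indicator (R e) x) * \<phi> x) \<in> l2_funs M"
  using assms(1-3)
proof (induction I rule: finite_ne_induct)
  case (singleton e)
  then show ?case using \<phi> R_sets by (simp add: \<rho>_range mul_op_class l2_funs_indicator)
next
  case (insert e I)
  have in_\<Gamma>: "sE e \<odot> sp_star (sE e) \<in> \<Gamma>" "(\<Sum>e\<in>I. sE e \<odot> sp_star (sE e)) \<in> \<Gamma>"
    using insert by (auto intro!: sp_carr_sum sp_carr_mult sp_carr_star)
  have e: "e \<in> edges G" using insert.prems by simp
  have "\<rho> (\<Sum>e\<in>insert e I. sE e \<odot> sp_star (sE e))
      = add (bounded_ops (l2 M)) (mul_op M (R e)) (\<rho> (\<Sum>e\<in>I. sE e \<odot> sp_star (sE e)))"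
    unfolding sum.insert[OF insert.hyps(1,3)] \<rho>_add[OF in_\<Gamma>] \<rho>_range[OF e] ..
  then have "\<rho> (\<Sum>e\<in>insert e I. sE e \<odot> sp_star (sE e)) (l2_class M \<phi>)
      = hadd (l2 M) (mul_op M (R e) (l2_class M \<phi>))
          (\<rho> (\<Sum>e\<in>I. sE e \<odot> sp_star (sE e)) (l2_class M \<phi>))"
    using l2_class_in[OF \<phi>] by simp
  moreover have IH: "\<rho> (\<Sum>e\<in>I. sE e \<odot> sp_star (sE e)) (l2_class M \<phi>)
      = l2_class M (\<lambda>x. (\<Sum>e\<in>I. indicator (R e) x) * \<phi> x)"
    "(\<lambda>x. (\<Sum>e\<in>I. indicator (R e) x) * \<phi> x) \<in> l2_funs M"
    using insert by auto
  moreover have "(\<lambda>x. (\<Sum>e\<in>insert e I. indicator (R e) x) * \<phi> x)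
      = (\<lambda>x. indicator (R e) x * \<phi> x + (\<Sum>e\<in>I. indicator (R e) x) * \<phi> x)"
    using insert.hyps by (simp add: distrib_right)
  ultimately show ?case
    using mul_op_class[OF R_sets[OF e] \<phi>] l2_funs_indicator[OF R_sets[OF e] \<phi>]
    by (simp only: hadd_l2_class l2_funs_add simp_thms)
qed

text \<open>After \<open>\<rho>_source\<close> and \<open>\<rho>_range\<close> have identified the
  products of an edge with its adjoint, every relation but the partial isometry one concerns
  multiplication by indicators only, that is, sets up to null sets, and is read off from the
  conditions of the system.\<close>

lemma opnorm_\<rho>_relator:
  assumes "t \<in> relators G"
  shows "nrm (bounded_ops (l2 M)) (\<rho> t) = 0"
  using assms
proof cases
  case (partial_isometry e)
  note e = partial_isometry(2)
  have "\<rho> (sE e \<odot> sp_star (sE e) \<odot> sE e) = compose (hcarr (l2 M)) (mul_op M (R e)) (S e)"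
    using \<rho>_mult[OF sp_carr_mult[OF sE_in sp_carr_star[OF sE_in]] sE_in, OF e e e]
    unfolding \<rho>_range[OF e] \<rho>_edge[OF e] .
  also have "\<dots> = \<rho> (sE e)"
    unfolding \<rho>_edge[OF e] S_def by (rule branching_edge.mul_op_S[OF edge[OF e]])
  finally show ?thesis
    unfolding partial_isometry(1)
    by (intro opnorm_\<rho>_diff sp_carr_mult sp_carr_star sE_in e)
next
  case (orthogonal_ranges e e')
  note e = orthogonal_ranges(2,3)
  have "\<rho> t = compose (hcarr (l2 M)) (mul_op M (R e)) (mul_op M (R e'))"
    unfolding orthogonal_ranges(1) \<rho>_range[OF e(1), symmetric] \<rho>_range[OF e(2), symmetric]
    by (intro \<rho>_mult sp_carr_mult sp_carr_star sE_in e)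
  also have "\<dots> = mul_op M (R e \<inter> R e')" by (intro mul_op_mult R_sets e)
  also have "\<dots> = mul_op M {}"
    using R_disjoint[OF e orthogonal_ranges(4)] R_sets[OF e(1)] R_sets[OF e(2)]
    by (intro mul_op_cong) auto
  finally show ?thesis by (intro opnorm_eq_0I) (auto simp: mul_op_empty)
next
  case (proj_selfadjoint A)
  have "\<rho> (sp_star (pV A)) = \<rho> (pV A)"
    unfolding \<rho>_star[OF pV_in[OF proj_selfadjoint(2)]] \<rho>_vert[OF proj_selfadjoint(2)]
    by (rule mul_op_adjoint[OF D_sets[OF proj_selfadjoint(2)]])
  then show ?thesis
    unfolding proj_selfadjoint(1) by (intro opnorm_\<rho>_diff sp_carr_star pV_in proj_selfadjoint(2))
next
  case (proj_idempotent A)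
  note A = proj_idempotent(2)
  have "\<rho> (pV A \<odot> pV A) = \<rho> (pV A)"
    unfolding \<rho>_mult[OF pV_in[OF A] pV_in[OF A]] \<rho>_vert[OF A] mul_op_mult[OF D_sets[OF A] D_sets[OF A]]
    by simp
  then show ?thesis
    unfolding proj_idempotent(1) by (intro opnorm_\<rho>_diff sp_carr_mult pV_in A)
next
  case proj_empty
  then show ?thesis
    using \<rho>_vert[OF gverts.empty] by (intro opnorm_eq_0I) (auto simp: D_empty mul_op_empty)
next
  case (proj_inter A B)
  note AB = proj_inter(2,3) gverts.inter[OF proj_inter(2,3)]
  have "\<rho> (pV A \<odot> pV B) = mul_op M (D A \<inter> D B)"
    unfolding \<rho>_mult[OF pV_in[OF AB(1)] pV_in[OF AB(2)]] \<rho>_vert[OF AB(1)] \<rho>_vert[OF AB(2)]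
    by (intro mul_op_mult D_sets AB)
  also have "\<dots> = \<rho> (pV (A \<inter> B))"
    unfolding \<rho>_vert[OF AB(3)] by (intro mul_op_cong sets.Int D_sets AB D_inter)
  finally show ?thesis
    unfolding proj_inter(1) by (intro opnorm_\<rho>_diff sp_carr_mult pV_in AB)
next
  case (proj_union A B)
  note AB = proj_union(2,3) gverts.union[OF proj_union(2,3)] gverts.inter[OF proj_union(2,3)]
  have \<rho>_sum: "\<rho> (pV A + pV B - pV (A \<inter> B)) = add (bounded_ops (l2 M))
      (add (bounded_ops (l2 M)) (mul_op M (D A)) (mul_op M (D B)))
      (scale (bounded_ops (l2 M)) (-1) (mul_op M (D (A \<inter> B))))"
    unfolding \<rho>_diff[OF sp_carr_add[OF pV_in[OF AB(1)] pV_in[OF AB(2)]] pV_in[OF AB(4)]]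
      \<rho>_add[OF pV_in[OF AB(1)] pV_in[OF AB(2)]] \<rho>_vert[OF AB(1)] \<rho>_vert[OF AB(2)]
      \<rho>_vert[OF AB(4)] ..
  show ?thesis unfolding proj_union(1)
  proof (rule opnorm_\<rho>_diff)
    show "\<rho> (pV (A \<union> B)) = \<rho> (pV A + pV B - pV (A \<inter> B))"
      unfolding \<rho>_sum \<rho>_vert[OF AB(3)]
    proof (rule l2_op_eqI)
      fix \<phi> assume \<phi>: "\<phi> \<in> l2_funs M"
      note ind = l2_funs_indicator[OF D_sets \<phi>] l2_funs_add l2_funs_diff
        l2_funs_scale[of _ M "-1", simplified]
      have "AE x in M. indicator (D (A \<union> B)) x * \<phi> x
          = indicator (D A) x * \<phi> x + indicator (D B) x * \<phi> x - indicator (D (A \<inter> B)) x * \<phi> x"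
        using D_inter[OF AB(1,2)] D_union[OF AB(1,2)]
        by eventually_elim (auto simp: indicator_def)
      then have "l2_class M (\<lambda>x. indicator (D (A \<union> B)) x * \<phi> x) = l2_class M (\<lambda>x.
          indicator (D A) x * \<phi> x + indicator (D B) x * \<phi> x - indicator (D (A \<inter> B)) x * \<phi> x)"
        using AB by (subst l2_class_eq_iff) (auto intro!: ind)
      then show "mul_op M (D (A \<union> B)) (l2_class M \<phi>) = add (bounded_ops (l2 M))
          (add (bounded_ops (l2 M)) (mul_op M (D A)) (mul_op M (D B)))
          (scale (bounded_ops (l2 M)) (-1) (mul_op M (D (A \<inter> B)))) (l2_class M \<phi>)"
        using \<phi> AB D_sets
        by (simp add: mul_op_class hadd_l2_class hscale_l2_class ind)
    qed (use AB D_sets in auto)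
  qed (intro sp_carr_diff sp_carr_add pV_in AB)+
next
  case (source_projection e)
  note r = gverts.range[OF source_projection(2)]
  have "\<rho> (sp_star (sE e) \<odot> sE e) = \<rho> (pV (rng G e))"
    unfolding \<rho>_source[OF source_projection(2)] \<rho>_vert[OF r] ..
  then show ?thesis
    unfolding source_projection(1)
    by (intro opnorm_\<rho>_diff sp_carr_mult sp_carr_star pV_in sE_in source_projection(2) r)
next
  case (range_projection e)
  note e = range_projection(2)
  have v: "{src G e} \<in> gverts G" by (intro gverts.vertex src_in_verts ultragraph e)
  have ss: "sE e \<odot> sp_star (sE e) \<in> \<Gamma>" by (intro sp_carr_mult sp_carr_star sE_in e)
  have "\<rho> (pV {src G e} \<odot> (sE e \<odot> sp_star (sE e)))
      = compose (hcarr (l2 M)) (mul_op M (D {src G e})) (mul_op M (R e))"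
    unfolding \<rho>_mult[OF pV_in[OF v] ss] \<rho>_range[OF e] \<rho>_vert[OF v] ..
  also have "\<dots> = mul_op M (D {src G e} \<inter> R e)"
    by (intro mul_op_mult D_sets R_sets v e)
  also have "\<dots> = \<rho> (sE e \<odot> sp_star (sE e))"
    unfolding \<rho>_range[OF e]
    using R_src[OF e] D_sets[OF v] R_sets[OF e] by (intro mul_op_cong) auto
  finally show ?thesis
    unfolding range_projection(1) by (intro opnorm_\<rho>_diff sp_carr_mult pV_in v ss)
next
  case (vertex_sum v)
  let ?I = "out_edges G v"
  have I: "?I \<subseteq> edges G" by (auto simp: out_edges_def)
  have v: "{v} \<in> gverts G" using vertex_sum(2) by (rule gverts.vertex)
  have sum_in: "(\<Sum>e\<in>?I. sE e \<odot> sp_star (sE e)) \<in> \<Gamma>"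
    using I by (intro sp_carr_sum sp_carr_mult sp_carr_star sE_in) auto
  \<comment> \<open>Pairwise disjointness holds off one null set per pair; there are finitely many
    pairs, so a single null set serves for all.\<close>
  have "AE x in M. \<forall>e\<in>?I. \<forall>e'\<in>?I. e \<noteq> e' \<longrightarrow> x \<notin> R e \<inter> R e'"
    using vertex_sum(3) R_disjoint I by (intro AE_finite_allI) auto
  then have ind: "AE x in M. indicator (D {v}) x = (\<Sum>e\<in>?I. indicator (R e) x :: complex)"
    using D_vertex[OF vertex_sum(2-4)]
  proof eventually_elim
    case (elim x)
    show ?case
    proof (cases "\<exists>e\<in>?I. x \<in> R e")
      case True
      then obtain e where e: "e \<in> ?I" "x \<in> R e" by blast
      \<comment> \<open>Disjointness leaves one nonzero summand, so the sum of the indicators is the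
        indicator of the union and not a multiplicity.\<close>
      have "(\<Sum>e\<in>?I. indicator (R e) x :: complex) = (\<Sum>e'\<in>?I. if e' = e then 1 else 0)"
        using elim(1) e by (intro sum.cong) (auto simp: indicator_def)
      then show ?thesis using e elim(2) vertex_sum(3) by (auto simp: indicator_def)
    next
      case False
      then show ?thesis using elim(2) by (auto simp: indicator_def intro!: sum.neutral)
    qed
  qed
  show ?thesis unfolding vertex_sum(1)
  proof (rule opnorm_\<rho>_diff)
    show "\<rho> (pV {v}) = \<rho> (\<Sum>e\<in>?I. sE e \<odot> sp_star (sE e))"
      unfolding \<rho>_vert[OF v]
    proof (rule l2_op_eqI)
      fix \<phi> assume \<phi>: "\<phi> \<in> l2_funs M"
      have "AE x in M. indicator (D {v}) x * \<phi> x = (\<Sum>e\<in>?I. indicator (R e) x) * \<phi> x"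
        using ind by eventually_elim simp
      then show "mul_op M (D {v}) (l2_class M \<phi>)
          = \<rho> (\<Sum>e\<in>?I. sE e \<odot> sp_star (sE e)) (l2_class M \<phi>)"
        using \<rho>_sum_ranges[OF vertex_sum(3,4) I \<phi>] \<phi> D_sets[OF v]
        by (simp add: mul_op_class l2_class_eq_iff l2_funs_indicator)
    qed (use D_sets[OF v] \<rho>_closed[OF sum_in] in auto)
  qed (use v sum_in in auto)
qed

text \<open>The left-hand side, as a function of \<open>x\<close>, is a C*-seminorm vanishing on the
  relators, hence one of those whose supremum is the universal norm.\<close>

lemma opnorm_\<rho>_le:
  assumes "x \<in> \<Gamma>"
  shows "nrm (bounded_ops (l2 M)) (\<rho> x) \<le> ug_norm G x"
proof (rule ug_norm_upper[OF _ assms])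
  have "cstar_seminorm (free_star_algebra (ug_gens G)) (\<lambda>x. nrm (bounded_ops (l2 M)) (\<rho> x))"
    by (rule cstar_seminorm_compose[OF \<rho> l2.cstar_seminorm_opnorm])
      (simp only: free_star_algebra_simps sp_carr_star)
  then show "(\<lambda>x. nrm (bounded_ops (l2 M)) (\<rho> x)) \<in> ug_seminorms G"
    by (simp add: ug_seminorms_def ug_free_def opnorm_\<rho>_relator)
qed

lemma S_class:
  assumes "e \<in> edges G" "\<phi> \<in> l2_funs M"
  shows "S e (l2_class M \<phi>) = l2_class M (\<lambda>x. if x \<in> R e
    then complex_of_real (sqrt (RN_inv G M R D f e x)) * \<phi> (g e x) else 0)"
  using branching_edge.S_class[OF edge[OF assms(1)] assms(2)]
  unfolding S_def branching_edge.E_def[OF edge[OF assms(1)], abs_def]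
    branching_edge.\<Phi>_def[OF edge[OF assms(1)]] RN_inv_def .

theorem ex1_representation:
  "\<exists>!\<pi>. \<pi> \<in> star_homs (ug_cstar G) (bounded_ops (l2 M)) \<and>
    (\<forall>e\<in>edges G. \<forall>\<phi>\<in>l2_funs M. \<pi> (s_gen G e) (l2_class M \<phi>) = S e (l2_class M \<phi>)) \<and>
    (\<forall>A\<in>gverts G. \<forall>\<phi>\<in>l2_funs M. \<pi> (p_gen G A) (l2_class M \<phi>) = mul_op M (D A) (l2_class M \<phi>))"
    (is "\<exists>!\<pi>. ?P \<pi>")
proof -
  interpret completion_rep "l2 M" "ug_gens G" "ug_norm G"
    by (intro completion_rep.intro hilbert_space_l2 sp_cstar_seminorm.intro cstar_seminorm_ug_norm)
  have ext: "extension \<rho> (to_completion \<A> (ug_norm G) x) = \<rho> x" if "x \<in> \<Gamma>" for x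
    by (rule extension_to_completion[OF \<rho> _ that]) (rule opnorm_\<rho>_le)
  have ext_hom: "extension \<rho> \<in> star_homs \<C> (bounded_ops (l2 M))"
    by (rule extension_hom[OF \<rho>]) (rule opnorm_\<rho>_le)
  have C: "ug_cstar G = \<C>" by (simp add: ug_cstar_def ug_free_def)
  have gen: "s_gen G e = to_completion \<A> (ug_norm G) (sE e)"
    "p_gen G A = to_completion \<A> (ug_norm G) (pV A)" for e A
    by (simp_all add: s_gen_def p_gen_def ug_free_def)
  show ?thesis
  proof (rule ex1I)
    have "extension \<rho> (s_gen G e) = S e" if "e \<in> edges G" for e
      unfolding gen ext[OF sE_in[OF that]] by (rule \<rho>_edge[OF that])
    moreover have "extension \<rho> (p_gen G A) = mul_op M (D A)" if "A \<in> gverts G" for A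
      unfolding gen ext[OF pV_in[OF that]] by (rule \<rho>_vert[OF that])
    ultimately show "?P (extension \<rho>)"
      unfolding C using ext_hom by (intro conjI ballI) simp_all
    fix \<pi> assume \<pi>: "?P \<pi>"
    show "\<pi> = extension \<rho>"
    proof (rule completion_homs_eqI)
      show \<pi>_hom: "\<pi> \<in> star_homs \<C> (bounded_ops (l2 M))" using \<pi> by (simp add: C)
      show "extension \<rho> \<in> star_homs \<C> (bounded_ops (l2 M))" by (rule ext_hom)
      \<comment> \<open>The empty set counts as a generalized vertex, so there is a generator even
        for an ultragraph without vertices.\<close>
      show "ug_gens G \<noteq> {}" using gverts.empty[of G] by blast
      fix x assume x: "x \<in> ug_gens G"
      have in_C: "to_completion \<A> (ug_norm G) (sp_var x) \<in> carr \<C>"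
        using star_homsD(1)[OF to_completion_hom sp_carr_var[OF x]] sp_carr_var[OF x] by simp
      have "\<pi> (to_completion \<A> (ug_norm G) (sp_var x)) = T x"
      proof (rule l2_op_eqI)
        show "\<pi> (to_completion \<A> (ug_norm G) (sp_var x)) \<in> bounded_ops_carr (l2 M)"
          using star_homsD(1)[OF \<pi>_hom in_C] by simp
        show "T x \<in> bounded_ops_carr (l2 M)" using T_bounded x by blast
        fix \<phi> assume \<phi>: "\<phi> \<in> l2_funs M"
        show "\<pi> (to_completion \<A> (ug_norm G) (sp_var x)) (l2_class M \<phi>) = T x (l2_class M \<phi>)"
        proof (cases x)
          case (Edge e)
          with x have "e \<in> edges G" by auto
          then have "\<pi> (s_gen G e) (l2_class M \<phi>) = S e (l2_class M \<phi>)" using \<pi> \<phi> by blast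
          then show ?thesis by (simp add: Edge T_def gen)
        next
          case (GVert A)
          with x have "A \<in> gverts G" by auto
          then have "\<pi> (p_gen G A) (l2_class M \<phi>) = mul_op M (D A) (l2_class M \<phi>)" using \<pi> \<phi> by blast
          then show ?thesis by (simp add: GVert T_def gen)
        qed
      qed
      then show "\<pi> (to_completion \<A> (ug_norm G) (sp_var x))
          = extension \<rho> (to_completion \<A> (ug_norm G) (sp_var x))"
        unfolding ext[OF sp_carr_var[OF x]] \<rho>_var[OF x] .
    qed
  qed
qed

end

theorem theorem4p1:
  fixes G :: "('v, 'e) ultragraph"
    and M :: "'x measure"
    and R :: "'e \<Rightarrow> 'x set"
    and D :: "'v set \<Rightarrow> 'x set"
    and f g :: "'e \<Rightarrow> 'x \<Rightarrow> 'x"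
  assumes "is_ultragraph G"
    and "sigma_finite_measure M"
    and "h_separable (l2 M)"
    and "h_infinite_dimensional (l2 M)"
    and "branching_system G M R D f g"
  shows "\<exists>!\<pi>. \<pi> \<in> star_homs (ug_cstar G) (bounded_ops (l2 M)) \<and>
    (\<forall>e\<in>edges G. \<forall>\<phi>\<in>l2_funs M.
       \<pi> (s_gen G e) (l2_class M \<phi>) =
       l2_class M (\<lambda>x. if x \<in> R e then complex_of_real (sqrt (RN_inv G M R D f e x)) * \<phi> (g e x)
                       else 0)) \<and>
    (\<forall>A\<in>gverts G. \<forall>\<phi>\<in>l2_funs M.
       \<pi> (p_gen G A) (l2_class M \<phi>) = l2_class M (\<lambda>x. indicator (D A) x * \<phi> x))"
proof -
  interpret ug_branching_system G M R D f g
    by (rule ug_branching_system.intro[OF assms(1,2,5)])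
  have s: "(\<forall>e\<in>edges G. \<forall>\<phi>\<in>l2_funs M. \<pi> (s_gen G e) (l2_class M \<phi>) = S e (l2_class M \<phi>)) \<longleftrightarrow>
      (\<forall>e\<in>edges G. \<forall>\<phi>\<in>l2_funs M. \<pi> (s_gen G e) (l2_class M \<phi>) =
         l2_class M (\<lambda>x. if x \<in> R e
           then complex_of_real (sqrt (RN_inv G M R D f e x)) * \<phi> (g e x) else 0))" for \<pi>
    by (intro ball_cong refl) (simp only: S_class)
  have p: "(\<forall>A\<in>gverts G. \<forall>\<phi>\<in>l2_funs M.
        \<pi> (p_gen G A) (l2_class M \<phi>) = mul_op M (D A) (l2_class M \<phi>)) \<longleftrightarrow>
      (\<forall>A\<in>gverts G. \<forall>\<phi>\<in>l2_funs M.
        \<pi> (p_gen G A) (l2_class M \<phi>) = l2_class M (\<lambda>x. indicator (D A) x * \<phi> x))" for \<pi>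
    by (intro ball_cong refl) (simp only: mul_op_class D_sets)
  show ?thesis using ex1_representation unfolding s p .
qed

end
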